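(* Let $d\ge1$ be an integer, let $\alpha\in(0,d/2)$, and let $\Delta\subset\mathbb{R}^d$ be a bounded convex Jordan-measurable set with $|\Delta|>0$ containing the origin in its interior. Then the distribution of the Rosenblatt-type random variable $$X_2(\Delta)=c_2(d,\alpha)\int_{\mathbb{R}^{2d}}^{\prime}K_\Delta(\lambda_1+\lambda_2)\frac{W(d\lambda_1)W(d\lambda_2)}{\|\lambda_1\|^{(d-\alpha)/2}\|\lambda_2\|^{(d-\alpha)/2}}$$ has a bounded probability density function: $$\sup_{z\in\mathbb{R}}p_{X_2(\Delta)}(z)=\sup_{z\in\mathbb{R}}\frac{d}{dz}P\left(X_2(\Delta)\le z\right)<+\infty.$$
   Context: $|\cdot|$ is Lebesgue measure and $\|\cdot\|$ the Euclidean norm on $\mathbb{R}^d$. $K_\Delta(x)=\int_\Delta e^{i(x,u)}\,du$ for $x\in\mathbb{R}^d$, and $$c_2(d,\alpha)=\frac{\Gamma\left(\frac{d-\alpha}{2}\right)}{2^{\alpha}\pi^{d/2}\Gamma\left(\frac{\alpha}{2}\right)}.$$ $W$ is the complex Gaussian white noise random measure on $\mathbb{R}^d$ (with $W(-A)=\overline{W(A)}$ and $\mathbf{E}|W(A)|^2=|A|$), and $\int'$ denotes the multiple (here double) Wiener–Itô integral. The probability distribution of $X_2(\Delta)$ is called the Rosenblatt-type distribution. *)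

theory Defs
  imports "HOL-Probability.Probability"
begin

section \<open>Gaussian variables and the complex white noise\<close>

text \<open>Degenerate laws count as Gaussian (the usual convention for Gaussian systems); this is needed
  because, e.g., the imaginary part of \<open>W A + W (-A)\<close> vanishes almost surely.\<close>

definition gaussian_rv :: "'w measure \<Rightarrow> ('w \<Rightarrow> real) \<Rightarrow> bool" where
  "gaussian_rv M Y \<longleftrightarrow> Y \<in> borel_measurable M \<and>
     (\<exists>\<mu> \<sigma>. \<sigma> \<ge> 0 \<and>
        distr M borel Y =
          (if \<sigma> = 0 then return borel \<mu> else density lborel (normal_density \<mu> \<sigma>)))"

definition finite_measure_sets :: "(real ^ 'd) set set" where
  "finite_measure_sets = {A \<in> sets borel. emeasure lborel A < \<infinity>}"

text \<open>The values \<open>W A\<close> are jointly Gaussian as complex variables: letting the complex coefficients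
  \<open>c A\<close> vary, the real part below runs through all real linear combinations of the real and
  imaginary parts of finitely many values of \<open>W\<close>.\<close>

definition complex_white_noise ::
    "'w measure \<Rightarrow> ((real ^ 'd) set \<Rightarrow> 'w \<Rightarrow> complex) \<Rightarrow> bool" where
  "complex_white_noise M W \<longleftrightarrow>
     prob_space M \<and>
     (\<forall>A \<in> finite_measure_sets. W A \<in> borel_measurable M) \<and>
     (\<forall>S c. finite S \<and> S \<subseteq> finite_measure_sets \<longrightarrow>
        gaussian_rv M (\<lambda>\<omega>. Re (\<Sum>A\<in>S. c A * W A \<omega>))) \<and>
     (\<forall>A \<in> finite_measure_sets. (LINT \<omega>|M. W A \<omega>) = 0) \<and>
     (\<forall>A \<in> finite_measure_sets. \<forall>B \<in> finite_measure_sets.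
        (LINT \<omega>|M. W A \<omega> * cnj (W B \<omega>)) = complex_of_real (measure lborel (A \<inter> B))) \<and>
     (\<forall>A \<in> finite_measure_sets. \<forall>B \<in> finite_measure_sets. A \<inter> B = {} \<longrightarrow>
        (AE \<omega> in M. W (A \<union> B) \<omega> = W A \<omega> + W B \<omega>)) \<and>
     (\<forall>A \<in> finite_measure_sets. AE \<omega> in M. W (uminus ` A) \<omega> = cnj (W A \<omega>))"


section \<open>The double Wiener--Ito integral\<close>

text \<open>A regular system is a finite disjoint family closed under reflection. By disjointness,
  \<open>uminus ` A \<noteq> A\<close> means that \<open>A\<close> does not meet its reflection.\<close>

definition regular_system :: "(real ^ 'd) set set \<Rightarrow> bool" where
  "regular_system D \<longleftrightarrow>
     finite D \<and> D \<subseteq> finite_measure_sets \<and>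
     (\<forall>A\<in>D. \<forall>B\<in>D. A \<noteq> B \<longrightarrow> A \<inter> B = {}) \<and>
     (\<forall>A\<in>D. uminus ` A \<in> D \<and> uminus ` A \<noteq> A)"

text \<open>\<open>a A B\<close> is the value on \<open>A \<times> B\<close> of a simple function adapted to \<open>D\<close>. It vanishes on the
  blocks meeting the diagonals \<open>x = y\<close> and \<open>x = -y\<close> (this is the prime on the integral sign), and
  the second condition says \<open>f (-x, -y) = cnj (f (x, y))\<close>.\<close>

definition simple_coeffs ::
    "(real ^ 'd) set set \<Rightarrow> ((real ^ 'd) set \<Rightarrow> (real ^ 'd) set \<Rightarrow> complex) \<Rightarrow> bool" where
  "simple_coeffs D a \<longleftrightarrow>
     regular_system D \<and>
     (\<forall>A\<in>D. a A A = 0 \<and> a A (uminus ` A) = 0) \<and>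
     (\<forall>A\<in>D. \<forall>B\<in>D. a (uminus ` A) (uminus ` B) = cnj (a A B))"

definition simple_fun ::
    "(real ^ 'd) set set \<Rightarrow> ((real ^ 'd) set \<Rightarrow> (real ^ 'd) set \<Rightarrow> complex) \<Rightarrow>
     (real ^ 'd) \<times> (real ^ 'd) \<Rightarrow> complex" where
  "simple_fun D a = (\<lambda>(x, y). \<Sum>A\<in>D. \<Sum>B\<in>D. a A B * indicator A x * indicator B y)"

definition simple_double_integral ::
    "((real ^ 'd) set \<Rightarrow> 'w \<Rightarrow> complex) \<Rightarrow> (real ^ 'd) set set \<Rightarrow>
     ((real ^ 'd) set \<Rightarrow> (real ^ 'd) set \<Rightarrow> complex) \<Rightarrow> 'w \<Rightarrow> complex" where
  "simple_double_integral W D a \<omega> = (\<Sum>A\<in>D. \<Sum>B\<in>D. a A B * W A \<omega> * W B \<omega>)"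

text \<open>Extension to square integrable functions by continuity: \<open>I\<close> is (a version of) the integral
  of \<open>f\<close> if it is the mean square limit of the integrals of simple functions that converge
  to \<open>f\<close> in \<open>L\<^sup>2\<close>. Such an \<open>I\<close> is determined only up to almost sure equality, hence a relation.\<close>

definition has_double_wiener_ito_integral ::
    "'w measure \<Rightarrow> ((real ^ 'd) set \<Rightarrow> 'w \<Rightarrow> complex) \<Rightarrow>
     ((real ^ 'd) \<times> (real ^ 'd) \<Rightarrow> complex) \<Rightarrow> ('w \<Rightarrow> complex) \<Rightarrow> bool" where
  "has_double_wiener_ito_integral M W f I \<longleftrightarrow>
     f \<in> borel_measurable (lborel \<Otimes>\<^sub>M lborel) \<and> I \<in> borel_measurable M \<and>
     (\<exists>D a. (\<forall>n::nat. simple_coeffs (D n) (a n)) \<and>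
        (\<lambda>n. \<integral>\<^sup>+ p. ennreal ((cmod (simple_fun (D n) (a n) p - f p))\<^sup>2)
                \<partial>(lborel \<Otimes>\<^sub>M lborel)) \<longlonglongrightarrow> 0 \<and>
        (\<lambda>n. \<integral>\<^sup>+ \<omega>. ennreal ((cmod (simple_double_integral W (D n) (a n) \<omega> - I \<omega>))\<^sup>2) \<partial>M)
           \<longlonglongrightarrow> 0)"


section \<open>The Rosenblatt-type kernel\<close>

definition jordan_measurable :: "(real ^ 'd) set \<Rightarrow> bool" where
  "jordan_measurable S \<longleftrightarrow> bounded S \<and> frontier S \<in> null_sets lebesgue"

text \<open>The integral is taken in \<open>lebesgue\<close>, not \<open>lborel\<close>, because a Jordan measurable set need not be Borel.\<close>

definition K :: "(real ^ 'd) set \<Rightarrow> real ^ 'd \<Rightarrow> complex" where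
  "K \<Delta> x = (LINT u:\<Delta>|lebesgue. exp (\<i> * complex_of_real (x \<bullet> u)))"

definition c2 :: "nat \<Rightarrow> real \<Rightarrow> real" where
  "c2 d \<alpha> = Gamma ((real d - \<alpha>) / 2) / (2 powr \<alpha> * pi powr (real d / 2) * Gamma (\<alpha> / 2))"

definition rosenblatt_kernel ::
    "(real ^ 'd) set \<Rightarrow> real \<Rightarrow> (real ^ 'd) \<times> (real ^ 'd) \<Rightarrow> complex" where
  "rosenblatt_kernel \<Delta> \<alpha> = (\<lambda>(x, y). K \<Delta> (x + y) /
     complex_of_real (norm x powr ((real CARD('d) - \<alpha>) / 2) *
                      norm y powr ((real CARD('d) - \<alpha>) / 2)))"

text \<open>\<open>X\<close> is real-valued; the double integral is only almost surely real.\<close>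

definition rosenblatt_type_rv ::
    "'w measure \<Rightarrow> ((real ^ 'd) set \<Rightarrow> 'w \<Rightarrow> complex) \<Rightarrow> (real ^ 'd) set \<Rightarrow> real \<Rightarrow>
     ('w \<Rightarrow> real) \<Rightarrow> bool" where
  "rosenblatt_type_rv M W \<Delta> \<alpha> X \<longleftrightarrow> X \<in> borel_measurable M \<and>
     (\<exists>I. has_double_wiener_ito_integral M W (rosenblatt_kernel \<Delta> \<alpha>) I \<and>
        (AE \<omega> in M. complex_of_real (X \<omega>) = complex_of_real (c2 CARD('d) \<alpha>) * I \<omega>))"

end

theory Submission
  imports Defs
begin

text \<open>
  The characteristic function \<open>\<phi>\<close> of \<open>X\<^sub>2(\<Delta>)\<close> satisfies \<open>\<bar>\<phi>(t)\<bar> \<le> 1 / (1 + (\<kappa> t)\<^sup>2)\<close> for some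
  \<open>\<kappa> > 0\<close>. Hence it is integrable, and Fourier inversion (\<open>density_if_char_integrable\<close>) gives a
  bounded function that is the derivative of the distribution function at every point. The bound
  is proved, with a constant that does not depend on the approximation, for the double integrals
  of the simple functions that converge to the kernel (\<open>simple_double_integral_char_bound\<close>); mean
  square convergence carries it over to the limit.

  The variables \<open>R(A) = Re W(A) + Im W(A)\<close> form a real Gaussian white noise, and \<open>W(A)\<close> is a
  combination of \<open>R(A)\<close> and \<open>R(-A)\<close>. So the double integral of a simple function is a real
  quadratic form \<open>Q = b(R, R)\<close> in independent centred Gaussian variables. Its characteristic function
  can be bounded without diagonalising \<open>b\<close>. If \<open>Q'\<close> is an independent copy of \<open>Q\<close>, then
  \<open>\<bar>E e\<^sup>i\<^sup>t\<^sup>Q\<bar>\<^sup>2 = E e\<^sup>i\<^sup>t\<^sup>(\<^sup>Q\<^sup>-\<^sup>Q\<^sup>'\<^sup>)\<close>, and a rotation by 45 degrees of the pair of noises turns \<open>Q - Q'\<close> into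
  \<open>2 b(U, V)\<close> with \<open>U\<close>, \<open>V\<close> independent copies of \<open>R\<close>. Integrating out \<open>V\<close> leaves
  \<open>E exp(- 2 t\<^sup>2 \<parallel>b U\<parallel>\<^sup>2)\<close>. By Bessel's inequality \<open>\<parallel>b U\<parallel>\<^sup>2\<close> is at least the sum of the squares of the
  coefficients of \<open>b U\<close> along four orthonormal functions \<open>e\<^sub>m\<close>. Writing the exponential of these
  squares as the characteristic function of an auxiliary standard Gaussian vector \<open>N\<close> with four
  components, one integrates out \<open>U\<close> and obtains the bound \<open>E exp(- 2 c\<^sup>2 t\<^sup>2 \<bar>N\<bar>\<^sup>2) = (1 + (2 c t)\<^sup>2)\<^sup>-\<^sup>2\<close>,
  provided that the quadratic form with matrix \<open>\<langle>b e\<^sub>m, e\<^sub>m\<^sub>'\<rangle>\<close> is at least \<open>c\<close> on the unit sphere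
  (\<open>cmod_char_quadratic_form_le\<close>).

  Uniform positivity of these matrices comes from the kernel. Let \<open>cas s = cos s - sin s\<close> and
  \<open>w(x) = \<parallel>x\<parallel>\<^sup>-\<^sup>(\<^sup>d\<^sup>-\<^sup>\<alpha>\<^sup>)\<^sup>/\<^sup>2\<close>. In terms of \<open>R\<close> instead of \<open>W\<close> the kernel \<open>f\<close> becomes
  \<open>Re f(-x, y) - Im f(x, y) = w(x) w(y) \<integral>\<^sub>\<Delta> cas (x, u) cas (y, u) du\<close>, which is visibly positive
  semidefinite. On masses at \<open>v, 2v, 3v, 4v\<close> the form is positive definite, because \<open>\<Delta>\<close> contains a
  neighbourhood of the origin and \<open>cas s, cas 2s, cas 3s, cas 4s\<close> are linearly independent there
  (\<open>real_kernel_positive_definite\<close>). The functions \<open>e\<^sub>m\<close> are the normalised indicators of small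
  balls around these four points; both the continuity of the kernel at the points and the
  convergence of the simple functions in \<open>L\<^sup>2\<close> change the matrix only a little.
\<close>

section \<open>Independence from characteristic functions\<close>

context prob_space
begin

text \<open>If \<open>H\<close> is normalised to mean one, the factorisation says that \<open>Y\<close> has the same characteristic
  function under \<open>H dM\<close> as under \<open>M\<close>, hence the same law by Levy's uniqueness theorem.\<close>

lemma real_weight_indicator_factor:
  fixes H Y :: "'a \<Rightarrow> real"
  assumes [measurable]: "H \<in> borel_measurable M" "Y \<in> borel_measurable M" "B \<in> sets borel"
    and nonneg: "\<And>\<omega>. 0 \<le> H \<omega>" and bound: "\<And>\<omega>. H \<omega> \<le> C"
    and factor: "\<And>r. (\<integral>\<omega>. H \<omega> * iexp (r * Y \<omega>) \<partial>M) = (\<integral>\<omega>. H \<omega> \<partial>M) * (\<integral>\<omega>. iexp (r * Y \<omega>) \<partial>M)"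
  shows "(\<integral>\<omega>. H \<omega> * indicator B (Y \<omega>) \<partial>M) = (\<integral>\<omega>. H \<omega> \<partial>M) * (\<integral>\<omega>. indicator B (Y \<omega>) \<partial>M)"
proof -
  define h where "h = (\<integral>\<omega>. H \<omega> \<partial>M)"
  have intH: "integrable M H"
    by (rule integrable_const_bound[where B=C]) (auto simp: nonneg bound)
  have h0: "h \<ge> 0" unfolding h_def by (simp add: nonneg)
  show ?thesis
  proof (cases "h = 0")
    case True
    have "AE \<omega> in M. H \<omega> = 0"
      using integral_nonneg_eq_0_iff_AE[OF intH] nonneg True by (simp add: h_def)
    then have "AE \<omega> in M. H \<omega> * indicator B (Y \<omega>) = 0" by auto
    then have "(\<integral>\<omega>. H \<omega> * indicator B (Y \<omega>) \<partial>M) = (\<integral>\<omega>. 0 \<partial>M)"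
      by (intro integral_cong_AE) auto
    then show ?thesis using True by (simp add: h_def)
  next
    case False
    then have hpos: "h > 0" using h0 by simp
    define N where "N = density M (\<lambda>\<omega>. ennreal (H \<omega> / h))"
    have "emeasure N (space N) = (\<integral>\<^sup>+\<omega>. ennreal (H \<omega> / h) \<partial>M)"
      by (simp add: N_def emeasure_density cong: nn_integral_cong)
    also have "\<dots> = ennreal (\<integral>\<omega>. H \<omega> / h \<partial>M)"
      using hpos by (intro nn_integral_eq_integral) (auto simp: intH nonneg)
    also have "\<dots> = 1" using hpos by (simp add: h_def)
    finally have pN: "prob_space N" by (rule prob_spaceI)
    interpret N: prob_space N by fact
    have YN[measurable]: "Y \<in> borel_measurable N" by (simp add: N_def)
    have int_N: "(\<integral>\<omega>. g \<omega> \<partial>N) = (\<integral>\<omega>. H \<omega> * g \<omega> \<partial>M) / h"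
      if [measurable]: "g \<in> borel_measurable M" for g :: "'a \<Rightarrow> complex"
    proof -
      have "(\<integral>\<omega>. g \<omega> \<partial>N) = (\<integral>\<omega>. (H \<omega> / h) *\<^sub>R g \<omega> \<partial>M)"
        unfolding N_def using hpos by (intro integral_density) (auto simp: nonneg)
      also have "\<dots> = (\<integral>\<omega>. (H \<omega> * g \<omega>) / h \<partial>M)"
        by (simp add: scaleR_conv_of_real)
      finally show ?thesis by simp
    qed
    have "char (distr N borel Y) = char (distr M borel Y)"
    proof
      fix r
      have "char (distr N borel Y) r = (\<integral>\<omega>. iexp (r * Y \<omega>) \<partial>N)"
        by (simp add: char_def integral_distr)
      also have "\<dots> = (\<integral>\<omega>. H \<omega> * iexp (r * Y \<omega>) \<partial>M) / h" by (rule int_N) simp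
      also have "\<dots> = (\<integral>\<omega>. iexp (r * Y \<omega>) \<partial>M)"
        using hpos by (subst factor) (simp add: h_def)
      finally show "char (distr N borel Y) r = char (distr M borel Y) r"
        by (simp add: char_def integral_distr)
    qed
    then have eq: "distr N borel Y = distr M borel Y"
      by (intro Levy_uniqueness N.real_distribution_distr real_distribution_distr) auto
    have "(\<integral>\<omega>. indicator B (Y \<omega>) \<partial>M) = integral\<^sup>L (distr M borel Y) (indicator B :: real \<Rightarrow> complex)"
      by (simp add: integral_distr)
    also have "\<dots> = (\<integral>\<omega>. indicator B (Y \<omega>) \<partial>N)"
      by (simp add: integral_distr flip: eq)
    also have "\<dots> = (\<integral>\<omega>. complex_of_real (H \<omega>) * indicator B (Y \<omega>) \<partial>M) / h" by (rule int_N) simp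
    also have "(\<integral>\<omega>. complex_of_real (H \<omega>) * indicator B (Y \<omega>) \<partial>M) = complex_of_real (\<integral>\<omega>. H \<omega> * indicator B (Y \<omega>) \<partial>M)"
      unfolding integral_complex_of_real[symmetric] by (simp add: of_real_indicator)
    finally have "complex_of_real (\<integral>\<omega>. indicator B (Y \<omega>) \<partial>M)
        = complex_of_real ((\<integral>\<omega>. H \<omega> * indicator B (Y \<omega>) \<partial>M) / h)"
      by (subst integral_complex_of_real[symmetric]) (simp add: of_real_indicator)
    then show ?thesis using hpos unfolding of_real_eq_iff by (simp add: h_def)
  qed
qed

text \<open>Since constants factor trivially, the real case applies to \<open>Re Z + C\<close> and \<open>Im Z + C\<close>, which are
  nonnegative.\<close>

lemma complex_weight_indicator_factor:
  fixes Z :: "'a \<Rightarrow> complex" and Y :: "'a \<Rightarrow> real"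
  assumes [measurable]: "Z \<in> borel_measurable M" "Y \<in> borel_measurable M" "B \<in> sets borel"
    and bound: "\<And>\<omega>. cmod (Z \<omega>) \<le> C"
    and factor: "\<And>r. (\<integral>\<omega>. Z \<omega> * iexp (r * Y \<omega>) \<partial>M) = (\<integral>\<omega>. Z \<omega> \<partial>M) * (\<integral>\<omega>. iexp (r * Y \<omega>) \<partial>M)"
  shows "(\<integral>\<omega>. Z \<omega> * indicator B (Y \<omega>) \<partial>M) = (\<integral>\<omega>. Z \<omega> \<partial>M) * (\<integral>\<omega>. indicator B (Y \<omega>) \<partial>M)"
proof -
  have int: "integrable M (\<lambda>\<omega>. f \<omega> * g \<omega>)"
    if f: "f \<in> borel_measurable M" "\<And>\<omega>. cmod (f \<omega>) \<le> C"
    and g: "g \<in> borel_measurable M" "\<And>\<omega>. cmod (g \<omega>) \<le> 1" for f g :: "'a \<Rightarrow> complex"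
  proof (rule integrable_const_bound[where B=C])
    have "cmod (f \<omega> * g \<omega>) \<le> C" for \<omega>
      using mult_left_le[OF g(2)[of \<omega>] norm_ge_zero[of "f \<omega>"]] f(2)[of \<omega>]
      by (simp add: norm_mult)
    then show "AE \<omega> in M. cmod (f \<omega> * g \<omega>) \<le> C" by simp
  qed (use f g in simp)
  have [measurable]: "(\<lambda>\<omega>. cnj (Z \<omega>)) \<in> borel_measurable M"
    by (rule measurable_compose[OF assms(1)])
       (auto intro!: borel_measurable_continuous_onI continuous_intros)
  have intZ: "integrable M Z" by (rule integrable_const_bound[where B=C]) (auto simp: bound)
  have inte: "integrable M (\<lambda>\<omega>. Z \<omega> * iexp (r * Y \<omega>))" for r
    by (rule int) (auto simp: bound)
  have inte': "integrable M (\<lambda>\<omega>. cnj (Z \<omega>) * iexp (r * Y \<omega>))" for r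
    by (rule int) (auto simp: bound)
  have inti: "integrable M (\<lambda>\<omega>. iexp (r * Y \<omega>))" for r
    by (rule integrable_iexp) auto
  have factor': "(\<integral>\<omega>. cnj (Z \<omega>) * iexp (r * Y \<omega>) \<partial>M) = cnj (\<integral>\<omega>. Z \<omega> \<partial>M) * (\<integral>\<omega>. iexp (r * Y \<omega>) \<partial>M)" for r
  proof -
    have c: "cnj (iexp (- r * x)) = iexp (r * x)" for x
      by (simp add: exp_cnj)
    have "(\<integral>\<omega>. cnj (Z \<omega>) * iexp (r * Y \<omega>) \<partial>M) = cnj (\<integral>\<omega>. Z \<omega> * iexp (- r * Y \<omega>) \<partial>M)"
    proof -
      have "cnj (Z \<omega>) * iexp (r * Y \<omega>) = cnj (Z \<omega> * iexp (- r * Y \<omega>))" for \<omega>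
        unfolding complex_cnj_mult c ..
      then show ?thesis by (simp only: Bochner_Integration.integral_cnj)
    qed
    also have "\<dots> = cnj (\<integral>\<omega>. Z \<omega> \<partial>M) * (\<integral>\<omega>. cnj (iexp (- r * Y \<omega>)) \<partial>M)"
      by (subst factor) (simp add: Bochner_Integration.integral_cnj)
    finally show ?thesis unfolding c .
  qed
  have re: "(\<integral>\<omega>. (Re (Z \<omega>) + C) * indicator B (Y \<omega>) \<partial>M)
      = (\<integral>\<omega>. Re (Z \<omega>) + C \<partial>M) * (\<integral>\<omega>. indicator B (Y \<omega>) \<partial>M)"
  proof (rule real_weight_indicator_factor[where C="C + C"])
    fix \<omega> show "0 \<le> Re (Z \<omega>) + C" "Re (Z \<omega>) + C \<le> C + C"
      using bound[of \<omega>] abs_Re_le_cmod[of "Z \<omega>"] by auto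
  next
    fix r
    have e: "complex_of_real (Re (Z \<omega>) + C) = (Z \<omega> + cnj (Z \<omega>)) / 2 + C" for \<omega>
      by (simp add: complex_add_cnj)
    have "(\<integral>\<omega>. complex_of_real (Re (Z \<omega>) + C) * iexp (r * Y \<omega>) \<partial>M)
       = (\<integral>\<omega>. (Z \<omega> * iexp (r * Y \<omega>)) / 2 + (cnj (Z \<omega>) * iexp (r * Y \<omega>)) / 2 + C * iexp (r * Y \<omega>) \<partial>M)"
      unfolding e by (intro Bochner_Integration.integral_cong refl) (simp add: field_simps)
    also have "\<dots> = (\<integral>\<omega>. Z \<omega> * iexp (r * Y \<omega>) \<partial>M) / 2 + (\<integral>\<omega>. cnj (Z \<omega>) * iexp (r * Y \<omega>) \<partial>M) / 2
        + C * (\<integral>\<omega>. iexp (r * Y \<omega>) \<partial>M)"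
      using inte[of r] inte'[of r] inti[of r] by simp
    also have "\<dots> = ((\<integral>\<omega>. Z \<omega> \<partial>M) / 2 + (\<integral>\<omega>. cnj (Z \<omega>) \<partial>M) / 2 + C) * (\<integral>\<omega>. iexp (r * Y \<omega>) \<partial>M)"
      unfolding factor factor' Bochner_Integration.integral_cnj by (simp add: field_simps)
    also have "(\<integral>\<omega>. Z \<omega> \<partial>M) / 2 + (\<integral>\<omega>. cnj (Z \<omega>) \<partial>M) / 2 + C = (\<integral>\<omega>. (Z \<omega> + cnj (Z \<omega>)) / 2 + C \<partial>M)"
      using intZ by (simp add: prob_space add_divide_distrib integral_add)
    also have "\<dots> = complex_of_real (\<integral>\<omega>. Re (Z \<omega>) + C \<partial>M)"
      unfolding e[symmetric] by (rule integral_complex_of_real)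
    finally show "(\<integral>\<omega>. complex_of_real (Re (Z \<omega>) + C) * iexp (r * Y \<omega>) \<partial>M)
       = complex_of_real (\<integral>\<omega>. Re (Z \<omega>) + C \<partial>M) * (\<integral>\<omega>. iexp (r * Y \<omega>) \<partial>M)" .
  qed auto
  have im: "(\<integral>\<omega>. (Im (Z \<omega>) + C) * indicator B (Y \<omega>) \<partial>M)
      = (\<integral>\<omega>. Im (Z \<omega>) + C \<partial>M) * (\<integral>\<omega>. indicator B (Y \<omega>) \<partial>M)"
  proof (rule real_weight_indicator_factor[where C="C + C"])
    fix \<omega> show "0 \<le> Im (Z \<omega>) + C" "Im (Z \<omega>) + C \<le> C + C"
      using bound[of \<omega>] abs_Im_le_cmod[of "Z \<omega>"] by auto
  next
    fix r
    have e: "complex_of_real (Im (Z \<omega>) + C) = (Z \<omega> - cnj (Z \<omega>)) / (2 * \<i>) + C" for \<omega>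
      by (auto simp: complex_diff_cnj complex_eq_iff)
    have "(\<integral>\<omega>. complex_of_real (Im (Z \<omega>) + C) * iexp (r * Y \<omega>) \<partial>M)
       = (\<integral>\<omega>. (Z \<omega> * iexp (r * Y \<omega>)) / (2*\<i>) - (cnj (Z \<omega>) * iexp (r * Y \<omega>)) / (2*\<i>) + C * iexp (r * Y \<omega>) \<partial>M)"
      unfolding e by (intro Bochner_Integration.integral_cong refl) (simp add: field_simps)
    also have "\<dots> = (\<integral>\<omega>. Z \<omega> * iexp (r * Y \<omega>) \<partial>M) / (2*\<i>) - (\<integral>\<omega>. cnj (Z \<omega>) * iexp (r * Y \<omega>) \<partial>M) / (2*\<i>)
        + C * (\<integral>\<omega>. iexp (r * Y \<omega>) \<partial>M)"
      using inte[of r] inte'[of r] inti[of r] by simp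
    also have "\<dots> = ((\<integral>\<omega>. Z \<omega> \<partial>M) / (2*\<i>) - (\<integral>\<omega>. cnj (Z \<omega>) \<partial>M) / (2*\<i>) + C) * (\<integral>\<omega>. iexp (r * Y \<omega>) \<partial>M)"
      unfolding factor factor' Bochner_Integration.integral_cnj by (simp add: field_simps)
    also have "(\<integral>\<omega>. Z \<omega> \<partial>M) / (2*\<i>) - (\<integral>\<omega>. cnj (Z \<omega>) \<partial>M) / (2*\<i>) + C = (\<integral>\<omega>. (Z \<omega> - cnj (Z \<omega>)) / (2*\<i>) + C \<partial>M)"
      using intZ by (simp add: prob_space diff_divide_distrib right_diff_distrib integral_diff)
    also have "\<dots> = complex_of_real (\<integral>\<omega>. Im (Z \<omega>) + C \<partial>M)"
      unfolding e[symmetric] by (rule integral_complex_of_real)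
    finally show "(\<integral>\<omega>. complex_of_real (Im (Z \<omega>) + C) * iexp (r * Y \<omega>) \<partial>M)
       = complex_of_real (\<integral>\<omega>. Im (Z \<omega>) + C \<partial>M) * (\<integral>\<omega>. iexp (r * Y \<omega>) \<partial>M)" .
  qed auto
  have intB: "integrable M (\<lambda>\<omega>. indicator B (Y \<omega>) :: complex)" "integrable M (\<lambda>\<omega>. indicator B (Y \<omega>) :: real)"
    by (auto intro!: integrable_const_bound[where B=1] split: split_indicator)
  have intZB: "integrable M (\<lambda>\<omega>. Z \<omega> * indicator B (Y \<omega>))"
    by (rule int) (auto simp: bound split: split_indicator)
  have C0: "0 \<le> C" using order_trans[OF norm_ge_zero bound] .
  have bRe: "\<bar>Re (Z \<omega>)\<bar> \<le> C" and bIm: "\<bar>Im (Z \<omega>)\<bar> \<le> C" for \<omega>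
    using bound[of \<omega>] abs_Re_le_cmod[of "Z \<omega>"] abs_Im_le_cmod[of "Z \<omega>"] by auto
  have intR: "integrable M (\<lambda>\<omega>. Re (Z \<omega>) * indicator B (Y \<omega>))"
    by (rule integrable_const_bound[where B=C]) (use bRe C0 in \<open>auto split: split_indicator\<close>)
  have intI: "integrable M (\<lambda>\<omega>. Im (Z \<omega>) * indicator B (Y \<omega>))"
    by (rule integrable_const_bound[where B=C]) (use bIm C0 in \<open>auto split: split_indicator\<close>)
  have R: "(\<integral>\<omega>. Re (Z \<omega>) * indicator B (Y \<omega>) \<partial>M) = (\<integral>\<omega>. Re (Z \<omega>) \<partial>M) * (\<integral>\<omega>. indicator B (Y \<omega>) \<partial>M)"
    using re integrable_Re[OF intZ] intR intB(2)
    by (simp add: distrib_right prob_space del: integral_Re)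
  have I: "(\<integral>\<omega>. Im (Z \<omega>) * indicator B (Y \<omega>) \<partial>M) = (\<integral>\<omega>. Im (Z \<omega>) \<partial>M) * (\<integral>\<omega>. indicator B (Y \<omega>) \<partial>M)"
    using im integrable_Im[OF intZ] intI intB(2)
    by (simp add: distrib_right prob_space del: integral_Im)
  have ind: "(\<integral>\<omega>. indicator B (Y \<omega>) \<partial>M) = complex_of_real (\<integral>\<omega>. indicator B (Y \<omega>) \<partial>M)"
    unfolding integral_complex_of_real[symmetric] by (simp add: of_real_indicator)
  have "Re (\<integral>\<omega>. Z \<omega> * indicator B (Y \<omega>) \<partial>M) = (\<integral>\<omega>. Re (Z \<omega>) * indicator B (Y \<omega>) \<partial>M)"
    unfolding integral_Re[OF intZB, symmetric]
    by (intro Bochner_Integration.integral_cong refl) (auto split: split_indicator)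
  moreover have "Im (\<integral>\<omega>. Z \<omega> * indicator B (Y \<omega>) \<partial>M) = (\<integral>\<omega>. Im (Z \<omega>) * indicator B (Y \<omega>) \<partial>M)"
    unfolding integral_Im[OF intZB, symmetric]
    by (intro Bochner_Integration.integral_cong refl) (auto split: split_indicator)
  ultimately show ?thesis
    unfolding R I ind using intZ by (simp add: complex_eq_iff)
qed

text \<open>Exponentials are exchanged for indicators one variable at a time: when \<open>Y j\<close> is treated, the
  exponentials of the variables that are still to come belong to the weight, and the indicators
  obtained so far are absorbed into \<open>Z\<close>. This is why the weight has to be complex.\<close>

lemma weighted_char_factor_prod_indicator:
  fixes Y :: "'i \<Rightarrow> 'a \<Rightarrow> real"
  assumes "finite J" and Y[measurable]: "\<And>j. j \<in> J \<Longrightarrow> Y j \<in> borel_measurable M"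
    and B: "\<And>j. j \<in> J \<Longrightarrow> B j \<in> sets borel"
    and "Z \<in> borel_measurable M" and "\<And>\<omega>. cmod (Z \<omega>) \<le> C"
    and "\<And>s. (\<integral>\<omega>. Z \<omega> * iexp (\<Sum>j\<in>J. s j * Y j \<omega>) \<partial>M)
            = (\<integral>\<omega>. Z \<omega> \<partial>M) * (\<Prod>j\<in>J. \<integral>\<omega>. iexp (s j * Y j \<omega>) \<partial>M)"
  shows "(\<integral>\<omega>. Z \<omega> * (\<Prod>j\<in>J. indicator (B j) (Y j \<omega>)) \<partial>M)
            = (\<integral>\<omega>. Z \<omega> \<partial>M) * (\<Prod>j\<in>J. \<integral>\<omega>. indicator (B j) (Y j \<omega>) \<partial>M)"
  using assms
proof (induction J arbitrary: Z rule: finite_induct)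
  case empty
  then show ?case by simp
next
  case (insert j J)
  note [measurable] = insert.prems(1)[of j] insert.prems(1) insert.prems(2)[of j] insert.prems(3)
  have Yj[measurable]: "Y k \<in> borel_measurable M" if "k \<in> J" for k using insert.prems(1) that by auto
  define Z' where "Z' = (\<lambda>\<omega>. Z \<omega> * indicator (B j) (Y j \<omega>))"
  have e0: "(\<integral>\<omega>. iexp (0 * Y j \<omega>) \<partial>M) = 1" by (simp add: prob_space)
  have key: "(\<integral>\<omega>. Z' \<omega> * iexp (\<Sum>k\<in>J. s k * Y k \<omega>) \<partial>M) =
     (\<integral>\<omega>. Z \<omega> \<partial>M) * (\<Prod>k\<in>J. \<integral>\<omega>. iexp (s k * Y k \<omega>) \<partial>M) * (\<integral>\<omega>. indicator (B j) (Y j \<omega>) \<partial>M)" for s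
  proof -
    let ?Zs = "\<lambda>\<omega>. Z \<omega> * iexp (\<Sum>k\<in>J. s k * Y k \<omega>)"
    have f: "(\<integral>\<omega>. ?Zs \<omega> * iexp (r * Y j \<omega>) \<partial>M) =
       (\<integral>\<omega>. Z \<omega> \<partial>M) * (\<Prod>k\<in>J. \<integral>\<omega>. iexp (s k * Y k \<omega>) \<partial>M) * (\<integral>\<omega>. iexp (r * Y j \<omega>) \<partial>M)" for r
    proof -
      have c: "(\<Sum>k\<in>J. (s(j := r)) k * Y k \<omega>) = (\<Sum>k\<in>J. s k * Y k \<omega>)" for \<omega>
        using insert.hyps by (intro sum.cong) auto
      have d: "(\<Prod>k\<in>J. \<integral>\<omega>. iexp ((s(j := r)) k * Y k \<omega>) \<partial>M) = (\<Prod>k\<in>J. \<integral>\<omega>. iexp (s k * Y k \<omega>) \<partial>M)"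
        using insert.hyps by (intro prod.cong) auto
      show ?thesis
        using insert.prems(5)[of "s(j := r)"] unfolding sum.insert[OF insert.hyps] prod.insert[OF insert.hyps] c d
        by (simp add: exp_add distrib_left mult_ac)
    qed
    have g: "(\<integral>\<omega>. ?Zs \<omega> \<partial>M) = (\<integral>\<omega>. Z \<omega> \<partial>M) * (\<Prod>k\<in>J. \<integral>\<omega>. iexp (s k * Y k \<omega>) \<partial>M)"
      using f[of 0] unfolding e0 by simp
    have "(\<integral>\<omega>. ?Zs \<omega> * indicator (B j) (Y j \<omega>) \<partial>M) = (\<integral>\<omega>. ?Zs \<omega> \<partial>M) * (\<integral>\<omega>. indicator (B j) (Y j \<omega>) \<partial>M)"
      by (rule complex_weight_indicator_factor[where C=C])
         (use insert.prems(4) f g in \<open>auto simp: norm_mult\<close>)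
    then show ?thesis unfolding g Z'_def by (simp add: mult_ac)
  qed
  have e: "(\<integral>\<omega>. Z' \<omega> \<partial>M) = (\<integral>\<omega>. Z \<omega> \<partial>M) * (\<integral>\<omega>. indicator (B j) (Y j \<omega>) \<partial>M)"
    using key[of "\<lambda>_. 0"] by (simp add: prob_space)
  have "(\<integral>\<omega>. Z' \<omega> * (\<Prod>k\<in>J. indicator (B k) (Y k \<omega>)) \<partial>M)
            = (\<integral>\<omega>. Z' \<omega> \<partial>M) * (\<Prod>k\<in>J. \<integral>\<omega>. indicator (B k) (Y k \<omega>) \<partial>M)"
  proof (rule insert.IH)
    show "Z' \<in> borel_measurable M" unfolding Z'_def by measurable
    show "cmod (Z' \<omega>) \<le> C" for \<omega>
      using insert.prems(4)[of \<omega>] order_trans[OF norm_ge_zero insert.prems(4)[of \<omega>]]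
      by (auto simp: Z'_def norm_mult split: split_indicator)
    show "(\<integral>\<omega>. Z' \<omega> * iexp (\<Sum>k\<in>J. s k * Y k \<omega>) \<partial>M)
        = (\<integral>\<omega>. Z' \<omega> \<partial>M) * (\<Prod>k\<in>J. \<integral>\<omega>. iexp (s k * Y k \<omega>) \<partial>M)" for s
      unfolding key e by (simp add: mult_ac)
  qed (use insert.prems in auto)
  then show ?case unfolding e using insert.hyps by (simp add: Z'_def mult_ac)
qed

proposition indep_vars_if_char_factors:
  fixes Y :: "'i \<Rightarrow> 'a \<Rightarrow> real"
  assumes J: "finite J" "J \<noteq> {}" and Y[measurable]: "\<And>j. j \<in> J \<Longrightarrow> Y j \<in> borel_measurable M"
    and factor: "\<And>s. (\<integral>\<omega>. iexp (\<Sum>j\<in>J. s j * Y j \<omega>) \<partial>M) = (\<Prod>j\<in>J. \<integral>\<omega>. iexp (s j * Y j \<omega>) \<partial>M)"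
  shows "indep_vars (\<lambda>_. borel) Y J"
proof -
  have "prob (\<Inter>j\<in>J. Y j -` A j \<inter> space M) = (\<Prod>j\<in>J. prob (Y j -` A j \<inter> space M))"
    if A: "A \<in> (\<Pi> j\<in>J. sets borel)" for A
  proof -
    have ind: "(\<integral>\<omega>. indicator (A j) (Y j \<omega>) \<partial>M) = complex_of_real (prob (Y j -` A j \<inter> space M))" if "j \<in> J" for j
    proof -
      have "(\<integral>\<omega>. indicator (A j) (Y j \<omega>) \<partial>M) = (\<integral>\<omega>. complex_of_real (indicator (Y j -` A j \<inter> space M) \<omega>) \<partial>M)"
        by (intro Bochner_Integration.integral_cong refl) (auto split: split_indicator)
      also have "\<dots> = complex_of_real (prob (Y j -` A j \<inter> space M \<inter> space M))"
        using A that unfolding integral_complex_of_real by simp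
      finally show ?thesis by simp
    qed
    have "(\<integral>\<omega>. 1 * (\<Prod>j\<in>J. indicator (A j) (Y j \<omega>)) \<partial>M)
            = (\<integral>\<omega>. 1 \<partial>M) * (\<Prod>j\<in>J. \<integral>\<omega>. (indicator (A j) (Y j \<omega>) :: complex) \<partial>M)"
      by (rule weighted_char_factor_prod_indicator[where C=1]) (use J A factor in \<open>auto simp: prob_space\<close>)
    also have "(\<integral>\<omega>. 1 * (\<Prod>j\<in>J. indicator (A j) (Y j \<omega>)) \<partial>M)
        = (\<integral>\<omega>. complex_of_real (indicator (\<Inter>j\<in>J. Y j -` A j \<inter> space M) \<omega>) \<partial>M)"
    proof (intro Bochner_Integration.integral_cong refl)
      fix \<omega> assume w: "\<omega> \<in> space M"
      have "(\<Prod>j\<in>J. indicator (A j) (Y j \<omega>) :: complex) = (if \<forall>j\<in>J. Y j \<omega> \<in> A j then 1 else 0)"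
        using J(1) by (auto simp: indicator_def intro!: prod_zero)
      then show "1 * (\<Prod>j\<in>J. indicator (A j) (Y j \<omega>)) = complex_of_real (indicator (\<Inter>j\<in>J. Y j -` A j \<inter> space M) \<omega>)"
        using J w by (auto simp: indicator_def)
    qed
    also have "\<dots> = complex_of_real (prob ((\<Inter>j\<in>J. Y j -` A j \<inter> space M) \<inter> space M))"
      unfolding integral_complex_of_real by simp
    also have "(\<Inter>j\<in>J. Y j -` A j \<inter> space M) \<inter> space M = (\<Inter>j\<in>J. Y j -` A j \<inter> space M)"
      using J by auto
    finally have "complex_of_real (prob (\<Inter>j\<in>J. Y j -` A j \<inter> space M)) = complex_of_real (\<Prod>j\<in>J. prob (Y j -` A j \<inter> space M))"
      by (simp add: prob_space ind)
    then show ?thesis unfolding of_real_eq_iff .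
  qed
  moreover have "Int_stable (sets (borel :: real measure))" by (auto simp: Int_stable_def)
  ultimately show ?thesis
    by (subst indep_vars_finite[where E="\<lambda>_. sets borel"])
       (use J in \<open>auto simp: sets.sigma_sets_eq[of borel, simplified] \<close>)
qed

end

section \<open>Decoupling of Gaussian quadratic forms\<close>

lemma integrable_iexp_bounded:
  assumes "finite_measure M" "f \<in> borel_measurable M"
  shows "integrable M (\<lambda>\<omega>. iexp (f \<omega>))"
proof -
  interpret finite_measure M by fact
  show ?thesis using assms(2) by (intro integrable_const_bound[where B=1]) auto
qed

text \<open>Up to the constant factor \<open>\<sigma>\<close>, the integrand is again a centred normal density, with variance
  \<open>\<sigma>\<^sup>2 = 1 / (1 + 2 a)\<close>.\<close>

lemma integral_exp_square_std_normal:
  assumes "0 \<le> (a::real)"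
  shows "(\<integral>x. exp (- (a * x\<^sup>2)) \<partial>std_normal_distribution) = 1 / sqrt (1 + 2 * a)"
proof -
  define \<sigma> where "\<sigma> = 1 / sqrt (1 + 2 * a)"
  have s: "\<sigma> > 0" "\<sigma>\<^sup>2 = 1 / (1 + 2 * a)" using assms by (auto simp: \<sigma>_def power_divide)
  have e: "std_normal_density x * exp (- (a * x\<^sup>2)) = \<sigma> * normal_density 0 \<sigma> x" for x
  proof -
    have "exp (- x\<^sup>2 / 2) * exp (- (a * x\<^sup>2)) = exp (- x\<^sup>2 / (2 * \<sigma>\<^sup>2))"
      using assms by (simp add: s exp_add[symmetric] field_simps)
    moreover have "sqrt (2 * pi * \<sigma>\<^sup>2) = sqrt (2 * pi) * \<sigma>"
      using s(1) by (simp add: real_sqrt_mult)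
    ultimately show ?thesis
      using s(1) by (simp add: std_normal_density_def normal_density_def)
  qed
  have "(\<integral>x. exp (- (a * x\<^sup>2)) \<partial>std_normal_distribution) = (\<integral>x. std_normal_density x * exp (- (a * x\<^sup>2)) \<partial>lborel)"
    by (subst integral_density) auto
  also have "\<dots> = \<sigma>" unfolding e using s by simp
  finally show ?thesis by (simp add: \<sigma>_def)
qed

lemma iexp_std_normal: "(\<integral>x. iexp (t * x) \<partial>std_normal_distribution) = complex_of_real (exp (- (t\<^sup>2) / 2))"
  using fun_cong[OF char_std_normal_distribution, of t] by (simp add: char_def exp_of_real)

context prob_space
begin

text \<open>The assumption on the characteristic function makes the family \<open>U\<close> independent of the family \<open>V\<close>.
  For a fixed value of \<open>U\<close> the bilinear form is linear in \<open>V\<close>, so \<open>V\<close> can be integrated out first.\<close>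

lemma char_bilinear_form_gaussian:
  fixes U V :: "'i \<Rightarrow> 'a \<Rightarrow> real" and v :: "'i \<Rightarrow> real"
  assumes J: "finite J"
    and U[measurable]: "\<And>j. j \<in> J \<Longrightarrow> U j \<in> borel_measurable M"
    and V[measurable]: "\<And>j. j \<in> J \<Longrightarrow> V j \<in> borel_measurable M"
    and ch: "\<And>s r. (\<integral>\<omega>. iexp (\<Sum>j\<in>J. s j * U j \<omega> + r j * V j \<omega>) \<partial>M)
              = complex_of_real (exp (- (\<Sum>j\<in>J. v j * ((s j)\<^sup>2 + (r j)\<^sup>2)) / 2))"
  shows "(\<integral>\<omega>. iexp (\<Sum>j\<in>J. \<Sum>k\<in>J. b j k * U j \<omega> * V k \<omega>) \<partial>M)
       = complex_of_real (\<integral>\<omega>. exp (- (\<Sum>k\<in>J. v k * (\<Sum>j\<in>J. b j k * U j \<omega>)\<^sup>2) / 2) \<partial>M)"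
proof (cases "J = {}")
  case True
  then show ?thesis by (simp add: prob_space)
next
  case False
  \<comment> \<open>\<open>U\<close> and \<open>V\<close> as one family, whose independence follows from its characteristic function.\<close>
  define Y where "Y = (\<lambda>(j, c) \<omega>. if c then U j \<omega> else V j \<omega>)"
  define I where "I = J \<times> (UNIV :: bool set)"
  have I: "finite I" "I \<noteq> {}" using J False by (auto simp: I_def)
  have Ym[measurable]: "Y i \<in> borel_measurable M" if "i \<in> I" for i
    using that U V by (cases i) (auto simp: Y_def I_def)
  have sumI: "(\<Sum>i\<in>I. f i) = (\<Sum>j\<in>J. f (j, True) + f (j, False))" for f :: "_ \<Rightarrow> real"
    unfolding I_def by (simp add: sum.cartesian_product' UNIV_bool add.commute)
  have chY: "(\<integral>\<omega>. iexp (\<Sum>i\<in>I. s i * Y i \<omega>) \<partial>M)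
      = complex_of_real (exp (- (\<Sum>i\<in>I. v (fst i) * (s i)\<^sup>2) / 2))" for s
    using ch[of "\<lambda>j. s (j, True)" "\<lambda>j. s (j, False)"]
    by (simp add: sumI Y_def distrib_left)
  have ch1: "(\<integral>\<omega>. iexp (s i * Y i \<omega>) \<partial>M) = complex_of_real (exp (- (v (fst i) * (s i)\<^sup>2) / 2))" if "i \<in> I" for s i
  proof -
    have "(\<Sum>k\<in>I. (if k = i then s i else 0) * Y k \<omega>) = s i * Y i \<omega>" for \<omega>
      using sum.delta[OF I(1), of i "\<lambda>k. s k * Y k \<omega>"] that by (auto simp: if_distrib if_distribR cong: if_cong)
    moreover have "(\<Sum>k\<in>I. v (fst k) * (if k = i then s i else 0)\<^sup>2) = v (fst i) * (s i)\<^sup>2"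
      using sum.delta[OF I(1), of i "\<lambda>k. v (fst k) * (s k)\<^sup>2"] that by (auto simp: if_distrib if_distribR cong: if_cong)
    ultimately show ?thesis using chY[of "\<lambda>k. if k = i then s i else 0"] by simp
  qed
  have ind: "indep_vars (\<lambda>_. borel) Y I"
  proof (rule indep_vars_if_char_factors[OF I])
    fix s
    have "(\<Prod>i\<in>I. \<integral>\<omega>. iexp (s i * Y i \<omega>) \<partial>M) = (\<Prod>i\<in>I. complex_of_real (exp (- (v (fst i) * (s i)\<^sup>2) / 2)))"
      by (intro prod.cong refl) (rule ch1)
    also have "\<dots> = complex_of_real (exp (\<Sum>i\<in>I. - (v (fst i) * (s i)\<^sup>2) / 2))"
      using I by (simp add: exp_sum)
    also have "(\<Sum>i\<in>I. - (v (fst i) * (s i)\<^sup>2) / 2) = - (\<Sum>i\<in>I. v (fst i) * (s i)\<^sup>2) / 2"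
      by (simp add: sum_divide_distrib sum_negf)
    finally show "(\<integral>\<omega>. iexp (\<Sum>j\<in>I. s j * Y j \<omega>) \<partial>M) = (\<Prod>j\<in>I. \<integral>\<omega>. iexp (s j * Y j \<omega>) \<partial>M)"
      unfolding chY ..
  qed (rule Ym)
  define A where "A = J \<times> {True}"
  define B where "B = J \<times> {False}"
  let ?PA = "PiM A (\<lambda>_. borel :: real measure)" and ?PB = "PiM B (\<lambda>_. borel :: real measure)"
  let ?YA = "\<lambda>\<omega>. restrict (\<lambda>i. Y i \<omega>) A" and ?YB = "\<lambda>\<omega>. restrict (\<lambda>i. Y i \<omega>) B"
  have AB: "A \<inter> B = {}" "A \<subseteq> I" "B \<subseteq> I" by (auto simp: A_def B_def I_def)
  have iv: "indep_var ?PA ?YA ?PB ?YB"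
    by (rule indep_var_restrict[OF ind AB])
  have rvA[measurable]: "?YA \<in> measurable M ?PA" and rvB[measurable]: "?YB \<in> measurable M ?PB"
    and deq: "distr M ?PA ?YA \<Otimes>\<^sub>M distr M ?PB ?YB = distr M (?PA \<Otimes>\<^sub>M ?PB) (\<lambda>\<omega>. (?YA \<omega>, ?YB \<omega>))"
    using iv unfolding indep_var_distribution_eq by auto
  define DA where "DA = distr M ?PA ?YA"
  define DB where "DB = distr M ?PB ?YB"
  interpret DA: prob_space DA unfolding DA_def by (rule prob_space_distr) (rule rvA)
  interpret DB: prob_space DB unfolding DB_def by (rule prob_space_distr) (rule rvB)
  interpret AB: pair_prob_space DA DB ..
  have setsDA[measurable_cong]: "sets DA = sets ?PA" and setsDB[measurable_cong]: "sets DB = sets ?PB"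
    by (auto simp: DA_def DB_def)
  define q where "q = (\<lambda>x y :: 'i \<times> bool \<Rightarrow> real. \<Sum>j\<in>J. \<Sum>k\<in>J. b j k * x (j, True) * y (k, False))"
  have mem: "(j, True) \<in> A" "(j, False) \<in> B" if "j \<in> J" for j using that by (auto simp: A_def B_def)
  have q[measurable]: "(\<lambda>z. q (fst z) (snd z)) \<in> borel_measurable (?PA \<Otimes>\<^sub>M ?PB)"
    unfolding q_def
    by (intro borel_measurable_sum borel_measurable_times borel_measurable_const
        measurable_compose[OF measurable_fst measurable_component_singleton]
        measurable_compose[OF measurable_snd measurable_component_singleton]) (auto simp: mem)
  have q'[measurable]: "(\<lambda>z. q (fst z) (snd z)) \<in> borel_measurable (DA \<Otimes>\<^sub>M DB)"
    using q by (simp cong: measurable_cong_sets add: setsDA setsDB sets_pair_measure_cong[OF setsDA setsDB])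
  have qY: "q (?YA \<omega>) (?YB \<omega>) = (\<Sum>j\<in>J. \<Sum>k\<in>J. b j k * U j \<omega> * V k \<omega>)" for \<omega>
    unfolding q_def by (intro sum.cong refl) (auto simp: mem Y_def)
  have inner: "(\<integral>y. iexp (q x y) \<partial>DB) = complex_of_real (exp (- (\<Sum>k\<in>J. v k * (\<Sum>j\<in>J. b j k * x (j, True))\<^sup>2) / 2))" for x
  proof -
    define c where "c = (\<lambda>k. \<Sum>j\<in>J. b j k * x (j, True))"
    have qx: "q x y = (\<Sum>k\<in>J. c k * y (k, False))" for y
      unfolding q_def c_def by (subst sum.swap) (simp add: sum_distrib_right)
    have qm: "q x \<in> borel_measurable ?PB"
      unfolding q_def
      by (intro borel_measurable_sum borel_measurable_times borel_measurable_const
        measurable_component_singleton) (auto simp: mem)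
    have "(\<integral>y. iexp (q x y) \<partial>DB) = (\<integral>\<omega>. iexp (q x (?YB \<omega>)) \<partial>M)"
      unfolding DB_def using qm by (subst integral_distr[OF rvB]) (auto simp: comp_def intro: measurable_compose[OF qm])
    also have "\<dots> = (\<integral>\<omega>. iexp (\<Sum>j\<in>J. 0 * U j \<omega> + c j * V j \<omega>) \<partial>M)"
      unfolding qx by (intro Bochner_Integration.integral_cong refl arg_cong[where f=iexp] sum.cong) (auto simp: mem Y_def)
    also have "\<dots> = complex_of_real (exp (- (\<Sum>k\<in>J. v k * (c k)\<^sup>2) / 2))"
      by (subst ch) simp
    finally show ?thesis by (simp add: c_def)
  qed
  have intq: "integrable (DA \<Otimes>\<^sub>M DB) (\<lambda>(x, y). iexp (q x y))"
    unfolding split_beta' by (rule integrable_iexp_bounded) (use q' in \<open>auto intro: AB.P.finite_measure_axioms\<close>)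
  have "(\<integral>\<omega>. iexp (\<Sum>j\<in>J. \<Sum>k\<in>J. b j k * U j \<omega> * V k \<omega>) \<partial>M) = (\<integral>\<omega>. iexp (q (?YA \<omega>) (?YB \<omega>)) \<partial>M)"
    by (simp only: qY)
  also have "\<dots> = (\<integral>z. iexp (q (fst z) (snd z)) \<partial>distr M (?PA \<Otimes>\<^sub>M ?PB) (\<lambda>\<omega>. (?YA \<omega>, ?YB \<omega>)))"
    by (subst integral_distr) auto
  also have "\<dots> = (\<integral>z. iexp (q (fst z) (snd z)) \<partial>(DA \<Otimes>\<^sub>M DB))"
    unfolding DA_def DB_def deq ..
  also have "\<dots> = (\<integral>x. (\<integral>y. iexp (q x y) \<partial>DB) \<partial>DA)"
    using AB.integral_fst'[OF intq] by (simp add: split_beta')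
  also have "\<dots> = (\<integral>x. complex_of_real (exp (- (\<Sum>k\<in>J. v k * (\<Sum>j\<in>J. b j k * x (j, True))\<^sup>2) / 2)) \<partial>DA)"
    unfolding inner ..
  also have "\<dots> = complex_of_real (\<integral>x. exp (- (\<Sum>k\<in>J. v k * (\<Sum>j\<in>J. b j k * x (j, True))\<^sup>2) / 2) \<partial>DA)"
    by (rule integral_complex_of_real)
  also have "(\<integral>x. exp (- (\<Sum>k\<in>J. v k * (\<Sum>j\<in>J. b j k * x (j, True))\<^sup>2) / 2) \<partial>DA)
     = (\<integral>\<omega>. exp (- (\<Sum>k\<in>J. v k * (\<Sum>j\<in>J. b j k * ?YA \<omega> (j, True))\<^sup>2) / 2) \<partial>M)"
    unfolding DA_def
  proof (rule integral_distr[OF rvA])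
    have [measurable]: "(\<lambda>x. x (j, True)) \<in> borel_measurable ?PA" if "j \<in> J" for j
      using that by (intro measurable_component_singleton) (auto simp: mem)
    show "(\<lambda>x. exp (- (\<Sum>k\<in>J. v k * (\<Sum>j\<in>J. b j k * x (j, True))\<^sup>2) / 2)) \<in> borel_measurable ?PA"
      by measurable
  qed
  also have "\<dots> = (\<integral>\<omega>. exp (- (\<Sum>k\<in>J. v k * (\<Sum>j\<in>J. b j k * U j \<omega>)\<^sup>2) / 2) \<partial>M)"
    by (intro Bochner_Integration.integral_cong refl arg_cong[where f=exp] arg_cong2[where f="(/)"] arg_cong[where f=uminus] sum.cong arg_cong2[where f="(*)"] arg_cong2[where f=power])
       (auto simp: mem Y_def)
  finally show ?thesis .
qed

end

context prob_space
begin

text \<open>\<open>U\<close> and \<open>V j (\<omega>, \<omega>') = (X j \<omega> - X j \<omega>') / sqrt 2\<close> are again independent copies of \<open>X\<close>, and by the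
  symmetry of \<open>b\<close> the difference of the quadratic form at \<open>\<omega>\<close> and at \<open>\<omega>'\<close> is \<open>2 b(U, V)\<close>.\<close>

lemma cmod_char_symmetric_quadratic_form:
  fixes X :: "'i \<Rightarrow> 'a \<Rightarrow> real" and v :: "'i \<Rightarrow> real"
  assumes J: "finite J"
    and X[measurable]: "\<And>j. j \<in> J \<Longrightarrow> X j \<in> borel_measurable M"
    and ch: "\<And>s. (\<integral>\<omega>. iexp (\<Sum>j\<in>J. s j * X j \<omega>) \<partial>M) = complex_of_real (exp (- (\<Sum>j\<in>J. v j * (s j)\<^sup>2) / 2))"
    and sym: "\<And>j k. b j k = b k j"
    and U_def: "U = (\<lambda>j (\<omega>, \<omega>'). (X j \<omega> + X j \<omega>') / sqrt 2)"
  shows "(cmod (\<integral>\<omega>. iexp (\<Sum>j\<in>J. \<Sum>k\<in>J. b j k * X j \<omega> * X k \<omega>) \<partial>M))\<^sup>2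
       = (\<integral>z. exp (- (\<Sum>k\<in>J. v k * (\<Sum>j\<in>J. 2 * b j k * U j z)\<^sup>2) / 2) \<partial>(M \<Otimes>\<^sub>M M))"
    and "\<And>j. j \<in> J \<Longrightarrow> U j \<in> borel_measurable (M \<Otimes>\<^sub>M M)"
    and "\<And>s. (\<integral>z. iexp (\<Sum>j\<in>J. s j * U j z) \<partial>(M \<Otimes>\<^sub>M M))
             = complex_of_real (exp (- (\<Sum>j\<in>J. v j * (s j)\<^sup>2) / 2))"
proof -
  interpret MM: pair_prob_space M M ..
  define V where "V = (\<lambda>j (\<omega>, \<omega>'). (X j \<omega> - X j \<omega>') / sqrt 2)"
  show U[measurable]: "\<And>j. j \<in> J \<Longrightarrow> U j \<in> borel_measurable (M \<Otimes>\<^sub>M M)"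
    unfolding U_def by measurable
  have V[measurable]: "\<And>j. j \<in> J \<Longrightarrow> V j \<in> borel_measurable (M \<Otimes>\<^sub>M M)"
    unfolding V_def by measurable
  define q where "q = (\<lambda>\<omega>. \<Sum>j\<in>J. \<Sum>k\<in>J. b j k * X j \<omega> * X k \<omega>)"
  have q[measurable]: "q \<in> borel_measurable M" unfolding q_def by measurable
  have chain: "(\<integral>z. iexp (f (fst z)) * iexp (g (snd z)) \<partial>(M \<Otimes>\<^sub>M M)) = (\<integral>\<omega>. iexp (f \<omega>) \<partial>M) * (\<integral>\<omega>. iexp (g \<omega>) \<partial>M)"
    if [measurable]: "f \<in> borel_measurable M" "g \<in> borel_measurable M" for f g
  proof -
    have "integrable (M \<Otimes>\<^sub>M M) (\<lambda>z. iexp (f (fst z) + g (snd z)))"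
      by (rule integrable_iexp_bounded) (auto intro: MM.P.finite_measure_axioms)
    then have int: "integrable (M \<Otimes>\<^sub>M M) (\<lambda>(x, y). iexp (f x) * iexp (g y))"
      by (simp add: split_beta' exp_add distrib_left)
    show ?thesis using MM.integral_fst'[OF int] by (simp add: split_beta')
  qed
  have ch2: "(\<integral>z. iexp (\<Sum>j\<in>J. s j * U j z + r j * V j z) \<partial>(M \<Otimes>\<^sub>M M))
              = complex_of_real (exp (- (\<Sum>j\<in>J. v j * ((s j)\<^sup>2 + (r j)\<^sup>2)) / 2))" for s r
  proof -
    let ?f = "\<lambda>\<omega>. \<Sum>j\<in>J. ((s j + r j) / sqrt 2) * X j \<omega>" and ?g = "\<lambda>\<omega>. \<Sum>j\<in>J. ((s j - r j) / sqrt 2) * X j \<omega>"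
    have "iexp (\<Sum>j\<in>J. s j * U j z + r j * V j z) = iexp (?f (fst z)) * iexp (?g (snd z))" for z
    proof -
      have "(\<Sum>j\<in>J. s j * U j z + r j * V j z) = ?f (fst z) + ?g (snd z)"
        unfolding sum.distrib[symmetric]
        by (intro sum.cong refl) (auto simp: U_def V_def split_beta' field_simps)
      then show ?thesis by (simp add: exp_add distrib_left)
    qed
    then have "(\<integral>z. iexp (\<Sum>j\<in>J. s j * U j z + r j * V j z) \<partial>(M \<Otimes>\<^sub>M M))
        = (\<integral>\<omega>. iexp (?f \<omega>) \<partial>M) * (\<integral>\<omega>. iexp (?g \<omega>) \<partial>M)"
      by (simp only:) (rule chain; measurable)
    also have "\<dots> = complex_of_real (exp (- (\<Sum>j\<in>J. v j * ((s j + r j) / sqrt 2)\<^sup>2) / 2 + - (\<Sum>j\<in>J. v j * ((s j - r j) / sqrt 2)\<^sup>2) / 2))"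
      unfolding ch exp_add of_real_mult ..
    also have "- (\<Sum>j\<in>J. v j * ((s j + r j) / sqrt 2)\<^sup>2) / 2 + - (\<Sum>j\<in>J. v j * ((s j - r j) / sqrt 2)\<^sup>2) / 2
       = - (\<Sum>j\<in>J. v j * ((s j + r j) / sqrt 2)\<^sup>2 + v j * ((s j - r j) / sqrt 2)\<^sup>2) / 2"
      by (simp add: sum.distrib)
    also have "(\<Sum>j\<in>J. v j * ((s j + r j) / sqrt 2)\<^sup>2 + v j * ((s j - r j) / sqrt 2)\<^sup>2) = (\<Sum>j\<in>J. v j * ((s j)\<^sup>2 + (r j)\<^sup>2))"
      by (intro sum.cong refl) (simp add: power_divide power2_sum power2_diff field_simps)
    finally show ?thesis .
  qed
  show "\<And>s. (\<integral>z. iexp (\<Sum>j\<in>J. s j * U j z) \<partial>(M \<Otimes>\<^sub>M M))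
             = complex_of_real (exp (- (\<Sum>j\<in>J. v j * (s j)\<^sup>2) / 2))"
    using ch2[of _ "\<lambda>_. 0"] by simp
  have qq: "q (fst z) - q (snd z) = (\<Sum>j\<in>J. \<Sum>k\<in>J. 2 * b j k * U j z * V k z)" for z
  proof -
    obtain x y where z: "z = (x, y)" by force
    have "(\<Sum>j\<in>J. \<Sum>k\<in>J. 2 * b j k * U j z * V k z)
      = (\<Sum>j\<in>J. \<Sum>k\<in>J. b j k * X j x * X k x - b j k * X j y * X k y + (b j k * X j y * X k x - b j k * X j x * X k y))"
      by (intro sum.cong refl) (simp add: z U_def V_def field_simps)
    also have "\<dots> = q x - q y + ((\<Sum>j\<in>J. \<Sum>k\<in>J. b j k * X j y * X k x) - (\<Sum>j\<in>J. \<Sum>k\<in>J. b j k * X j x * X k y))"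
      by (simp add: sum.distrib sum_subtractf q_def)
    also have "(\<Sum>j\<in>J. \<Sum>k\<in>J. b j k * X j y * X k x) = (\<Sum>j\<in>J. \<Sum>k\<in>J. b j k * X j x * X k y)"
      by (subst sum.swap) (simp add: sym mult_ac)
    finally show ?thesis by (simp add: z)
  qed
  have "complex_of_real ((cmod (\<integral>\<omega>. iexp (q \<omega>) \<partial>M))\<^sup>2) = (\<integral>\<omega>. iexp (q \<omega>) \<partial>M) * cnj (\<integral>\<omega>. iexp (q \<omega>) \<partial>M)"
    by (rule complex_norm_square)
  also have "cnj (\<integral>\<omega>. iexp (q \<omega>) \<partial>M) = (\<integral>\<omega>. iexp (- q \<omega>) \<partial>M)"
    unfolding Bochner_Integration.integral_cnj[symmetric] by (simp add: exp_cnj)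
  also have "(\<integral>\<omega>. iexp (q \<omega>) \<partial>M) * (\<integral>\<omega>. iexp (- q \<omega>) \<partial>M) = (\<integral>z. iexp (q (fst z)) * iexp (- q (snd z)) \<partial>(M \<Otimes>\<^sub>M M))"
    by (rule chain[symmetric]) measurable
  also have "\<dots> = (\<integral>z. iexp (\<Sum>j\<in>J. \<Sum>k\<in>J. 2 * b j k * U j z * V k z) \<partial>(M \<Otimes>\<^sub>M M))"
    unfolding qq[symmetric] by (simp add: exp_add[symmetric] algebra_simps)
  also have "\<dots> = complex_of_real (\<integral>z. exp (- (\<Sum>k\<in>J. v k * (\<Sum>j\<in>J. 2 * b j k * U j z)\<^sup>2) / 2) \<partial>(M \<Otimes>\<^sub>M M))"
    by (rule MM.P.char_bilinear_form_gaussian[OF J U V ch2])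
  finally show "(cmod (\<integral>\<omega>. iexp (\<Sum>j\<in>J. \<Sum>k\<in>J. b j k * X j \<omega> * X k \<omega>) \<partial>M))\<^sup>2
       = (\<integral>z. exp (- (\<Sum>k\<in>J. v k * (\<Sum>j\<in>J. 2 * b j k * U j z)\<^sup>2) / 2) \<partial>(M \<Otimes>\<^sub>M M))"
    unfolding of_real_eq_iff q_def .
qed

text \<open>The exponential on the left is the characteristic function of a standard Gaussian vector \<open>N\<close>, so
  both sides are the mean of \<open>exp (\<i> \<Sum>\<^sub>m \<Sum>\<^sub>j N m * g m j * U j)\<close>, with the two integrations taken in
  different order.\<close>

lemma gaussian_exp_neg_sum_squares:
  fixes U :: "'i \<Rightarrow> 'a \<Rightarrow> real" and v :: "'i \<Rightarrow> real" and g :: "'m::finite \<Rightarrow> 'i \<Rightarrow> real"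
  assumes J: "finite J"
    and U[measurable]: "\<And>j. j \<in> J \<Longrightarrow> U j \<in> borel_measurable M"
    and ch: "\<And>s. (\<integral>\<omega>. iexp (\<Sum>j\<in>J. s j * U j \<omega>) \<partial>M) = complex_of_real (exp (- (\<Sum>j\<in>J. v j * (s j)\<^sup>2) / 2))"
  shows "(\<integral>\<omega>. exp (- (\<Sum>m\<in>UNIV. (\<Sum>j\<in>J. g m j * U j \<omega>)\<^sup>2) / 2) \<partial>M)
       = (\<integral>N. exp (- (\<Sum>j\<in>J. v j * (\<Sum>m\<in>UNIV. N m * g m j)\<^sup>2) / 2) \<partial>PiM (UNIV :: 'm set) (\<lambda>_. std_normal_distribution))"
proof -
  interpret N: real_distribution std_normal_distribution by (rule real_dist_normal_dist)
  interpret PN: finite_product_sigma_finite "\<lambda>_. std_normal_distribution" "UNIV :: 'm set"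
    by unfold_locales auto
  define P where "P = PiM (UNIV :: 'm set) (\<lambda>_. std_normal_distribution)"
  interpret P: prob_space P unfolding P_def by (rule prob_space_PiM) unfold_locales
  interpret MP: pair_prob_space M P ..
  have comp[measurable]: "(\<lambda>N. N m) \<in> borel_measurable P" for m
    unfolding P_def using measurable_component_singleton[of m UNIV "\<lambda>_. std_normal_distribution"] by simp
  have gs: "(\<integral>N. iexp (\<Sum>m\<in>UNIV. N m * y m) \<partial>P) = complex_of_real (exp (- (\<Sum>m\<in>UNIV. (y m)\<^sup>2) / 2))" for y
  proof -
    have "(\<integral>N. iexp (\<Sum>m\<in>UNIV. N m * y m) \<partial>P) = (\<integral>N. (\<Prod>m\<in>UNIV. iexp (y m * N m)) \<partial>P)"
      by (simp add: exp_sum[symmetric] sum_distrib_left mult_ac)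
    also have "\<dots> = (\<Prod>m\<in>UNIV. (\<integral>x. iexp (y m * x) \<partial>std_normal_distribution))"
      unfolding P_def by (rule PN.product_integral_prod)
        (simp, rule integrable_iexp_bounded, auto intro: N.finite_measure_axioms)
    also have "\<dots> = (\<Prod>m\<in>UNIV. complex_of_real (exp (- ((y m)\<^sup>2) / 2)))" unfolding iexp_std_normal ..
    also have "\<dots> = complex_of_real (exp (\<Sum>m\<in>UNIV. - ((y m)\<^sup>2) / 2))" by (simp add: exp_sum)
    also have "(\<Sum>m\<in>UNIV. - ((y m)\<^sup>2) / 2) = - (\<Sum>m\<in>UNIV. (y m)\<^sup>2) / 2"
      by (simp add: sum_divide_distrib sum_negf)
    finally show ?thesis .
  qed
  define h where "h = (\<lambda>\<omega> N. \<Sum>m\<in>UNIV. N m * (\<Sum>j\<in>J. g m j * U j \<omega>))"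
  have hm: "(\<lambda>z. h (fst z) (snd z)) \<in> borel_measurable (M \<Otimes>\<^sub>M P)"
    unfolding h_def by measurable
  have int: "integrable (M \<Otimes>\<^sub>M P) (\<lambda>(\<omega>, N). iexp (h \<omega> N))"
    unfolding split_beta' by (rule integrable_iexp_bounded) (use hm in \<open>auto intro: MP.P.finite_measure_axioms\<close>)
  have h2: "h \<omega> N = (\<Sum>j\<in>J. (\<Sum>m\<in>UNIV. N m * g m j) * U j \<omega>)" for \<omega> N
    unfolding h_def sum_distrib_left sum_distrib_right by (subst sum.swap) (simp add: mult_ac)
  have "complex_of_real (\<integral>\<omega>. exp (- (\<Sum>m\<in>UNIV. (\<Sum>j\<in>J. g m j * U j \<omega>)\<^sup>2) / 2) \<partial>M)
     = (\<integral>\<omega>. (\<integral>N. iexp (h \<omega> N) \<partial>P) \<partial>M)"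
    unfolding h_def gs integral_complex_of_real ..
  also have "\<dots> = (\<integral>N. (\<integral>\<omega>. iexp (h \<omega> N) \<partial>M) \<partial>P)"
    by (rule MP.Fubini_integral[OF int, symmetric])
  also have "\<dots> = complex_of_real (\<integral>N. exp (- (\<Sum>j\<in>J. v j * (\<Sum>m\<in>UNIV. N m * g m j)\<^sup>2) / 2) \<partial>P)"
    unfolding h2 ch integral_complex_of_real ..
  finally show ?thesis unfolding of_real_eq_iff P_def .
qed

text \<open>Think of \<open>X j\<close> as the values of a white noise on disjoint cells of volume \<open>v j\<close>, and of \<open>p m j\<close> as the
  integral over the \<open>j\<close>-th cell of the \<open>m\<close>-th of finitely many orthonormal functions. Then
  \<open>bessel\<close> is Bessel's inequality for step functions, and \<open>pos\<close> says that the form \<open>b\<close>, compressed to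
  the span of these functions, is at least \<open>c\<close>. Each such direction contributes one factor, as one
  eigenvalue of \<open>b\<close> of modulus \<open>c\<close> would.\<close>

proposition cmod_char_quadratic_form_le:
  fixes X :: "'i \<Rightarrow> 'a \<Rightarrow> real" and v :: "'i \<Rightarrow> real" and p :: "'m::finite \<Rightarrow> 'i \<Rightarrow> real"
  assumes J: "finite J"
    and X[measurable]: "\<And>j. j \<in> J \<Longrightarrow> X j \<in> borel_measurable M"
    and ch: "\<And>s. (\<integral>\<omega>. iexp (\<Sum>j\<in>J. s j * X j \<omega>) \<partial>M) = complex_of_real (exp (- (\<Sum>j\<in>J. v j * (s j)\<^sup>2) / 2))"
    and v: "\<And>j. j \<in> J \<Longrightarrow> 0 \<le> v j"
    and bessel: "\<And>y. (\<Sum>m\<in>UNIV. (\<Sum>j\<in>J. p m j * y j)\<^sup>2) \<le> (\<Sum>j\<in>J. v j * (y j)\<^sup>2)"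
    and pos: "\<And>N. c * (\<Sum>m\<in>UNIV. (N m)\<^sup>2)
        \<le> (\<Sum>m\<in>UNIV. \<Sum>m'\<in>UNIV. N m * N m' * (\<Sum>j\<in>J. \<Sum>k\<in>J. b j k * p m j * p m' k))"
    and c: "0 \<le> c"
  shows "(cmod (\<integral>\<omega>. iexp (t * (\<Sum>j\<in>J. \<Sum>k\<in>J. b j k * X j \<omega> * X k \<omega>)) \<partial>M))\<^sup>2
      \<le> (1 / sqrt (1 + (2 * c * t)\<^sup>2)) ^ CARD('m)"
proof -
  interpret MM: pair_prob_space M M ..
  interpret N: real_distribution std_normal_distribution by (rule real_dist_normal_dist)
  interpret PN: finite_product_sigma_finite "\<lambda>_. std_normal_distribution" "UNIV :: 'm set"
    by unfold_locales auto
  define P where "P = PiM (UNIV :: 'm set) (\<lambda>_. std_normal_distribution)"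
  interpret P: prob_space P unfolding P_def by (rule prob_space_PiM) unfold_locales
  have comp[measurable]: "(\<lambda>N. N m) \<in> borel_measurable P" for m
    unfolding P_def using measurable_component_singleton[of m UNIV "\<lambda>_. std_normal_distribution"] by simp
  \<comment> \<open>A quadratic form depends only on the symmetric part of its matrix; the factor \<open>t\<close> is absorbed here.\<close>
  define b' where "b' = (\<lambda>j k. t * (b j k + b k j) / 2)"
  define U where "U = (\<lambda>j (\<omega>, \<omega>'). (X j \<omega> + X j \<omega>') / sqrt 2)"
  define g where "g = (\<lambda>m j. \<Sum>k\<in>J. 2 * b' j k * p m k)"
  have symb: "b' j k = b' k j" for j k by (simp add: b'_def add.commute)
  have sq: "t * (\<Sum>j\<in>J. \<Sum>k\<in>J. b j k * x j * y k) + t * (\<Sum>j\<in>J. \<Sum>k\<in>J. b j k * y j * x k)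
      = 2 * (\<Sum>j\<in>J. \<Sum>k\<in>J. b' j k * x j * y k)" for x y :: "'i \<Rightarrow> real"
  proof -
    have "(\<Sum>j\<in>J. \<Sum>k\<in>J. b j k * y j * x k) = (\<Sum>j\<in>J. \<Sum>k\<in>J. b k j * x j * y k)"
      by (subst sum.swap) (simp add: mult_ac)
    moreover have "2 * (\<Sum>j\<in>J. \<Sum>k\<in>J. b' j k * x j * y k)
       = (\<Sum>j\<in>J. \<Sum>k\<in>J. t * (b j k * x j * y k) + t * (b k j * x j * y k))"
      unfolding sum_distrib_left by (intro sum.cong refl) (simp add: b'_def field_simps)
    ultimately show ?thesis by (simp only: sum.distrib sum_distrib_left)
  qed
  note F = cmod_char_symmetric_quadratic_form[OF J X ch symb U_def]
  have Um[measurable]: "\<And>j. j \<in> J \<Longrightarrow> U j \<in> borel_measurable (M \<Otimes>\<^sub>M M)" by (rule F(2))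
  have "(cmod (\<integral>\<omega>. iexp (t * (\<Sum>j\<in>J. \<Sum>k\<in>J. b j k * X j \<omega> * X k \<omega>)) \<partial>M))\<^sup>2
     = (cmod (\<integral>\<omega>. iexp (\<Sum>j\<in>J. \<Sum>k\<in>J. b' j k * X j \<omega> * X k \<omega>) \<partial>M))\<^sup>2"
  proof -
    have "t * (\<Sum>j\<in>J. \<Sum>k\<in>J. b j k * X j \<omega> * X k \<omega>) = (\<Sum>j\<in>J. \<Sum>k\<in>J. b' j k * X j \<omega> * X k \<omega>)" for \<omega>
      using sq[of "\<lambda>j. X j \<omega>" "\<lambda>j. X j \<omega>"] by simp
    then show ?thesis by (simp only:)
  qed
  also have "\<dots> = (\<integral>z. exp (- (\<Sum>k\<in>J. v k * (\<Sum>j\<in>J. 2 * b' j k * U j z)\<^sup>2) / 2) \<partial>(M \<Otimes>\<^sub>M M))"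
    by (rule F(1))
  also have "\<dots> \<le> (\<integral>z. exp (- (\<Sum>m\<in>UNIV. (\<Sum>j\<in>J. g m j * U j z)\<^sup>2) / 2) \<partial>(M \<Otimes>\<^sub>M M))"
  proof (rule integral_mono)
    have nn: "0 \<le> (\<Sum>k\<in>J. v k * (\<Sum>j\<in>J. 2 * b' j k * U j z)\<^sup>2)" for z
      by (intro sum_nonneg mult_nonneg_nonneg v) auto
    show "integrable (M \<Otimes>\<^sub>M M) (\<lambda>z. exp (- (\<Sum>k\<in>J. v k * (\<Sum>j\<in>J. 2 * b' j k * U j z)\<^sup>2) / 2))"
      by (rule MM.P.integrable_const_bound[where B=1]) (use nn in auto)
    show "integrable (M \<Otimes>\<^sub>M M) (\<lambda>z. exp (- (\<Sum>m\<in>UNIV. (\<Sum>j\<in>J. g m j * U j z)\<^sup>2) / 2))"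
      by (rule MM.P.integrable_const_bound[where B=1]) (auto intro!: sum_nonneg)
    fix z
    have "(\<Sum>k\<in>J. p m k * (\<Sum>j\<in>J. 2 * b' j k * U j z)) = (\<Sum>j\<in>J. g m j * U j z)" for m
      unfolding g_def sum_distrib_left sum_distrib_right by (subst sum.swap) (simp add: mult_ac)
    with bessel[of "\<lambda>k. \<Sum>j\<in>J. 2 * b' j k * U j z"]
    show "exp (- (\<Sum>k\<in>J. v k * (\<Sum>j\<in>J. 2 * b' j k * U j z)\<^sup>2) / 2)
        \<le> exp (- (\<Sum>m\<in>UNIV. (\<Sum>j\<in>J. g m j * U j z)\<^sup>2) / 2)"
      by simp
  qed
  also have "\<dots> = (\<integral>N. exp (- (\<Sum>j\<in>J. v j * (\<Sum>m\<in>UNIV. N m * g m j)\<^sup>2) / 2) \<partial>P)"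
    unfolding P_def by (rule MM.P.gaussian_exp_neg_sum_squares[OF J Um F(3)])
  also have "\<dots> \<le> (\<integral>N. (\<Prod>m\<in>UNIV. exp (- (2 * (c * t)\<^sup>2 * (N m)\<^sup>2))) \<partial>P)"
  proof (rule integral_mono)
    have nn: "0 \<le> (\<Sum>j\<in>J. v j * (\<Sum>m\<in>UNIV. N m * g m j)\<^sup>2)" for N
      by (intro sum_nonneg mult_nonneg_nonneg v) auto
    show "integrable P (\<lambda>N. exp (- (\<Sum>j\<in>J. v j * (\<Sum>m\<in>UNIV. N m * g m j)\<^sup>2) / 2))"
      by (rule P.integrable_const_bound[where B=1]) (use nn in auto)
    show "integrable P (\<lambda>N. \<Prod>m\<in>UNIV. exp (- (2 * (c * t)\<^sup>2 * (N m)\<^sup>2)))"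
      by (rule P.integrable_const_bound[where B=1])
         (auto simp: abs_prod intro!: prod_le_1)
    fix N :: "'m \<Rightarrow> real"
    define S where "S = (\<Sum>m\<in>UNIV. (N m)\<^sup>2)"
    define y where "y = (\<lambda>j. \<Sum>m\<in>UNIV. N m * g m j)"
    define L where "L = (\<lambda>m. \<Sum>j\<in>J. p m j * y j)"
    have S0: "0 \<le> S" by (simp add: S_def sum_nonneg)
    have "(\<Sum>m\<in>UNIV. N m * L m) = 2 * (\<Sum>m\<in>UNIV. \<Sum>m'\<in>UNIV. N m * N m' * (\<Sum>j\<in>J. \<Sum>k\<in>J. b' j k * p m j * p m' k))"
      (is "?l = _")
    proof -
      have "L m = (\<Sum>m'\<in>UNIV. 2 * (N m' * (\<Sum>j\<in>J. \<Sum>k\<in>J. b' j k * p m j * p m' k)))" for m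
        unfolding L_def y_def g_def sum_distrib_left
        by (rule trans[OF sum.swap]) (simp add: mult_ac)
      then show ?thesis by (simp add: sum_distrib_left mult_ac)
    qed
    also have "\<dots> = (\<Sum>m\<in>UNIV. \<Sum>m'\<in>UNIV. N m * N m' * (t * (\<Sum>j\<in>J. \<Sum>k\<in>J. b j k * p m j * p m' k)
         + t * (\<Sum>j\<in>J. \<Sum>k\<in>J. b j k * p m' j * p m k)))"
      unfolding sq by (simp add: sum_distrib_left mult_ac)
    also have "\<dots> = t * (\<Sum>m\<in>UNIV. \<Sum>m'\<in>UNIV. N m * N m' * (\<Sum>j\<in>J. \<Sum>k\<in>J. b j k * p m j * p m' k))
        + t * (\<Sum>m\<in>UNIV. \<Sum>m'\<in>UNIV. N m * N m' * (\<Sum>j\<in>J. \<Sum>k\<in>J. b j k * p m' j * p m k))"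
      by (simp add: distrib_left sum.distrib sum_distrib_left mult_ac)
    also have "(\<Sum>m\<in>UNIV. \<Sum>m'\<in>UNIV. N m * N m' * (\<Sum>j\<in>J. \<Sum>k\<in>J. b j k * p m' j * p m k))
      = (\<Sum>m\<in>UNIV. \<Sum>m'\<in>UNIV. N m * N m' * (\<Sum>j\<in>J. \<Sum>k\<in>J. b j k * p m j * p m' k))"
      by (subst sum.swap) (simp add: mult_ac)
    finally have l: "?l = 2 * t * (\<Sum>m\<in>UNIV. \<Sum>m'\<in>UNIV. N m * N m' * (\<Sum>j\<in>J. \<Sum>k\<in>J. b j k * p m j * p m' k))"
      by simp
    \<comment> \<open>Lower bound for \<open>\<bar>L\<bar>\<^sup>2\<close>: pair \<open>L\<close> with \<open>N\<close> itself, use the positivity of the form, and apply Cauchy--Schwarz.\<close>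
    have "(2 * t * c * S)\<^sup>2 \<le> ?l\<^sup>2"
    proof -
      have "(c * S)\<^sup>2 \<le> (\<Sum>m\<in>UNIV. \<Sum>m'\<in>UNIV. N m * N m' * (\<Sum>j\<in>J. \<Sum>k\<in>J. b j k * p m j * p m' k))\<^sup>2"
        using pos[of N] c S0 by (intro power_mono) (auto simp: S_def)
      then have "(2 * t)\<^sup>2 * (c * S)\<^sup>2 \<le> (2 * t)\<^sup>2 * (\<Sum>m\<in>UNIV. \<Sum>m'\<in>UNIV. N m * N m' * (\<Sum>j\<in>J. \<Sum>k\<in>J. b j k * p m j * p m' k))\<^sup>2"
        by (rule mult_left_mono) simp
      then show ?thesis unfolding l by (simp add: power_mult_distrib mult_ac)
    qed
    also have "?l\<^sup>2 \<le> S * (\<Sum>m\<in>UNIV. (L m)\<^sup>2)"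
      unfolding S_def by (rule Cauchy_Schwarz_ineq_sum)
    finally have "S * ((2 * t * c)\<^sup>2 * S) \<le> S * (\<Sum>m\<in>UNIV. (L m)\<^sup>2)"
      by (simp add: power_mult_distrib power2_eq_square mult_ac)
    then have "(2 * t * c)\<^sup>2 * S \<le> (\<Sum>m\<in>UNIV. (L m)\<^sup>2)"
      using S0 by (cases "S = 0") (auto simp: sum_nonneg mult_le_cancel_left)
    also have "\<dots> \<le> (\<Sum>j\<in>J. v j * (y j)\<^sup>2)" unfolding L_def by (rule bessel)
    finally have "(2 * t * c)\<^sup>2 * S \<le> (\<Sum>j\<in>J. v j * (y j)\<^sup>2)" .
    moreover have "(\<Prod>m\<in>UNIV. exp (- (2 * (c * t)\<^sup>2 * (N m)\<^sup>2))) = exp (- ((2 * t * c)\<^sup>2 * S) / 2)"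
      by (simp add: exp_sum[symmetric] S_def sum_distrib_left sum_negf power_mult_distrib mult_ac sum_divide_distrib)
    ultimately show "exp (- (\<Sum>j\<in>J. v j * (\<Sum>m\<in>UNIV. N m * g m j)\<^sup>2) / 2) \<le> (\<Prod>m\<in>UNIV. exp (- (2 * (c * t)\<^sup>2 * (N m)\<^sup>2)))"
      by (simp add: y_def)
  qed
  also have "\<dots> = (\<Prod>m\<in>(UNIV :: 'm set). \<integral>x. exp (- (2 * (c * t)\<^sup>2 * x\<^sup>2)) \<partial>std_normal_distribution)"
    unfolding P_def
    by (rule PN.product_integral_prod) (auto intro!: N.integrable_const_bound[where B=1])
  also have "\<dots> = (1 / sqrt (1 + (2 * c * t)\<^sup>2)) ^ CARD('m)"
    by (subst integral_exp_square_std_normal) (auto simp: power_mult_distrib mult.assoc)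
  finally show ?thesis .
qed

end

section \<open>Densities from integrable characteristic functions\<close>

context real_distribution
begin

text \<open>For an integrable characteristic function the improper integral in Levy's inversion formula is
  an absolutely convergent one, by dominated convergence.\<close>

lemma measure_Ioc_char_integrable:
  assumes int: "integrable lborel (char M)" and "a \<le> b" "measure M {a} = 0" "measure M {b} = 0"
  shows "complex_of_real (measure M {a<..b})
    = 1 / (2 * pi) * (\<integral>t. (iexp (-(t * a)) - iexp (-(t * b))) / (\<i> * t) * char M t \<partial>lborel)"
proof -
  let ?F = "\<lambda>t :: real. (iexp (-(t * a)) - iexp (-(t * b))) / (\<i> * t) * char M t"
  have bound: "cmod (?F t) \<le> (b - a) * cmod (char M t)" for t
  proof (cases "t = 0")
    case False
    have "cmod ((iexp (t * - a) - iexp (t * - b)) / (\<i> * t)) \<le> - a - - b"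
      by (rule Levy_Inversion_aux2) (use \<open>a \<le> b\<close> False in auto)
    then show ?thesis unfolding norm_mult by (intro mult_right_mono) auto
  qed (use \<open>a \<le> b\<close> in simp)
  have "(\<lambda>T::nat. \<integral>t. indicator {- real T<..<real T} t *\<^sub>R ?F t \<partial>lborel) \<longlonglongrightarrow> (\<integral>t. ?F t \<partial>lborel)"
  proof (rule integral_dominated_convergence[where w="\<lambda>t. (b - a) * cmod (char M t)"])
    show "AE t in lborel. (\<lambda>T::nat. indicator {- real T<..<real T} t *\<^sub>R ?F t) \<longlonglongrightarrow> ?F t"
    proof (rule AE_I2)
      fix t :: real
      have "\<forall>\<^sub>F T in sequentially. indicator {- real T<..<real T} t *\<^sub>R ?F t = ?F t"
        using eventually_gt_at_top[of "nat \<lceil>\<bar>t\<bar>\<rceil>"]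
        by eventually_elim (auto simp: indicator_def, linarith+)
      then show "(\<lambda>T::nat. indicator {- real T<..<real T} t *\<^sub>R ?F t) \<longlonglongrightarrow> ?F t"
        by (rule tendsto_eventually)
    qed
    show "AE t in lborel. norm (indicator {- real T<..<real T} t *\<^sub>R ?F t) \<le> (b - a) * cmod (char M t)" for T :: nat
      using bound \<open>a \<le> b\<close> by (intro AE_I2) (auto simp: indicator_def)
  qed (use int in auto)
  moreover have "(\<integral>t. indicator {- real T<..<real T} t *\<^sub>R ?F t \<partial>lborel) = (CLBINT t=-real T..real T. ?F t)" for T :: nat
    by (simp add: interval_lebesgue_integral_def set_lebesgue_integral_def)
  ultimately have A: "(\<lambda>T::nat. 1 / (2 * pi) * (CLBINT t=-real T..real T. ?F t)) \<longlonglongrightarrow> 1 / (2 * pi) * (\<integral>t. ?F t \<partial>lborel)"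
    by (intro tendsto_intros) simp
  have B: "(\<lambda>T::nat. 1 / (2 * pi) * (CLBINT t=-real T..real T. ?F t)) \<longlonglongrightarrow> complex_of_real (measure M {a<..b})"
    using Levy_Inversion[OF assms(2-4)] by simp
  show ?thesis by (rule LIMSEQ_unique[OF B A])
qed

text \<open>The integrand of the inversion formula is at most \<open>(b - a) \<bar>\<phi>(t)\<bar>\<close>, so intervals have measure of the
  order of their length. This excludes atoms, after which the formula holds for all endpoints and
  can be differentiated under the integral.\<close>

theorem density_if_char_integrable:
  assumes int: "integrable lborel (char M)"
  shows "\<exists>p. (\<forall>z. 0 \<le> p z) \<and> p \<in> borel_measurable borel \<and> M = density lborel (\<lambda>z. ennreal (p z)) \<and>
    (\<forall>z. (cdf M has_real_derivative p z) (at z)) \<and> bdd_above (range p)"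
proof -
  define I where "I = (\<integral>t. cmod (char M t) \<partial>lborel)"
  have I0: "0 \<le> I" by (simp add: I_def)
  define F where "F = (\<lambda>a b t :: real. (iexp (-(t * a)) - iexp (-(t * b))) / (\<i> * t))"
  have [measurable]: "F a b \<in> borel_measurable borel" for a b unfolding F_def by measurable
  define G where "G = (\<lambda>a b. (\<integral>t. F a b t * char M t \<partial>lborel))"
  have Fb: "cmod (F a b t) \<le> \<bar>b - a\<bar>" for a b t
  proof (cases "t = 0")
    case False
    show ?thesis
    proof (cases "a \<le> b")
      case True
      have "cmod ((iexp (t * - a) - iexp (t * - b)) / (\<i> * t)) \<le> - a - - b"
        by (rule Levy_Inversion_aux2) (use True False in auto)
      with True show ?thesis by (simp add: F_def)
    next
      case l: False
      have "cmod ((iexp (t * - b) - iexp (t * - a)) / (\<i> * t)) \<le> - b - - a"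
        by (rule Levy_Inversion_aux2) (use l False in auto)
      with l show ?thesis by (simp add: F_def norm_divide norm_minus_commute)
    qed
  qed (simp add: F_def)
  have Gb: "cmod (G a b) \<le> \<bar>b - a\<bar> * I" for a b
  proof -
    have "cmod (G a b) \<le> (\<integral>t. \<bar>b - a\<bar> * cmod (char M t) \<partial>lborel)"
    proof -
      have "integrable lborel (\<lambda>t. F a b t * char M t)"
        by (rule Bochner_Integration.integrable_bound[where f="\<lambda>t. \<bar>b - a\<bar> * cmod (char M t)"])
           (use int Fb in \<open>auto simp: norm_mult intro!: mult_right_mono\<close>)
      then have "(\<integral>t. cmod (F a b t * char M t) \<partial>lborel) \<le> (\<integral>t. \<bar>b - a\<bar> * cmod (char M t) \<partial>lborel)"
      proof (rule integral_mono[OF integrable_norm])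
        show "cmod (F a b t * char M t) \<le> \<bar>b - a\<bar> * cmod (char M t)" for t
          unfolding norm_mult by (intro mult_right_mono Fb) simp
      qed (use int in auto)
      then show ?thesis unfolding G_def by (rule order_trans[OF integral_norm_bound])
    qed
    then show ?thesis by (simp add: I_def)
  qed
  have meas: "complex_of_real (measure M {a<..b}) = 1 / (2 * pi) * G a b"
    if "a \<le> b" "measure M {a} = 0" "measure M {b} = 0" for a b
    using measure_Ioc_char_integrable[OF int that] by (simp add: F_def G_def)
  have atom: "measure M {z} = 0" for z
  proof (rule ccontr)
    assume ne: "measure M {z} \<noteq> 0"
    \<comment> \<open>Half-length of an interval around \<open>z\<close> whose measure would be less than that of the point \<open>z\<close>.\<close>
    define e where "e = pi * measure M {z} / (2 * (I + 1))"
    have m: "measure M {z} > 0" using ne by (simp add: zero_less_measure_iff)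
    then have e: "e > 0" using I0 by (simp add: e_def)
    have cnt: "countable {x. measure M {x} \<noteq> 0}" by (rule countable_support)
    obtain a where a: "z - e < a" "a < z" "measure M {a} = 0"
      using open_minus_countable[OF cnt, of "{z - e<..<z}"] e by auto
    obtain b where b: "z < b" "b < z + e" "measure M {b} = 0"
      using open_minus_countable[OF cnt, of "{z<..<z + e}"] e by auto
    have "measure M {z} \<le> measure M {a<..b}"
      using a b by (intro finite_measure_mono) auto
    also have "\<dots> = cmod (1 / (2 * pi) * G a b)"
      using meas[of a b] a b by (metis abs_of_nonneg less_imp_le measure_nonneg norm_of_real order.trans)
    also have "\<dots> \<le> 1 / (2 * pi) * ((2 * e) * I)"
    proof -
      have "cmod (G a b) \<le> \<bar>b - a\<bar> * I" by (rule Gb)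
      also have "\<dots> \<le> (2 * e) * I" using a b I0 by (intro mult_right_mono) auto
      finally have "cmod (G a b) / (2 * pi) \<le> ((2 * e) * I) / (2 * pi)" by (rule divide_right_mono) simp
      then show ?thesis by (simp add: norm_mult norm_divide)
    qed
    also have "\<dots> = measure M {z} / 2 * (I / (I + 1))" using I0 by (simp add: e_def field_simps)
    also have "\<dots> \<le> measure M {z} / 2 * 1" using I0 by (intro mult_left_mono) auto
    also have "\<dots> < measure M {z}" using m by simp
    finally show False by simp
  qed
  have cdf_diff: "complex_of_real (cdf M b - cdf M a) = 1 / (2 * pi) * G a b" for a b
  proof -
    have G_swap: "G a b = - G b a" unfolding G_def F_def Bochner_Integration.integral_minus[symmetric]
      by (intro Bochner_Integration.integral_cong refl) (simp add: divide_simps algebra_simps)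
    consider "a < b" | "a = b" | "b < a" by linarith
    then show ?thesis
    proof cases
      case 1
      then show ?thesis using meas[of a b] atom by (simp add: cdf_diff_eq)
    next
      case 2
      then show ?thesis using G_swap by (simp add: G_def F_def)
    next
      case 3
      then show ?thesis using meas[of b a] atom cdf_diff_eq[OF 3]
        by (simp add: G_swap of_real_diff[symmetric] del: of_real_diff) (simp add: algebra_simps)
    qed
  qed
  define p where "p = (\<lambda>z. Re (1 / (2 * pi) * (\<integral>t. iexp (-(t * z)) * char M t \<partial>lborel)))"
  have pm[measurable]: "p \<in> borel_measurable borel"
    unfolding p_def by measurable
  have pb: "p z \<le> I / (2 * pi)" for z
  proof -
    have "p z \<le> cmod (1 / (2 * pi) * (\<integral>t. iexp (-(t * z)) * char M t \<partial>lborel))"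
      unfolding p_def by (rule complex_Re_le_cmod)
    also have "\<dots> = cmod (\<integral>t. iexp (-(t * z)) * char M t \<partial>lborel) / (2 * pi)"
      by (simp add: norm_mult norm_divide)
    also have "\<dots> \<le> (\<integral>t. cmod (iexp (-(t * z)) * char M t) \<partial>lborel) / (2 * pi)"
      by (intro divide_right_mono integral_norm_bound) auto
    also have "\<dots> = I / (2 * pi)" by (simp add: norm_mult I_def)
    finally show ?thesis .
  qed
  have deriv: "(cdf M has_real_derivative p z) (at z)" for z
    unfolding DERIV_def tendsto_at_iff_sequentially
  proof (intro allI impI)
    fix h :: "nat \<Rightarrow> real" assume h: "\<forall>i. h i \<in> UNIV - {0}" "h \<longlonglongrightarrow> 0"
    have h0: "h i \<noteq> 0" for i using h(1) by auto
    have "(\<lambda>i. \<integral>t. F z (z + h i) t / h i * char M t \<partial>lborel) \<longlonglongrightarrow> (\<integral>t. iexp (-(t * z)) * char M t \<partial>lborel)"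
    proof (rule integral_dominated_convergence[where w="\<lambda>t. cmod (char M t)"])
      have "(\<lambda>i. F z (z + h i) t / h i * char M t) \<longlonglongrightarrow> iexp (-(t * z)) * char M t" if "t \<noteq> 0" for t
      proof -
        let ?g = "\<lambda>w. exp (- (\<i> * t * w))"
        have "(?g has_field_derivative (- (\<i> * t) * ?g z)) (at (complex_of_real z))"
          by (auto intro!: derivative_eq_intros)
        then have "((\<lambda>w::complex. (?g (complex_of_real z + w) - ?g z) / w) \<longlongrightarrow> - (\<i> * t) * ?g z) (at 0)"
          by (rule DERIV_D)
        moreover have "filterlim (\<lambda>i. complex_of_real (h i)) (at 0) sequentially"
          using h(2) h0 by (auto simp: filterlim_at intro!: tendsto_eq_intros)
        ultimately have "(\<lambda>i. (?g (complex_of_real z + complex_of_real (h i)) - ?g z) / h i) \<longlonglongrightarrow> - (\<i> * t) * ?g z"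
          using filterlim_compose by fast
        then have "(\<lambda>i. (?g (complex_of_real z + complex_of_real (h i)) - ?g z) / h i / (- (\<i> * t)) * char M t) \<longlonglongrightarrow> (- (\<i> * t) * ?g z) / (- (\<i> * t)) * char M t"
          using that by (intro tendsto_intros) auto
        moreover have "(?g (complex_of_real z + complex_of_real (h i)) - ?g z) / h i / (- (\<i> * t)) * char M t = F z (z + h i) t / h i * char M t" for i
          using that h0[of i] by (simp add: F_def field_simps)
        moreover have "(- (\<i> * t) * ?g z) / (- (\<i> * t)) * char M t = iexp (-(t * z)) * char M t"
          using that by (simp add: mult_ac)
        ultimately show ?thesis by (simp only:)
      qed
      then show "AE t in lborel. (\<lambda>i. F z (z + h i) t / h i * char M t) \<longlonglongrightarrow> iexp (-(t * z)) * char M t"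
        by (intro AE_I[where N="{0}"]) auto
      show "AE t in lborel. cmod (F z (z + h i) t / h i * char M t) \<le> cmod (char M t)" for i
        using mult_right_mono[OF Fb[of z "z + h i"] norm_ge_zero[of "char M _"]] h0[of i]
        by (intro AE_I2) (auto simp: norm_mult norm_divide divide_le_eq mult_ac)
    qed (use int in auto)
    then have "(\<lambda>i. Re (1 / (2 * pi) * (\<integral>t. F z (z + h i) t / h i * char M t \<partial>lborel))) \<longlonglongrightarrow> p z"
      unfolding p_def by (intro tendsto_intros)
    moreover have "Re (1 / (2 * pi) * (\<integral>t. F z (z + h i) t / h i * char M t \<partial>lborel)) = (cdf M (z + h i) - cdf M z) / h i" for i
    proof -
      have "(\<integral>t. F z (z + h i) t / h i * char M t \<partial>lborel) = G z (z + h i) / h i"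
        unfolding G_def integral_divide_zero[symmetric] by (intro Bochner_Integration.integral_cong refl) simp
      then have "1 / (2 * pi) * (\<integral>t. F z (z + h i) t / h i * char M t \<partial>lborel) = complex_of_real ((cdf M (z + h i) - cdf M z) / h i)"
        using cdf_diff[of "z + h i" z] by simp
      then show ?thesis by (metis Re_complex_of_real)
    qed
    ultimately show "((\<lambda>h. (cdf M (z + h) - cdf M z) / h) \<circ> h) \<longlonglongrightarrow> p z"
      by (simp add: comp_def)
  qed
  have p0: "0 \<le> p z" for z
  proof -
    have "((\<lambda>h. (cdf M (z + h) - cdf M z) / h) \<longlongrightarrow> p z) (at_right 0)"
      using deriv[of z] unfolding DERIV_def by (rule filterlim_mono[OF _ order_refl at_le]) auto
    moreover have "\<forall>\<^sub>F h in at_right 0. 0 \<le> (cdf M (z + h) - cdf M z) / h"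
      unfolding eventually_at_right_field
      by (intro exI[of _ 1]) (auto intro!: divide_nonneg_pos cdf_nondecreasing)
    ultimately show ?thesis by (rule tendsto_lowerbound) simp
  qed
  have "M = density lborel (\<lambda>z. ennreal (p z))"
  proof (rule measure_eqI_lessThan)
    fix x :: real
    show "emeasure M {x<..} < \<infinity>" by (simp add: less_top[symmetric])
    have "emeasure (density lborel (\<lambda>z. ennreal (p z))) {x<..} = (\<integral>\<^sup>+z. ennreal (p z) * indicator {x<..} z \<partial>lborel)"
      by (simp add: emeasure_density)
    also have "\<dots> = (\<integral>\<^sup>+z. ennreal (p z) * indicator {x..} z \<partial>lborel)"
      by (intro nn_integral_cong_AE AE_I[where N="{x}"]) (auto split: split_indicator)
    also have "\<dots> = ennreal (1 - cdf M x)"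
      by (rule nn_integral_FTC_atLeast) (auto simp: p0 deriv cdf_lim_at_top_prob)
    also have "1 - cdf M x = measure M {x<..}"
    proof -
      have "{x<..} = space M - {..x}" by auto
      then show ?thesis using prob_compl[of "{..x}"] by (simp add: cdf_def)
    qed
    finally show "emeasure M {x<..} = emeasure (density lborel (\<lambda>z. ennreal (p z))) {x<..}"
      by (simp add: emeasure_eq_measure)
  qed auto
  then show ?thesis
    using p0 pm deriv pb by (intro exI[of _ p]) (auto intro!: bdd_aboveI)
qed

end

section \<open>The real white noise behind the complex one\<close>

lemma gaussian_rv_square_integrable:
  assumes "prob_space M" and g: "gaussian_rv M Y"
  shows "integrable M (\<lambda>\<omega>. (Y \<omega>)\<^sup>2)" and "integrable M Y"
    and "(\<integral>\<omega>. Y \<omega> \<partial>M) = 0 \<Longrightarrow> (\<integral>\<omega>. iexp (Y \<omega>) \<partial>M) = complex_of_real (exp (- (\<integral>\<omega>. (Y \<omega>)\<^sup>2 \<partial>M) / 2))"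
proof -
  interpret prob_space M by fact
  have Y[measurable]: "Y \<in> borel_measurable M" using g by (simp add: gaussian_rv_def)
  obtain \<mu> \<sigma> where s: "\<sigma> \<ge> 0"
    and d: "distr M borel Y = (if \<sigma> = 0 then return borel \<mu> else density lborel (normal_density \<mu> \<sigma>))"
    using g by (auto simp: gaussian_rv_def)
  have "integrable M (\<lambda>\<omega>. (Y \<omega>)\<^sup>2) \<and> integrable M Y \<and>
     ((\<integral>\<omega>. Y \<omega> \<partial>M) = 0 \<longrightarrow> (\<integral>\<omega>. iexp (Y \<omega>) \<partial>M) = complex_of_real (exp (- (\<integral>\<omega>. (Y \<omega>)\<^sup>2 \<partial>M) / 2)))"
  proof (cases "\<sigma> = 0")
    case True
    then have d0: "distr M borel Y = return borel \<mu>" using d by simp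
    have i1: "integrable M (\<lambda>\<omega>. f (Y \<omega>))" if [measurable]: "f \<in> borel_measurable borel" for f :: "real \<Rightarrow> real"
      using integrable_distr_eq[OF Y, of f] d0 by (simp add: integrable_iff_bounded nn_integral_return)
    have e: "(\<integral>\<omega>. f (Y \<omega>) \<partial>M) = f \<mu>" if [measurable]: "f \<in> borel_measurable borel"
      for f :: "real \<Rightarrow> 'b :: {banach, second_countable_topology}"
      using integral_distr[OF Y, of f] d0 by (simp add: integral_return)
    have "(\<integral>\<omega>. Y \<omega> \<partial>M) = \<mu>" using e[of "\<lambda>x. x"] by simp
    moreover have "(\<integral>\<omega>. (Y \<omega>)\<^sup>2 \<partial>M) = \<mu>\<^sup>2" using e[of "\<lambda>x. x\<^sup>2"] by simp
    moreover have "(\<integral>\<omega>. iexp (Y \<omega>) \<partial>M) = iexp \<mu>" using e[of "\<lambda>x. iexp x"] by simp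
    ultimately show ?thesis using i1[of "\<lambda>x. x"] i1[of "\<lambda>x. x\<^sup>2"] by auto
  next
    case False
    then have sp: "\<sigma> > 0" using s by simp
    have D: "distributed M lborel Y (normal_density \<mu> \<sigma>)"
      using d False by (simp add: distributed_def cong: distr_cong)
    have i2: "integrable M (\<lambda>\<omega>. (Y \<omega> - \<mu>)\<^sup>2)"
      using integrable_normal_moment[OF sp, of \<mu> 2] distributed_integrable[OF D, of "\<lambda>x. (x - \<mu>)\<^sup>2"] by simp
    have i1: "integrable M Y"
      using integrable_normal_moment_nz_1[OF sp, of \<mu>] distributed_integrable[OF D, of "\<lambda>x. x"] by simp
    have "integrable M (\<lambda>\<omega>. (Y \<omega> - \<mu>)\<^sup>2 + 2 * \<mu> * Y \<omega> - \<mu>\<^sup>2)"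
      using i1 i2 by auto
    then have i2': "integrable M (\<lambda>\<omega>. (Y \<omega>)\<^sup>2)"
      by (simp add: power2_diff algebra_simps)
    have "(\<integral>\<omega>. iexp (Y \<omega>) \<partial>M) = complex_of_real (exp (- (\<integral>\<omega>. (Y \<omega>)\<^sup>2 \<partial>M) / 2))" if "(\<integral>\<omega>. Y \<omega> \<partial>M) = 0"
    proof -
      have mu: "\<mu> = 0" using normal_distributed_expectation[OF sp D] that by simp
      have var: "(\<integral>\<omega>. (Y \<omega>)\<^sup>2 \<partial>M) = \<sigma>\<^sup>2"
        using normal_distributed_variance[OF sp D] that by simp
      have Z: "distributed M lborel (\<lambda>\<omega>. Y \<omega> / \<sigma>) std_normal_density"
        using normal_standard_normal_convert[OF sp, of Y \<mu>] D mu by simp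
      have "(\<integral>\<omega>. iexp (Y \<omega>) \<partial>M) = (\<integral>\<omega>. iexp (\<sigma> * (Y \<omega> / \<sigma>)) \<partial>M)" using sp by simp
      also have "\<dots> = (\<integral>x. iexp (\<sigma> * x) \<partial>distr M lborel (\<lambda>\<omega>. Y \<omega> / \<sigma>))"
        by (subst integral_distr) auto
      also have "\<dots> = (\<integral>x. iexp (\<sigma> * x) \<partial>std_normal_distribution)"
        using distributed_distr_eq_density[OF Z] by simp
      also have "\<dots> = complex_of_real (exp (- \<sigma>\<^sup>2 / 2))" by (rule iexp_std_normal)
      finally show ?thesis by (simp add: var)
    qed
    then show ?thesis using i1 i2' by blast
  qed
  then show "integrable M (\<lambda>\<omega>. (Y \<omega>)\<^sup>2)" and "integrable M Y"
    and "(\<integral>\<omega>. Y \<omega> \<partial>M) = 0 \<Longrightarrow> (\<integral>\<omega>. iexp (Y \<omega>) \<partial>M) = complex_of_real (exp (- (\<integral>\<omega>. (Y \<omega>)\<^sup>2 \<partial>M) / 2))"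
    by auto
qed

lemma integrable_mult_square_integrable:
  fixes f g :: "'a \<Rightarrow> real"
  assumes [measurable]: "f \<in> borel_measurable M" "g \<in> borel_measurable M"
    and "integrable M (\<lambda>x. (f x)\<^sup>2)" "integrable M (\<lambda>x. (g x)\<^sup>2)"
  shows "integrable M (\<lambda>x. f x * g x)"
proof (rule Bochner_Integration.integrable_bound)
  show "integrable M (\<lambda>x. (f x)\<^sup>2 + (g x)\<^sup>2)" using assms by auto
  have "\<bar>a * b\<bar> \<le> a\<^sup>2 + b\<^sup>2" for a b :: real
  proof -
    have "2 * \<bar>a * b\<bar> \<le> a\<^sup>2 + b\<^sup>2"
      using sum_squares_bound[of "\<bar>a\<bar>" "\<bar>b\<bar>"] by (simp add: abs_mult mult.assoc)
    then show ?thesis using abs_ge_zero[of "a * b"] by linarith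
  qed
  then show "AE x in M. norm (f x * g x) \<le> norm ((f x)\<^sup>2 + (g x)\<^sup>2)" by simp
qed measurable

lemma complex_integrable_Re_Im:
  assumes "integrable M (\<lambda>x. Re (f x))" "integrable M (\<lambda>x. Im (f x))"
  shows "integrable M f"
proof -
  have "integrable M (\<lambda>x. complex_of_real (Re (f x)) + \<i> * complex_of_real (Im (f x)))"
    using assms by (intro Bochner_Integration.integrable_add integrable_mult_right integrable_of_real)
  then show ?thesis by (simp flip: complex_eq)
qed

text \<open>As for the Hartley transform, adding real and imaginary parts encodes a random measure with
  \<open>W(-A) = cnj (W A)\<close> in real variables that are uncorrelated for disjoint sets; \<open>Re W\<close> and \<open>Im W\<close>
  taken separately are not, because they repeat themselves on \<open>-A\<close>.\<close>

definition real_noise :: "('s \<Rightarrow> 'w \<Rightarrow> complex) \<Rightarrow> 's \<Rightarrow> 'w \<Rightarrow> real" where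
  "real_noise W A \<omega> = Re (W A \<omega>) + Im (W A \<omega>)"

text \<open>The covariances are \<open>E R(A) R(B) = Re E[W(A) cnj (W(B))] + Im E[W(A) W(B)]\<close>. The first term is the
  volume of \<open>A \<inter> B\<close>, and \<open>E[W(A) W(B)] = E[W(A) cnj (W(-B))]\<close> is real.\<close>

lemma real_noise_char:
  assumes wn: "complex_white_noise M W" and D: "regular_system D"
  shows "A \<in> D \<Longrightarrow> real_noise W A \<in> borel_measurable M"
    and "(\<integral>\<omega>. iexp (\<Sum>A\<in>D. s A * real_noise W A \<omega>) \<partial>M)
       = complex_of_real (exp (- (\<Sum>A\<in>D. measure lborel A * (s A)\<^sup>2) / 2))"
proof -
  interpret prob_space M using wn by (simp add: complex_white_noise_def)
  have fin: "finite D" and Dfm: "D \<subseteq> finite_measure_sets"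
    and disj: "\<And>A B. A \<in> D \<Longrightarrow> B \<in> D \<Longrightarrow> A \<noteq> B \<Longrightarrow> A \<inter> B = {}"
    and um: "\<And>A. A \<in> D \<Longrightarrow> uminus ` A \<in> D" "\<And>A. A \<in> D \<Longrightarrow> uminus ` A \<noteq> A"
    using D unfolding regular_system_def by blast+
  note w = wn[unfolded complex_white_noise_def, THEN conjunct2]
  note Wmeas = w[THEN conjunct1] and Wgauss = w[THEN conjunct2, THEN conjunct1]
    and Wmean = w[THEN conjunct2, THEN conjunct2, THEN conjunct1]
    and Wcov = w[THEN conjunct2, THEN conjunct2, THEN conjunct2, THEN conjunct1]
    and Wrefl = w[THEN conjunct2, THEN conjunct2, THEN conjunct2, THEN conjunct2, THEN conjunct2]
  have Wm[measurable]: "W A \<in> borel_measurable M" if "A \<in> D" for A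
    using Wmeas that Dfm by blast
  show Rm[measurable]: "real_noise W A \<in> borel_measurable M" if "A \<in> D" for A
    using Wm[OF that] unfolding real_noise_def by measurable
  have gauss: "gaussian_rv M (\<lambda>\<omega>. Re (\<Sum>A\<in>S. c A * W A \<omega>))" if "S \<subseteq> D" for S c
    using Wgauss finite_subset[OF that fin] that Dfm by blast
  have re: "integrable M (\<lambda>\<omega>. (Re (W A \<omega>))\<^sup>2)" "integrable M (\<lambda>\<omega>. Re (W A \<omega>))" if "A \<in> D" for A
    using gaussian_rv_square_integrable[OF prob_space_axioms gauss[of "{A}" "\<lambda>_. 1"]] that by simp_all
  have im: "integrable M (\<lambda>\<omega>. (Im (W A \<omega>))\<^sup>2)" "integrable M (\<lambda>\<omega>. Im (W A \<omega>))" if "A \<in> D" for A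
    using gaussian_rv_square_integrable[OF prob_space_axioms gauss[of "{A}" "\<lambda>_. - \<i>"]] that by simp_all
  have ReM: "(\<lambda>\<omega>. Re (W A \<omega>)) \<in> borel_measurable M" and ImM: "(\<lambda>\<omega>. Im (W A \<omega>)) \<in> borel_measurable M"
    if "A \<in> D" for A
    using Wm[OF that] by measurable
  have prods: "integrable M (\<lambda>\<omega>. Re (W A \<omega>) * Re (W B \<omega>))" "integrable M (\<lambda>\<omega>. Im (W A \<omega>) * Im (W B \<omega>))"
     "integrable M (\<lambda>\<omega>. Re (W A \<omega>) * Im (W B \<omega>))" "integrable M (\<lambda>\<omega>. Im (W A \<omega>) * Re (W B \<omega>))"
    if "A \<in> D" "B \<in> D" for A B
    by (intro integrable_mult_square_integrable ReM ImM re(1) im(1) that)+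
  have mean: "(\<integral>\<omega>. real_noise W A \<omega> \<partial>M) = 0" if A: "A \<in> D" for A
  proof -
    have W0: "(\<integral>\<omega>. W A \<omega> \<partial>M) = 0" using Wmean A Dfm by blast
    have int: "integrable M (W A)"
      using re(2)[OF A] im(2)[OF A] by (rule complex_integrable_Re_Im)
    have "(\<integral>\<omega>. Re (W A \<omega>) \<partial>M) = 0" "(\<integral>\<omega>. Im (W A \<omega>) \<partial>M) = 0"
      using int W0 by simp_all
    then show ?thesis using re(2)[OF A] im(2)[OF A] by (simp add: real_noise_def)
  qed
  have cov: "(\<integral>\<omega>. real_noise W A \<omega> * real_noise W B \<omega> \<partial>M) = measure lborel (A \<inter> B)"
    if A: "A \<in> D" and B: "B \<in> D" for A B
  proof -
    have fm: "A \<in> finite_measure_sets" "B \<in> finite_measure_sets" "uminus ` B \<in> finite_measure_sets"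
      using A B um Dfm by auto
    have E1: "(\<integral>\<omega>. W A \<omega> * cnj (W B \<omega>) \<partial>M) = complex_of_real (measure lborel (A \<inter> B))"
      using Wcov fm by blast
    have "(\<integral>\<omega>. W A \<omega> * W B \<omega> \<partial>M) = (\<integral>\<omega>. W A \<omega> * cnj (W (uminus ` B) \<omega>) \<partial>M)"
    proof (rule integral_cong_AE)
      have "AE \<omega> in M. W (uminus ` B) \<omega> = cnj (W B \<omega>)"
        using Wrefl fm by blast
      then show "AE \<omega> in M. W A \<omega> * W B \<omega> = W A \<omega> * cnj (W (uminus ` B) \<omega>)" by auto
      have "(\<lambda>\<omega>. cnj (W (uminus ` B) \<omega>)) \<in> borel_measurable M"
        by (rule measurable_compose[OF Wm[OF um(1)[OF B]]])
           (auto intro!: borel_measurable_continuous_onI continuous_intros)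
      then show "(\<lambda>\<omega>. W A \<omega> * cnj (W (uminus ` B) \<omega>)) \<in> borel_measurable M" using A by measurable
    qed (use A B in measurable)
    also have "\<dots> = complex_of_real (measure lborel (A \<inter> uminus ` B))"
      using Wcov fm by blast
    finally have E2: "(\<integral>\<omega>. W A \<omega> * W B \<omega> \<partial>M) = complex_of_real (measure lborel (A \<inter> uminus ` B))" .
    have i1: "integrable M (\<lambda>\<omega>. W A \<omega> * cnj (W B \<omega>))" and i2: "integrable M (\<lambda>\<omega>. W A \<omega> * W B \<omega>)"
      using prods[OF A B] by (auto intro!: complex_integrable_Re_Im)
    have "(\<integral>\<omega>. real_noise W A \<omega> * real_noise W B \<omega> \<partial>M)
       = (\<integral>\<omega>. Re (W A \<omega> * cnj (W B \<omega>)) + Im (W A \<omega> * W B \<omega>) \<partial>M)"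
      by (intro Bochner_Integration.integral_cong refl) (simp add: real_noise_def algebra_simps)
    also have "\<dots> = (\<integral>\<omega>. Re (W A \<omega> * cnj (W B \<omega>)) \<partial>M) + (\<integral>\<omega>. Im (W A \<omega> * W B \<omega>) \<partial>M)"
      using i1 i2 by (intro Bochner_Integration.integral_add integrable_Re integrable_Im)
    also have "\<dots> = measure lborel (A \<inter> B)"
      unfolding integral_Re[OF i1] integral_Im[OF i2] E1 E2 by simp
    finally show ?thesis .
  qed
  let ?Y = "\<lambda>\<omega>. \<Sum>A\<in>D. s A * real_noise W A \<omega>"
  have rr: "integrable M (\<lambda>\<omega>. real_noise W A \<omega> * real_noise W B \<omega>)" if "A \<in> D" "B \<in> D" for A B
  proof -
    have "integrable M (\<lambda>\<omega>. Re (W A \<omega>) * Re (W B \<omega>) + Re (W A \<omega>) * Im (W B \<omega>) + (Im (W A \<omega>) * Re (W B \<omega>) + Im (W A \<omega>) * Im (W B \<omega>)))"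
      using prods[OF that] by (intro Bochner_Integration.integrable_add)
    then show ?thesis by (simp add: real_noise_def algebra_simps)
  qed
  have r1: "integrable M (real_noise W A)" if "A \<in> D" for A
    using re(2)[OF that] im(2)[OF that] unfolding real_noise_def by auto
  have "gaussian_rv M (\<lambda>\<omega>. Re (\<Sum>A\<in>D. (of_real (s A) * (1 - \<i>)) * W A \<omega>))"
    by (rule gauss) simp
  then have gY: "gaussian_rv M ?Y"
    by (simp add: real_noise_def algebra_simps)
  have mY: "(\<integral>\<omega>. ?Y \<omega> \<partial>M) = 0"
    using r1 mean by (subst Bochner_Integration.integral_sum) auto
  have "(\<integral>\<omega>. (?Y \<omega>)\<^sup>2 \<partial>M) = (\<integral>\<omega>. (\<Sum>A\<in>D. \<Sum>B\<in>D. s A * s B * (real_noise W A \<omega> * real_noise W B \<omega>)) \<partial>M)"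
    by (simp add: power2_eq_square sum_product mult_ac)
  also have "\<dots> = (\<Sum>A\<in>D. \<Sum>B\<in>D. s A * s B * measure lborel (A \<inter> B))"
  proof -
    have i: "integrable M (\<lambda>\<omega>. s A * s B * (real_noise W A \<omega> * real_noise W B \<omega>))" if "A \<in> D" "B \<in> D" for A B
      by (intro integrable_mult_right rr that)
    have "(\<integral>\<omega>. (\<Sum>A\<in>D. \<Sum>B\<in>D. s A * s B * (real_noise W A \<omega> * real_noise W B \<omega>)) \<partial>M)
        = (\<Sum>A\<in>D. \<integral>\<omega>. (\<Sum>B\<in>D. s A * s B * (real_noise W A \<omega> * real_noise W B \<omega>)) \<partial>M)"
      by (intro Bochner_Integration.integral_sum Bochner_Integration.integrable_sum i)
    also have "\<dots> = (\<Sum>A\<in>D. \<Sum>B\<in>D. \<integral>\<omega>. s A * s B * (real_noise W A \<omega> * real_noise W B \<omega>) \<partial>M)"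
      by (intro sum.cong refl Bochner_Integration.integral_sum i)
    also have "\<dots> = (\<Sum>A\<in>D. \<Sum>B\<in>D. s A * s B * measure lborel (A \<inter> B))"
      by (intro sum.cong refl) (simp add: cov)
    finally show ?thesis .
  qed
  also have "\<dots> = (\<Sum>A\<in>D. measure lborel A * (s A)\<^sup>2)"
  proof (intro sum.cong refl)
    fix A assume A: "A \<in> D"
    have "(\<Sum>B\<in>D. s A * s B * measure lborel (A \<inter> B)) = (\<Sum>B\<in>D. if B = A then measure lborel A * (s A)\<^sup>2 else 0)"
      using disj[OF A] by (intro sum.cong refl) (auto simp: power2_eq_square)
    then show "(\<Sum>B\<in>D. s A * s B * measure lborel (A \<inter> B)) = measure lborel A * (s A)\<^sup>2"
      using A fin by simp
  qed
  finally have var: "(\<integral>\<omega>. (?Y \<omega>)\<^sup>2 \<partial>M) = (\<Sum>A\<in>D. measure lborel A * (s A)\<^sup>2)" .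
  show "(\<integral>\<omega>. iexp (\<Sum>A\<in>D. s A * real_noise W A \<omega>) \<partial>M)
       = complex_of_real (exp (- (\<Sum>A\<in>D. measure lborel A * (s A)\<^sup>2) / 2))"
    using gaussian_rv_square_integrable(3)[OF prob_space_axioms gY mY] unfolding var .
qed

text \<open>The coefficients of a simple double integral with respect to \<open>real_noise\<close>.\<close>

definition real_coeff :: "((real ^ 'd) set \<Rightarrow> (real ^ 'd) set \<Rightarrow> complex) \<Rightarrow> (real ^ 'd) set \<Rightarrow> (real ^ 'd) set \<Rightarrow> real" where
  "real_coeff a A B = Re (a (uminus ` A) B) - Im (a A B)"

lemma uminus_image_involution: "uminus ` uminus ` (A :: 'a :: group_add set) = A"
  by (auto simp: image_image)

lemma sum_uminus_reindex:
  assumes "regular_system D"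
  shows "(\<Sum>A\<in>D. f (uminus ` A)) = (\<Sum>A\<in>D. f A)"
  by (rule sum.reindex_bij_witness[where i="image uminus" and j="image uminus"])
     (use assms in \<open>auto simp: regular_system_def image_image\<close>)

text \<open>Substitute \<open>W A = \<kappa> * R A + cnj \<kappa> * R (-A)\<close> with \<open>\<kappa> = (1 + \<i>) / 2\<close>, reindex the sums by \<open>A \<mapsto> -A\<close>, and use
  that the coefficients are Hermitian.\<close>

lemma simple_double_integral_real_noise:
  assumes wn: "complex_white_noise M W" and sc: "simple_coeffs D a"
  shows "AE \<omega> in M. simple_double_integral W D a \<omega>
    = complex_of_real (\<Sum>A\<in>D. \<Sum>B\<in>D. real_coeff a A B * real_noise W A \<omega> * real_noise W B \<omega>)"
proof -
  have reg: "regular_system D" using sc by (simp add: simple_coeffs_def)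
  have fin: "finite D" and Dfm: "D \<subseteq> finite_measure_sets" and um: "\<And>A. A \<in> D \<Longrightarrow> uminus ` A \<in> D"
    using reg unfolding regular_system_def by blast+
  have herm: "a (uminus ` A) (uminus ` B) = cnj (a A B)" if "A \<in> D" "B \<in> D" for A B
    using sc that unfolding simple_coeffs_def by blast
  note Wrefl = wn[unfolded complex_white_noise_def, THEN conjunct2, THEN conjunct2, THEN conjunct2,
      THEN conjunct2, THEN conjunct2, THEN conjunct2]
  have "AE \<omega> in M. \<forall>A\<in>D. W (uminus ` A) \<omega> = cnj (W A \<omega>)"
    by (rule AE_finite_allI[OF fin]) (use Wrefl Dfm in blast)
  then show ?thesis
  proof eventually_elim
    fix \<omega> assume c: "\<forall>A\<in>D. W (uminus ` A) \<omega> = cnj (W A \<omega>)"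
    define r where "r = (\<lambda>A. complex_of_real (real_noise W A \<omega>))"
    let ?n = "\<lambda>A. uminus ` A"
    define \<kappa> where "\<kappa> = (1 + \<i>) / 2"
    have W: "W A \<omega> = \<kappa> * r A + cnj \<kappa> * r (?n A)" if "A \<in> D" for A
      using c that by (simp add: \<kappa>_def r_def real_noise_def complex_eq_iff field_simps)
    have k: "\<kappa> * \<kappa> = \<i> / 2" "\<kappa> * cnj \<kappa> = 1 / 2" "cnj \<kappa> * cnj \<kappa> = - \<i> / 2"
      by (simp_all add: \<kappa>_def complex_eq_iff)
    let ?S = "\<lambda>f. \<Sum>A\<in>D. \<Sum>B\<in>D. f A B"
    have "simple_double_integral W D a \<omega> = ?S (\<lambda>A B. a A B * (\<kappa> * r A + cnj \<kappa> * r (?n A)) * (\<kappa> * r B + cnj \<kappa> * r (?n B)))"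
      unfolding simple_double_integral_def by (intro sum.cong refl) (simp add: W)
    also have "\<dots> = ?S (\<lambda>A B. a A B * (\<kappa> * \<kappa>) * r A * r B + a A B * (\<kappa> * cnj \<kappa>) * r (?n A) * r B
        + a A B * (\<kappa> * cnj \<kappa>) * r A * r (?n B) + a A B * (cnj \<kappa> * cnj \<kappa>) * r (?n A) * r (?n B))"
      by (intro sum.cong refl) (simp add: algebra_simps)
    also have "\<dots> = ?S (\<lambda>A B. a A B * (\<i> / 2) * r A * r B) + ?S (\<lambda>A B. a A B * (1 / 2) * r (?n A) * r B)
        + ?S (\<lambda>A B. a A B * (1 / 2) * r A * r (?n B)) + ?S (\<lambda>A B. a A B * (- \<i> / 2) * r (?n A) * r (?n B))"
      unfolding k by (simp only: sum.distrib)
    also have "?S (\<lambda>A B. a A B * (1 / 2) * r (?n A) * r B) = ?S (\<lambda>A B. a (?n A) B * (1 / 2) * r A * r B)"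
      by (subst sum_uminus_reindex[OF reg, symmetric]) (simp add: uminus_image_involution)
    also have "?S (\<lambda>A B. a A B * (1 / 2) * r A * r (?n B)) = ?S (\<lambda>A B. cnj (a (?n A) B) * (1 / 2) * r A * r B)"
    proof (rule sum.cong[OF refl])
      fix A assume A: "A \<in> D"
      have "(\<Sum>B\<in>D. a A B * (1 / 2) * r A * r (?n B)) = (\<Sum>B\<in>D. a A (?n B) * (1 / 2) * r A * r B)"
        by (subst sum_uminus_reindex[OF reg, symmetric]) (simp add: uminus_image_involution)
      also have "\<dots> = (\<Sum>B\<in>D. cnj (a (?n A) B) * (1 / 2) * r A * r B)"
        using herm[OF um[OF A]] by (intro sum.cong refl) (simp add: uminus_image_involution)
      finally show "(\<Sum>B\<in>D. a A B * (1 / 2) * r A * r (?n B)) = (\<Sum>B\<in>D. cnj (a (?n A) B) * (1 / 2) * r A * r B)" .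
    qed
    also have "?S (\<lambda>A B. a A B * (- \<i> / 2) * r (?n A) * r (?n B)) = ?S (\<lambda>A B. cnj (a A B) * (- \<i> / 2) * r A * r B)"
    proof -
      have "?S (\<lambda>A B. a A B * (- \<i> / 2) * r (?n A) * r (?n B)) = ?S (\<lambda>A B. a (?n A) B * (- \<i> / 2) * r A * r (?n B))"
        by (subst sum_uminus_reindex[OF reg, symmetric]) (simp add: uminus_image_involution)
      also have "\<dots> = ?S (\<lambda>A B. a (?n A) (?n B) * (- \<i> / 2) * r A * r B)"
        by (rule sum.cong[OF refl], subst sum_uminus_reindex[OF reg, symmetric]) (simp add: uminus_image_involution)
      also have "\<dots> = ?S (\<lambda>A B. cnj (a A B) * (- \<i> / 2) * r A * r B)"
        by (intro sum.cong refl) (simp add: herm)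
      finally show ?thesis .
    qed
    also have "?S (\<lambda>A B. a A B * (\<i> / 2) * r A * r B) + ?S (\<lambda>A B. a (?n A) B * (1 / 2) * r A * r B)
        + ?S (\<lambda>A B. cnj (a (?n A) B) * (1 / 2) * r A * r B) + ?S (\<lambda>A B. cnj (a A B) * (- \<i> / 2) * r A * r B)
      = ?S (\<lambda>A B. (a A B * (\<i> / 2) + a (?n A) B * (1 / 2) + cnj (a (?n A) B) * (1 / 2) + cnj (a A B) * (- \<i> / 2)) * r A * r B)"
      by (simp only: sum.distrib distrib_right)
    also have "\<dots> = ?S (\<lambda>A B. complex_of_real (real_coeff a A B) * r A * r B)"
      by (intro sum.cong refl arg_cong2[where f="(*)"]) (simp add: real_coeff_def complex_eq_iff)
    also have "\<dots> = complex_of_real (\<Sum>A\<in>D. \<Sum>B\<in>D. real_coeff a A B * real_noise W A \<omega> * real_noise W B \<omega>)"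
      by (simp add: r_def)
    finally show "simple_double_integral W D a \<omega>
       = complex_of_real (\<Sum>A\<in>D. \<Sum>B\<in>D. real_coeff a A B * real_noise W A \<omega> * real_noise W B \<omega>)" .
  qed
qed

text \<open>Bessel's inequality in \<open>L\<^sup>2\<close> for the step function with the value \<open>y A\<close> on \<open>A\<close> and the orthonormal
  family \<open>indicator (E m) / sqrt e\<close>. In this form it is a consequence of the Cauchy--Schwarz inequality on
  each \<open>E m\<close>.\<close>

lemma overlap_bessel:
  fixes E :: "'m::finite \<Rightarrow> 'a::euclidean_space set"
  assumes fin: "finite D" and D: "\<And>A. A \<in> D \<Longrightarrow> A \<in> sets borel \<and> emeasure lborel A < \<infinity>"
    and disjD: "\<And>A B. A \<in> D \<Longrightarrow> B \<in> D \<Longrightarrow> A \<noteq> B \<Longrightarrow> A \<inter> B = {}"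
    and E: "\<And>m. E m \<in> sets borel" "\<And>m. emeasure lborel (E m) < \<infinity>" "\<And>m. measure lborel (E m) = e"
    and disjE: "\<And>m m'. m \<noteq> m' \<Longrightarrow> E m \<inter> E m' = {}" and e: "e > 0"
  shows "(\<Sum>m\<in>UNIV. (\<Sum>A\<in>D. measure lborel (A \<inter> E m) / sqrt e * y A)\<^sup>2) \<le> (\<Sum>A\<in>D. measure lborel A * (y A)\<^sup>2)"
proof -
  define q where "q = (\<lambda>m A. measure lborel (A \<inter> E m))"
  have q0: "0 \<le> q m A" for m A by (simp add: q_def)
  have fmA: "A \<inter> E m \<in> fmeasurable lborel" if "A \<in> D" for A m
    using D[OF that] E(1)[of m] by (intro fmeasurable_Int_fmeasurable) (auto simp: fmeasurable_def)
  have qD: "(\<Sum>A\<in>D. q m A) \<le> e" for m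
  proof -
    have "(\<Sum>A\<in>D. q m A) = measure lborel (\<Union>A\<in>D. A \<inter> E m)"
      unfolding q_def
    proof (rule measure_finite_Union[symmetric])
      show "disjoint_family_on (\<lambda>A. A \<inter> E m) D"
        using disjD unfolding disjoint_family_on_def by blast
    qed (use fmA[of _ m] fin in \<open>auto simp: fmeasurable_def less_top\<close>)
    also have "\<dots> \<le> measure lborel (E m)"
    proof (rule measure_mono_fmeasurable)
      show "(\<Union>A\<in>D. A \<inter> E m) \<in> sets lborel"
        using fmA[of _ m] fin by (intro sets.finite_UN) (auto simp: fmeasurable_def)
    qed (use E in \<open>auto simp: fmeasurable_def\<close>)
    finally show ?thesis using E by simp
  qed
  have qE: "(\<Sum>m\<in>UNIV. q m A) \<le> measure lborel A" if A: "A \<in> D" for A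
  proof -
    have "(\<Sum>m\<in>UNIV. q m A) = measure lborel (\<Union>m\<in>UNIV. A \<inter> E m)"
      unfolding q_def
    proof (rule measure_finite_Union[symmetric])
      show "disjoint_family_on (\<lambda>m. A \<inter> E m) UNIV"
        using disjE unfolding disjoint_family_on_def by blast
    qed (use fmA[OF A] in \<open>auto simp: fmeasurable_def less_top\<close>)
    also have "\<dots> \<le> measure lborel A"
    proof (rule measure_mono_fmeasurable)
      show "(\<Union>m\<in>UNIV. A \<inter> E m) \<in> sets lborel"
        using fmA[OF A] by (intro sets.finite_UN) (auto simp: fmeasurable_def)
    qed (use D[OF A] in \<open>auto simp: fmeasurable_def\<close>)
    finally show ?thesis .
  qed
  have "(\<Sum>A\<in>D. q m A / sqrt e * y A)\<^sup>2 \<le> (\<Sum>A\<in>D. q m A * (y A)\<^sup>2)" for m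
  proof -
    have "(\<Sum>A\<in>D. q m A * y A)\<^sup>2 = (\<Sum>A\<in>D. sqrt (q m A) * (sqrt (q m A) * y A))\<^sup>2"
      using q0 by (simp add: mult.assoc[symmetric])
    also have "\<dots> \<le> (\<Sum>A\<in>D. (sqrt (q m A))\<^sup>2) * (\<Sum>A\<in>D. (sqrt (q m A) * y A)\<^sup>2)"
      by (rule Cauchy_Schwarz_ineq_sum)
    also have "\<dots> = (\<Sum>A\<in>D. q m A) * (\<Sum>A\<in>D. q m A * (y A)\<^sup>2)"
      using q0 by (simp add: power_mult_distrib)
    also have "\<dots> \<le> e * (\<Sum>A\<in>D. q m A * (y A)\<^sup>2)"
      by (intro mult_right_mono qD sum_nonneg mult_nonneg_nonneg q0) auto
    finally have "(\<Sum>A\<in>D. q m A * y A)\<^sup>2 / e \<le> (\<Sum>A\<in>D. q m A * (y A)\<^sup>2)"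
      using e by (simp add: divide_le_eq mult.commute)
    moreover have "(\<Sum>A\<in>D. q m A / sqrt e * y A) = (\<Sum>A\<in>D. q m A * y A) / sqrt e"
      by (simp add: sum_divide_distrib)
    ultimately show ?thesis using e by (simp add: power_divide)
  qed
  then have "(\<Sum>m\<in>UNIV. (\<Sum>A\<in>D. q m A / sqrt e * y A)\<^sup>2) \<le> (\<Sum>m\<in>UNIV. \<Sum>A\<in>D. q m A * (y A)\<^sup>2)"
    by (rule sum_mono)
  also have "\<dots> = (\<Sum>A\<in>D. (\<Sum>m\<in>UNIV. q m A) * (y A)\<^sup>2)"
    by (subst sum.swap) (simp add: sum_distrib_right)
  also have "\<dots> \<le> (\<Sum>A\<in>D. measure lborel A * (y A)\<^sup>2)"
    by (intro sum_mono mult_right_mono qE) auto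
  finally show ?thesis by (simp add: q_def)
qed

section \<open>Positivity of the Rosenblatt-type kernel\<close>

definition cas :: "real \<Rightarrow> real" where
  "cas s = cos s - sin s"

lemma continuous_on_cas[continuous_intros]:
  fixes f :: "'a::t2_space \<Rightarrow> real"
  shows "continuous_on S f \<Longrightarrow> continuous_on S (\<lambda>x. cas (f x))"
  unfolding cas_def by (intro continuous_intros)

lemma cas_mult: "cas a * cas b = cos (b - a) - sin (a + b)"
  by (simp add: cas_def cos_diff sin_add algebra_simps)

text \<open>The odd part of the combination is \<open>- sin s\<close> times a polynomial of degree at most three in
  \<open>cos s\<close>, and this polynomial has infinitely many zeros.\<close>

lemma cas_multiples_independent:
  assumes "\<delta> > 0"
    and zero: "\<And>s. \<bar>s\<bar> < \<delta> \<Longrightarrow> a * cas s + b * cas (2 * s) + c * cas (3 * s) + d * cas (4 * s) = 0"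
  shows "a = 0 \<and> b = 0 \<and> c = 0 \<and> d = 0"
proof -
  \<comment> \<open>Below \<open>m\<close> the sine is positive and the cosine injective.\<close>
  define m where "m = min \<delta> 1"
  have m: "0 < m" "m \<le> 1" "m \<le> \<delta>" using assms(1) by (auto simp: m_def)
  let ?p = "[:a - c, 2 * b - 4 * d, 4 * c, 8 * d:]"
  have root: "poly ?p (cos s) = 0" if s: "0 < s" "s < m" for s
  proof -
    have sp: "sin s > 0" using s m pi_gt3 by (intro sin_gt_zero) auto
    have "cas (-x) - cas x = 2 * sin x" for x by (simp add: cas_def)
    from this[of s] this[of "2 * s"] this[of "3 * s"] this[of "4 * s"]
    have 0: "a * (2 * sin s) + b * (2 * sin (2 * s)) + c * (2 * sin (3 * s)) + d * (2 * sin (4 * s)) = 0"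
      using zero[of s] zero[of "- s"] s m by (simp add: algebra_simps)
    have "sin (3 * s) = sin (2 * s + s)" by simp
    also have "\<dots> = 2 * sin s * cos s * cos s + (2 * (cos s)\<^sup>2 - 1) * sin s"
      by (simp only: sin_add sin_double cos_double_cos)
    finally have 3: "sin (3 * s) = sin s * (4 * (cos s)\<^sup>2 - 1)"
      by (simp add: power2_eq_square algebra_simps)
    have "sin (4 * s) = sin (2 * (2 * s))" by simp
    also have "\<dots> = 2 * (2 * sin s * cos s) * (2 * (cos s)\<^sup>2 - 1)"
      by (simp only: sin_double cos_double_cos)
    finally have 4: "sin (4 * s) = sin s * (8 * (cos s)\<^sup>2 * cos s - 4 * cos s)"
      by (simp add: power2_eq_square algebra_simps)
    have "2 * sin s * poly ?p (cos s) = 0"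
      using 0 unfolding 3 4 sin_double by (simp add: power2_eq_square algebra_simps)
    then show ?thesis using sp by simp
  qed
  have "inj_on cos {0<..<m}"
    using m pi_gt3 by (intro inj_onI) (auto intro!: cos_inj_pi)
  then have "infinite (cos ` {0<..<m})"
    using m by (simp add: finite_image_iff)
  moreover have "cos ` {0<..<m} \<subseteq> {x. poly ?p x = 0}" using root by auto
  ultimately have "infinite {x. poly ?p x = 0}" using finite_subset by blast
  then have "?p = 0" using poly_roots_finite by blast
  then show ?thesis by auto
qed

context
  fixes \<Delta> :: "(real ^ 'd) set"
  assumes bdd: "bounded \<Delta>" and pos: "measure lebesgue \<Delta> > 0"
begin

lemma sets_Delta: "\<Delta> \<in> sets lebesgue"
  using pos measure_notin_sets by fastforce

lemma integrable_Delta: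
  fixes f :: "real ^ 'd \<Rightarrow> 'b :: euclidean_space"
  assumes "continuous_on UNIV f"
  shows "set_integrable lebesgue \<Delta> f"
proof -
  obtain B where B: "\<Delta> \<subseteq> cball 0 B" using bdd unfolding bounded_iff by (metis mem_cball_0 subsetI)
  have "bounded (f ` cball 0 B)"
    using assms by (intro compact_imp_bounded compact_continuous_image) (auto intro: continuous_on_subset)
  then obtain C where C: "\<forall>y\<in>f ` cball 0 B. norm y \<le> C"
    unfolding bounded_iff by blast
  have [measurable]: "f \<in> borel_measurable lebesgue"
    using borel_measurable_continuous_onI[OF assms] by (simp add: measurable_completion)
  show ?thesis unfolding set_integrable_def
  proof (rule integrableI_bounded_set[where A=\<Delta> and B=C])
    show "\<Delta> \<in> sets lebesgue" by (rule sets_Delta)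
    then show "(\<lambda>x. indicator \<Delta> x *\<^sub>R f x) \<in> borel_measurable lebesgue" by measurable
    show "emeasure lebesgue \<Delta> < \<infinity>"
      using pos by (metis infinity_ennreal_def less_irrefl measure_eq_emeasure_eq_ennreal measure_zero_top top.not_eq_extremum)
  qed (use B C in auto)
qed

lemma K_Re: "Re (K \<Delta> x) = (LINT u:\<Delta>|lebesgue. cos (x \<bullet> u))"
  and K_Im: "Im (K \<Delta> x) = (LINT u:\<Delta>|lebesgue. sin (x \<bullet> u))"
proof -
  have "set_integrable lebesgue \<Delta> (\<lambda>u. exp (\<i> * complex_of_real (x \<bullet> u)))"
    by (rule integrable_Delta) (intro continuous_intros)
  then have i: "integrable lebesgue (\<lambda>u. indicator \<Delta> u *\<^sub>R exp (\<i> * complex_of_real (x \<bullet> u)))"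
    by (simp add: set_integrable_def)
  show "Re (K \<Delta> x) = (LINT u:\<Delta>|lebesgue. cos (x \<bullet> u))"
    unfolding K_def set_lebesgue_integral_def integral_Re[OF i, symmetric]
    by (intro Bochner_Integration.integral_cong refl) (simp add: Re_exp)
  show "Im (K \<Delta> x) = (LINT u:\<Delta>|lebesgue. sin (x \<bullet> u))"
    unfolding K_def set_lebesgue_integral_def integral_Im[OF i, symmetric]
    by (intro Bochner_Integration.integral_cong refl) (simp add: Im_exp)
qed

lemma K_cas: "Re (K \<Delta> (- x + y)) - Im (K \<Delta> (x + y)) = (LINT u:\<Delta>|lebesgue. cas (x \<bullet> u) * cas (y \<bullet> u))"
proof -
  have "set_integrable lebesgue \<Delta> (\<lambda>u. cos ((- x + y) \<bullet> u))" "set_integrable lebesgue \<Delta> (\<lambda>u. sin ((x + y) \<bullet> u))"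
    by (rule integrable_Delta; intro continuous_intros)+
  then have "Re (K \<Delta> (- x + y)) - Im (K \<Delta> (x + y)) = (LINT u:\<Delta>|lebesgue. cos ((- x + y) \<bullet> u) - sin ((x + y) \<bullet> u))"
    unfolding K_Re K_Im by (rule set_integral_diff(2)[symmetric])
  also have "\<dots> = (LINT u:\<Delta>|lebesgue. cas (x \<bullet> u) * cas (y \<bullet> u))"
    by (simp add: cas_mult inner_add_left inner_diff_left)
  finally show ?thesis .
qed

lemma continuous_K: "continuous_on UNIV (K \<Delta>)"
proof -
  obtain B where B: "\<And>u. u \<in> \<Delta> \<Longrightarrow> norm u \<le> B" using bdd bounded_iff by blast
  have i: "set_integrable lebesgue \<Delta> (\<lambda>u. exp (\<i> * complex_of_real (x \<bullet> u)))" for x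
    by (rule integrable_Delta) (intro continuous_intros)
  have fin: "integrable lebesgue (\<lambda>u. indicator \<Delta> u *\<^sub>R 1 :: real)"
    using integrable_Delta[of "\<lambda>_. 1 :: real"] by (simp add: set_integrable_def)
  show ?thesis unfolding continuous_on_sequentially
  proof (intro allI ballI impI)
    fix X :: "nat \<Rightarrow> real ^ 'd" and x assume X: "(\<forall>n. X n \<in> UNIV) \<and> X \<longlonglongrightarrow> x"
    show "(K \<Delta> \<circ> X) \<longlonglongrightarrow> K \<Delta> x"
      unfolding comp_def K_def set_lebesgue_integral_def
    proof (rule integral_dominated_convergence[where w="\<lambda>u. indicator \<Delta> u *\<^sub>R 1"])
      show "AE u in lebesgue. (\<lambda>n. indicator \<Delta> u *\<^sub>R exp (\<i> * complex_of_real (X n \<bullet> u))) \<longlonglongrightarrow> indicator \<Delta> u *\<^sub>R exp (\<i> * complex_of_real (x \<bullet> u))"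
        using X by (intro AE_I2 tendsto_intros) auto
      show "(\<lambda>u. indicator \<Delta> u *\<^sub>R exp (\<i> * complex_of_real (y \<bullet> u))) \<in> borel_measurable lebesgue" for y
        using i[of y] unfolding set_integrable_def by (rule borel_measurable_integrable)
    qed (use fin i in \<open>auto simp: set_integrable_def split: split_indicator\<close>)
  qed
qed

lemma rosenblatt_kernel_isCont:
  assumes "x \<noteq> 0" "y \<noteq> 0"
  shows "isCont (rosenblatt_kernel \<Delta> \<alpha>) (x, y)"
proof -
  have "isCont (K \<Delta>) (fst (x, y) + snd (x, y))"
    using continuous_K continuous_on_eq_continuous_at open_UNIV by blast
  then have "isCont (\<lambda>p. K \<Delta> (fst p + snd p)) (x, y)"
    by (rule isCont_o2[rotated]) (intro continuous_intros)
  then show ?thesis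
    unfolding rosenblatt_kernel_def split_beta'
    using assms by (intro continuous_intros) auto
qed

text \<open>The integrand is continuous, so if the integral vanished it would be zero on a ball around the origin;
  along the direction of \<open>v\<close> this contradicts the linear independence of the functions \<open>cas (j s)\<close>.\<close>

lemma cas_form_positive:
  assumes int: "0 \<in> interior \<Delta>" and v: "v \<noteq> 0" and ne: "a \<noteq> 0 \<or> b \<noteq> 0 \<or> c \<noteq> 0 \<or> d \<noteq> 0"
  shows "0 < (LINT u:\<Delta>|lebesgue. (a * cas (v \<bullet> u) + b * cas (2 * (v \<bullet> u)) + c * cas (3 * (v \<bullet> u)) + d * cas (4 * (v \<bullet> u)))\<^sup>2)"
proof -
  define F where "F = (\<lambda>u. a * cas (v \<bullet> u) + b * cas (2 * (v \<bullet> u)) + c * cas (3 * (v \<bullet> u)) + d * cas (4 * (v \<bullet> u)))"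
  have cF: "continuous_on UNIV F" unfolding F_def by (intro continuous_intros)
  obtain e where e: "e > 0" "ball 0 e \<subseteq> \<Delta>" using int by (auto simp: mem_interior)
  have "\<exists>u\<in>ball 0 e. F u \<noteq> 0"
  proof (rule ccontr)
    assume "\<not> ?thesis"
    then have F0: "F u = 0" if "norm u < e" for u using that by auto
    have "a = 0 \<and> b = 0 \<and> c = 0 \<and> d = 0"
    proof (rule cas_multiples_independent)
      show "e * norm v > 0" using e v by simp
      fix s assume s: "\<bar>s\<bar> < e * norm v"
      let ?u = "(s / (norm v)\<^sup>2) *\<^sub>R v"
      have "norm ?u = \<bar>s\<bar> / norm v" using v by (simp add: power2_eq_square)
      also have "\<dots> < e" using s v by (simp add: divide_less_eq)
      finally have F: "F ?u = 0" by (rule F0)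
      have "v \<bullet> ?u = s" using v by (simp add: power2_norm_eq_inner)
      then show "a * cas s + b * cas (2 * s) + c * cas (3 * s) + d * cas (4 * s) = 0"
        using F unfolding F_def by (simp only:)
    qed
    then show False using ne by blast
  qed
  then obtain u0 where u0: "u0 \<in> ball 0 e" "F u0 \<noteq> 0" by blast
  define G where "G = {u \<in> ball 0 e. F u \<noteq> 0}"
  have oG: "open G"
  proof -
    have "open (F -` (- {0}))" using cF by (intro open_vimage) auto
    then have "open (ball 0 e \<inter> F -` (- {0}))" by auto
    moreover have "ball 0 e \<inter> F -` (- {0}) = G" by (auto simp: G_def)
    ultimately show ?thesis by simp
  qed
  have i: "integrable lebesgue (\<lambda>u. indicator \<Delta> u *\<^sub>R (F u)\<^sup>2)"
    using integrable_Delta[of "\<lambda>u. (F u)\<^sup>2"] cF by (auto simp: set_integrable_def intro!: continuous_intros)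
  have nz: "(\<integral>u. indicator \<Delta> u *\<^sub>R (F u)\<^sup>2 \<partial>lebesgue) \<noteq> 0"
  proof
    assume "(\<integral>u. indicator \<Delta> u *\<^sub>R (F u)\<^sup>2 \<partial>lebesgue) = 0"
    then have "AE u in lebesgue. indicator \<Delta> u *\<^sub>R (F u)\<^sup>2 = 0"
      using integral_nonneg_eq_0_iff_AE[OF i] by auto
    then have "AE u in lebesgue. u \<notin> G"
      by eventually_elim (use e in \<open>auto simp: G_def split: split_indicator_asm\<close>)
    moreover have "{u \<in> space lebesgue. \<not> u \<notin> G} = G" by simp
    ultimately have "G \<in> null_sets lebesgue"
      using AE_iff_null_sets[of G lebesgue] oG by (metis borel_open sets_completionI_sets sets_lborel)
    then have "negligible G" by (simp add: negligible_iff_null_sets)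
    then show False using open_not_negligible[OF oG] u0 by (auto simp: G_def)
  qed
  have "0 \<le> (\<integral>u. indicator \<Delta> u *\<^sub>R (F u)\<^sup>2 \<partial>lebesgue)" by (rule integral_nonneg_AE) auto
  with nz have "0 < (\<integral>u. indicator \<Delta> u *\<^sub>R (F u)\<^sup>2 \<partial>lebesgue)" by (rule order_neq_le_trans[OF not_sym])
  then show ?thesis by (simp only: set_lebesgue_integral_def F_def)
qed

text \<open>The continuous counterpart of \<open>real_coeff\<close>.\<close>

definition real_kernel :: "real \<Rightarrow> real ^ 'd \<Rightarrow> real ^ 'd \<Rightarrow> real" where
  "real_kernel \<alpha> x y = Re (rosenblatt_kernel \<Delta> \<alpha> (- x, y)) - Im (rosenblatt_kernel \<Delta> \<alpha> (x, y))"

text \<open>The form is the integral over \<open>\<Delta>\<close> of the square of \<open>\<Sum>\<^sub>m N m * w m * cas (P m \<bullet> u)\<close>, which is positive for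
  \<open>N \<noteq> 0\<close>; compactness of the unit sphere makes this uniform. For the later bound on the
  characteristic function four points are convenient, since they give the decay \<open>\<bar>t\<bar>\<^sup>-\<^sup>2\<close>.\<close>

proposition real_kernel_positive_definite:
  assumes int: "0 \<in> interior \<Delta>"
  obtains P :: "4 \<Rightarrow> real ^ 'd" and c where "inj P" "\<And>m. P m \<noteq> 0" "c > 0"
    "\<And>N. c * (\<Sum>m\<in>UNIV. (N m)\<^sup>2) \<le> (\<Sum>m\<in>UNIV. \<Sum>m'\<in>UNIV. N m * N m' * real_kernel \<alpha> (P m) (P m'))"
proof -
  obtain v :: "real ^ 'd" where v: "v \<noteq> 0"
    by (metis vector_choose_size zero_neq_one norm_zero zero_le_one)
  define r :: "4 \<Rightarrow> real" where "r = (\<lambda>m. if m = 1 then 1 else if m = 2 then 2 else if m = 3 then 3 else 4)"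
  define P where "P = (\<lambda>m. r m *\<^sub>R v)"
  have r: "r 1 = 1" "r 2 = 2" "r 3 = 3" "r 4 = 4" by (simp_all add: r_def)
  have rpos: "r m > 0" for m by (simp add: r_def)
  have injr: "inj r"
  proof (rule injI)
    fix x y :: 4 assume "r x = r y"
    then show "x = y" using exhaust_4[of x] exhaust_4[of y] r by auto
  qed
  have injP: "inj P"
    using injr v by (auto simp: inj_def P_def)
  have Pnz: "P m \<noteq> 0" for m using v rpos[of m] by (simp add: P_def)
  define w where "w = (\<lambda>m. 1 / norm (P m) powr ((real CARD('d) - \<alpha>) / 2))"
  have w: "w m > 0" for m using Pnz[of m] by (simp add: w_def)
  define Q where "Q = (\<lambda>N :: real ^ 4. LINT u:\<Delta>|lebesgue. (\<Sum>m\<in>UNIV. N $ m * w m * cas (P m \<bullet> u))\<^sup>2)"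
  have k: "real_kernel \<alpha> (P m) (P m') = w m * w m' * (LINT u:\<Delta>|lebesgue. cas (P m \<bullet> u) * cas (P m' \<bullet> u))" for m m'
  proof -
    have "real_kernel \<alpha> (P m) (P m') = (w m * w m') * (Re (K \<Delta> (- P m + P m')) - Im (K \<Delta> (P m + P m')))"
      by (simp add: real_kernel_def rosenblatt_kernel_def w_def Re_divide_of_real Im_divide_of_real
          diff_divide_distrib del: of_real_mult)
    then show ?thesis unfolding K_cas .
  qed
  have QN: "(\<Sum>m\<in>UNIV. \<Sum>m'\<in>UNIV. N $ m * N $ m' * real_kernel \<alpha> (P m) (P m')) = Q N" for N
  proof -
    let ?f = "\<lambda>m m' u. (N $ m * w m) * (N $ m' * w m') * (cas (P m \<bullet> u) * cas (P m' \<bullet> u))"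
    have ii: "integrable lebesgue (\<lambda>u. indicator \<Delta> u *\<^sub>R ?f m m' u)" for m m'
    proof -
      have "continuous_on UNIV (?f m m')" by (intro continuous_intros)
      from integrable_Delta[OF this] show ?thesis by (simp only: set_integrable_def)
    qed
    have "Q N = (\<integral>u. (\<Sum>m\<in>UNIV. \<Sum>m'\<in>UNIV. indicator \<Delta> u *\<^sub>R ?f m m' u) \<partial>lebesgue)"
      unfolding Q_def set_lebesgue_integral_def
      by (intro Bochner_Integration.integral_cong refl)
         (simp add: power2_eq_square sum_product sum_distrib_left mult_ac)
    also have "\<dots> = (\<Sum>m\<in>UNIV. \<Sum>m'\<in>UNIV. (\<integral>u. indicator \<Delta> u *\<^sub>R ?f m m' u \<partial>lebesgue))"
      by (subst Bochner_Integration.integral_sum, intro Bochner_Integration.integrable_sum ii)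
         (intro sum.cong refl Bochner_Integration.integral_sum ii)
    also have "\<dots> = (\<Sum>m\<in>UNIV. \<Sum>m'\<in>UNIV. N $ m * N $ m' * real_kernel \<alpha> (P m) (P m'))"
    proof (intro sum.cong refl)
      fix m m'
      have "(\<integral>u. indicator \<Delta> u *\<^sub>R ?f m m' u \<partial>lebesgue)
        = (\<integral>u. (N $ m * w m * (N $ m' * w m')) * (indicator \<Delta> u *\<^sub>R (cas (P m \<bullet> u) * cas (P m' \<bullet> u))) \<partial>lebesgue)"
        by (intro Bochner_Integration.integral_cong refl) simp
      also have "\<dots> = N $ m * N $ m' * real_kernel \<alpha> (P m) (P m')"
        unfolding k set_lebesgue_integral_def by simp
      finally show "(\<integral>u. indicator \<Delta> u *\<^sub>R ?f m m' u \<partial>lebesgue) = N $ m * N $ m' * real_kernel \<alpha> (P m) (P m')" .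
    qed
    finally show ?thesis ..
  qed
  have Qpos: "Q N > 0" if "N \<noteq> 0" for N
  proof -
    have "N $ 1 * w 1 \<noteq> 0 \<or> N $ 2 * w 2 \<noteq> 0 \<or> N $ 3 * w 3 \<noteq> 0 \<or> N $ 4 * w 4 \<noteq> 0"
      using that w[of 1] w[of 2] w[of 3] w[of 4] by (auto simp: vec_eq_iff forall_4)
    from cas_form_positive[OF int v this] show ?thesis
      by (simp add: Q_def sum_4 P_def r)
  qed
  have cQ: "continuous_on UNIV Q"
    unfolding QN[symmetric] by (intro continuous_intros)
  obtain N0 where N0: "N0 \<in> sphere (0 :: real ^ 4) 1" "\<And>N. N \<in> sphere 0 1 \<Longrightarrow> Q N0 \<le> Q N"
    using continuous_attains_inf[of "sphere (0 :: real ^ 4) 1" Q] cQ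
    by (metis compact_sphere continuous_on_subset subset_UNIV sphere_eq_empty not_one_less_zero)
  have hom: "Q (t *\<^sub>R N) = t\<^sup>2 * Q N" for t N
    unfolding QN[symmetric] by (simp add: sum_distrib_left power2_eq_square mult_ac)
  have "Q N0 * (\<Sum>m\<in>UNIV. (N m)\<^sup>2) \<le> (\<Sum>m\<in>UNIV. \<Sum>m'\<in>UNIV. N m * N m' * real_kernel \<alpha> (P m) (P m'))" for N :: "4 \<Rightarrow> real"
  proof -
    define z where "z = (\<chi> m. N m)"
    have nz: "(\<Sum>m\<in>UNIV. (N m)\<^sup>2) = (norm z)\<^sup>2"
      unfolding power2_norm_eq_inner by (simp add: z_def inner_vec_def power2_eq_square)
    have "Q N0 * (norm z)\<^sup>2 \<le> Q z"
    proof (cases "z = 0")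
      case True
      then show ?thesis using hom[of 0 z] by simp
    next
      case False
      then have "Q N0 \<le> Q (inverse (norm z) *\<^sub>R z)" by (intro N0) simp
      then have "Q N0 * (norm z)\<^sup>2 \<le> (inverse (norm z))\<^sup>2 * Q z * (norm z)\<^sup>2"
        unfolding hom by (intro mult_right_mono) auto
      then show ?thesis using False by (simp add: field_simps)
    qed
    then show ?thesis unfolding nz QN[symmetric] by (simp add: z_def)
  qed
  moreover have "Q N0 > 0" by (rule Qpos) (use N0 in auto)
  ultimately show ?thesis using that[OF injP Pnz] by blast
qed

end

section \<open>Approximation on rectangles\<close>

lemma uminus_image_eq_vimage: "uminus ` S = uminus -` (S :: 'a::group_add set)"
  by (auto simp: image_iff) (metis add.inverse_inverse)

lemma measure_lborel_uminus_image:
  fixes S :: "'a::euclidean_space set"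
  assumes "S \<in> sets borel"
  shows "measure lborel (uminus ` S) = measure lborel S"
proof -
  have l: "(lborel :: 'a measure) = distr lborel borel uminus"
    using lborel_affine[of "-1 :: real" "0 :: 'a"] by (simp add: density_1)
  have "measure lborel (uminus ` S) = measure (distr lborel borel uminus) (uminus ` S)"
    by (subst l) simp
  also have "\<dots> = measure lborel (uminus -` (uminus ` S) \<inter> space (lborel :: 'a measure))"
  proof (rule measure_distr)
    show "uminus ` S \<in> sets borel"
      unfolding uminus_image_eq_vimage using assms by (intro measurable_sets_borel[OF borel_measurable_uminus]) auto
  qed simp
  also have "uminus -` (uminus ` S) \<inter> space (lborel :: 'a measure) = S" by auto
  finally show ?thesis .
qed

lemma measure_lborel_Times:
  fixes A B :: "'a::euclidean_space set"
  assumes "A \<in> sets borel" "B \<in> sets borel"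
  shows "measure (lborel \<Otimes>\<^sub>M lborel) (A \<times> B) = measure lborel A * measure lborel B"
  using assms by (simp add: measure_def lborel.emeasure_pair_measure_Times enn2real_mult)

lemma emeasure_lborel_Times_finite:
  fixes A B :: "'a::euclidean_space set"
  assumes "A \<in> sets borel" "B \<in> sets borel" "emeasure lborel A < \<infinity>" "emeasure lborel B < \<infinity>"
  shows "emeasure (lborel \<Otimes>\<^sub>M lborel) (A \<times> B) < \<infinity>"
  using assms by (simp add: lborel.emeasure_pair_measure_Times ennreal_mult_less_top)

text \<open>The integral over \<open>E \<times> F\<close> of the simple function with coefficients \<open>a\<close>.\<close>

definition rectangle_sum :: "(real ^ 'd) set set \<Rightarrow> ((real ^ 'd) set \<Rightarrow> (real ^ 'd) set \<Rightarrow> complex) \<Rightarrow>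
    (real ^ 'd) set \<Rightarrow> (real ^ 'd) set \<Rightarrow> complex" where
  "rectangle_sum D a E F = (\<Sum>A\<in>D. \<Sum>B\<in>D. a A B * complex_of_real (measure lborel (A \<inter> E) * measure lborel (B \<inter> F)))"

lemma simple_fun_rectangle_integral:
  fixes D :: "(real ^ 'd) set set"
  assumes fin: "finite D" and D: "D \<subseteq> finite_measure_sets"
    and E: "E \<in> finite_measure_sets" and F: "F \<in> finite_measure_sets"
  shows "integrable (lborel \<Otimes>\<^sub>M lborel) (\<lambda>p. indicator (E \<times> F) p *\<^sub>R simple_fun D a p)"
    and "(\<integral>p. indicator (E \<times> F) p *\<^sub>R simple_fun D a p \<partial>(lborel \<Otimes>\<^sub>M lborel)) = rectangle_sum D a E F"
proof -
  let ?L = "lborel \<Otimes>\<^sub>M lborel :: ((real ^ 'd) \<times> (real ^ 'd)) measure"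
  have eq: "(\<lambda>p. indicator (E \<times> F) p *\<^sub>R simple_fun D a p)
     = (\<lambda>p. \<Sum>A\<in>D. \<Sum>B\<in>D. indicator ((A \<inter> E) \<times> (B \<inter> F)) p *\<^sub>R a A B)"
  proof
    fix p :: "(real ^ 'd) \<times> (real ^ 'd)"
    obtain x y where p: "p = (x, y)" by force
    have "indicator (E \<times> F) p *\<^sub>R (a A B * indicator A x * indicator B y) = indicator ((A \<inter> E) \<times> (B \<inter> F)) p *\<^sub>R a A B" for A B
      by (auto simp: p indicator_def)
    then show "indicator (E \<times> F) p *\<^sub>R simple_fun D a p = (\<Sum>A\<in>D. \<Sum>B\<in>D. indicator ((A \<inter> E) \<times> (B \<inter> F)) p *\<^sub>R a A B)"
      by (simp add: simple_fun_def p scaleR_sum_right)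
  qed
  have s: "A \<inter> E \<in> sets borel" "B \<inter> F \<in> sets borel" "emeasure lborel (A \<inter> E) < \<infinity>" "emeasure lborel (B \<inter> F) < \<infinity>"
    if "A \<in> D" "B \<in> D" for A B
  proof -
    have AB: "A \<in> sets borel" "B \<in> sets borel" "E \<in> sets borel" "F \<in> sets borel"
      "emeasure lborel E < \<infinity>" "emeasure lborel F < \<infinity>"
      using that D E F by (auto simp: finite_measure_sets_def)
    then show "A \<inter> E \<in> sets borel" "B \<inter> F \<in> sets borel" by auto
    show "emeasure lborel (A \<inter> E) < \<infinity>" "emeasure lborel (B \<inter> F) < \<infinity>"
      using AB by (auto intro!: le_less_trans[OF emeasure_mono[of "A \<inter> E" E]] le_less_trans[OF emeasure_mono[of "B \<inter> F" F]])
  qed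
  have i: "integrable ?L (\<lambda>p. indicator ((A \<inter> E) \<times> (B \<inter> F)) p *\<^sub>R a A B)" if "A \<in> D" "B \<in> D" for A B
    using s[OF that] emeasure_lborel_Times_finite[OF s[OF that]]
    by (intro integrable_scaleR_left integrable_real_indicator) auto
  show "integrable ?L (\<lambda>p. indicator (E \<times> F) p *\<^sub>R simple_fun D a p)"
    unfolding eq by (intro Bochner_Integration.integrable_sum i)
  have "(\<integral>p. indicator (E \<times> F) p *\<^sub>R simple_fun D a p \<partial>?L)
      = (\<Sum>A\<in>D. \<Sum>B\<in>D. \<integral>p. indicator ((A \<inter> E) \<times> (B \<inter> F)) p *\<^sub>R a A B \<partial>?L)"
    unfolding eq
    by (subst Bochner_Integration.integral_sum, intro Bochner_Integration.integrable_sum i, assumption+)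
       (intro sum.cong refl Bochner_Integration.integral_sum i)
  also have "\<dots> = rectangle_sum D a E F"
    unfolding rectangle_sum_def
  proof (intro sum.cong refl)
    fix A B assume AB: "A \<in> D" "B \<in> D"
    have "(\<integral>p. indicator ((A \<inter> E) \<times> (B \<inter> F)) p *\<^sub>R a A B \<partial>?L) = measure ?L ((A \<inter> E) \<times> (B \<inter> F)) *\<^sub>R a A B"
    proof -
      have "integrable ?L (\<lambda>p. indicator ((A \<inter> E) \<times> (B \<inter> F)) p :: real)"
        using s[OF AB] emeasure_lborel_Times_finite[OF s[OF AB]] by (intro integrable_real_indicator) auto
      then show ?thesis by (simp add: space_pair_measure)
    qed
    then show "(\<integral>p. indicator ((A \<inter> E) \<times> (B \<inter> F)) p *\<^sub>R a A B \<partial>?L)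
        = a A B * complex_of_real (measure lborel (A \<inter> E) * measure lborel (B \<inter> F))"
      using measure_lborel_Times[OF s(1,2)[OF AB]] by (simp add: scaleR_conv_of_real)
  qed
  finally show "(\<integral>p. indicator (E \<times> F) p *\<^sub>R simple_fun D a p \<partial>?L) = rectangle_sum D a E F" .
qed

lemma power2_le_ennreal_imp_le:
  assumes "x\<^sup>2 \<le> ennreal (c\<^sup>2)" "0 \<le> c"
  shows "x \<le> ennreal c"
proof (cases x)
  case (real r)
  then have "r\<^sup>2 \<le> c\<^sup>2" using assms by (simp add: ennreal_power)
  then have "r \<le> c" using assms(2) by (rule power2_le_imp_le)
  then show ?thesis using real by (simp add: ennreal_leI)
next
  case top
  then show ?thesis using assms by (simp add: power2_eq_square top_unique)
qed

text \<open>The term \<open>e * \<delta>\<close> is the Cauchy--Schwarz bound for the integral of \<open>\<bar>g - f\<bar>\<close> over the rectangle, whose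
  volume is \<open>e\<^sup>2\<close>; the other term is the error made by replacing \<open>f\<close> by the constant \<open>z\<close>.\<close>

lemma rectangle_integral_close:
  fixes f g :: "(real ^ 'd) \<times> (real ^ 'd) \<Rightarrow> complex"
  assumes f[measurable]: "f \<in> borel_measurable (lborel \<Otimes>\<^sub>M lborel)"
    and g[measurable]: "g \<in> borel_measurable (lborel \<Otimes>\<^sub>M lborel)"
    and int: "integrable (lborel \<Otimes>\<^sub>M lborel) (\<lambda>p. indicator (E \<times> F) p *\<^sub>R g p)"
    and E: "E \<in> finite_measure_sets" "measure lborel E = e"
    and F: "F \<in> finite_measure_sets" "measure lborel F = e"
    and l2: "(\<integral>\<^sup>+p. ennreal ((cmod (g p - f p))\<^sup>2) \<partial>(lborel \<Otimes>\<^sub>M lborel)) \<le> ennreal (\<delta>\<^sup>2)"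
    and close: "\<And>p. p \<in> E \<times> F \<Longrightarrow> cmod (f p - z) \<le> \<epsilon>"
    and nonneg: "0 \<le> \<delta>" "0 \<le> \<epsilon>"
  shows "cmod ((\<integral>p. indicator (E \<times> F) p *\<^sub>R g p \<partial>(lborel \<Otimes>\<^sub>M lborel)) - complex_of_real (e\<^sup>2) * z) \<le> e * \<delta> + \<epsilon> * e\<^sup>2"
proof -
  let ?L = "lborel \<Otimes>\<^sub>M lborel :: ((real ^ 'd) \<times> (real ^ 'd)) measure"
  let ?S = "E \<times> F"
  have e0: "0 \<le> e" using E(2) measure_nonneg by metis
  have b: "E \<in> sets borel" "F \<in> sets borel" "emeasure lborel E < \<infinity>" "emeasure lborel F < \<infinity>"
    using E F by (auto simp: finite_measure_sets_def)
  have S[measurable]: "?S \<in> sets ?L" using b by auto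
  have Sf: "emeasure ?L ?S < \<infinity>" by (rule emeasure_lborel_Times_finite[OF b])
  have mS: "measure ?L ?S = e\<^sup>2" using measure_lborel_Times[OF b(1,2)] E F by (simp add: power2_eq_square)
  have emS: "emeasure ?L ?S = ennreal (e\<^sup>2)"
    using Sf mS by (simp add: emeasure_eq_ennreal_measure less_top)
  have intz: "integrable ?L (\<lambda>p. indicator ?S p *\<^sub>R z)"
    by (intro integrable_scaleR_left integrable_real_indicator S Sf)
  have iz: "(\<integral>p. indicator ?S p *\<^sub>R z \<partial>?L) = complex_of_real (e\<^sup>2) * z"
  proof -
    have "integrable ?L (\<lambda>p. indicator ?S p :: real)"
      by (intro integrable_real_indicator S Sf)
    then show ?thesis using mS by (simp add: space_pair_measure scaleR_conv_of_real)
  qed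
  define h where "h = (\<lambda>p. indicator ?S p *\<^sub>R g p - indicator ?S p *\<^sub>R z)"
  have inth: "integrable ?L h" unfolding h_def using int intz by simp
  define A where "A = (\<integral>\<^sup>+p. indicator ?S p * ennreal (cmod (g p - f p)) \<partial>?L)"
  have "A\<^sup>2 \<le> (\<integral>\<^sup>+p. (indicator ?S p)\<^sup>2 \<partial>?L) * (\<integral>\<^sup>+p. (ennreal (cmod (g p - f p)))\<^sup>2 \<partial>?L)"
    unfolding A_def by (rule Cauchy_Schwarz_nn_integral) auto
  also have "(\<integral>\<^sup>+p. (indicator ?S p)\<^sup>2 \<partial>?L) = (\<integral>\<^sup>+p. indicator ?S p \<partial>?L)"
    by (intro nn_integral_cong) (auto split: split_indicator)
  also have "\<dots> = ennreal (e\<^sup>2)" by (simp only: nn_integral_indicator[OF S] emS)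
  also have "(\<integral>\<^sup>+p. (ennreal (cmod (g p - f p)))\<^sup>2 \<partial>?L) \<le> ennreal (\<delta>\<^sup>2)"
    using l2 by (simp add: ennreal_power)
  finally have "A\<^sup>2 \<le> ennreal (e\<^sup>2) * ennreal (\<delta>\<^sup>2)" by (simp add: mult_left_mono)
  then have "A\<^sup>2 \<le> ennreal ((e * \<delta>)\<^sup>2)" by (simp add: ennreal_mult power_mult_distrib)
  then have A: "A \<le> ennreal (e * \<delta>)" by (rule power2_le_ennreal_imp_le) (intro mult_nonneg_nonneg e0 nonneg)
  have "ennreal (cmod (\<integral>p. h p \<partial>?L)) \<le> (\<integral>\<^sup>+p. ennreal (cmod (h p)) \<partial>?L)"
    by (rule integral_norm_bound_ennreal[OF inth])
  also have "\<dots> \<le> (\<integral>\<^sup>+p. indicator ?S p * ennreal (cmod (g p - f p)) + ennreal \<epsilon> * indicator ?S p \<partial>?L)"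
  proof (rule nn_integral_mono)
    fix p
    show "ennreal (cmod (h p)) \<le> indicator ?S p * ennreal (cmod (g p - f p)) + ennreal \<epsilon> * indicator ?S p"
    proof (cases "p \<in> ?S")
      case True
      have "cmod (h p) \<le> cmod (g p - f p) + \<epsilon>"
        using norm_triangle_ineq[of "g p - f p" "f p - z"] close[OF True] True by (simp add: h_def)
      then show ?thesis using True nonneg by (simp add: ennreal_plus[symmetric] del: ennreal_plus)
    qed (simp add: h_def)
  qed
  also have "\<dots> = A + ennreal \<epsilon> * ennreal (e\<^sup>2)"
  proof -
    have "(\<integral>\<^sup>+p. indicator ?S p * ennreal (cmod (g p - f p)) + ennreal \<epsilon> * indicator ?S p \<partial>?L)
       = A + (\<integral>\<^sup>+p. ennreal \<epsilon> * indicator ?S p \<partial>?L)"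
      unfolding A_def by (rule nn_integral_add) measurable
    then show ?thesis by (simp only: nn_integral_cmult_indicator[OF S] emS)
  qed
  also have "\<dots> \<le> ennreal (e * \<delta>) + ennreal \<epsilon> * ennreal (e\<^sup>2)" using A by (intro add_mono) auto
  also have "\<dots> = ennreal (e * \<delta> + \<epsilon> * e\<^sup>2)"
    using e0 nonneg by (simp add: ennreal_mult ennreal_plus)
  finally have "cmod (\<integral>p. h p \<partial>?L) \<le> e * \<delta> + \<epsilon> * e\<^sup>2"
    using e0 nonneg by (subst (asm) ennreal_le_iff) auto
  moreover have "(\<integral>p. h p \<partial>?L) = (\<integral>p. indicator ?S p *\<^sub>R g p \<partial>?L) - complex_of_real (e\<^sup>2) * z"
    unfolding h_def iz[symmetric] using int intz by (rule Bochner_Integration.integral_diff)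
  ultimately show ?thesis by simp
qed

text \<open>This expresses the matrix of the form \<open>real_coeff a\<close> on indicators of sets through integrals of the complex
  simple function alone, so that its limit can be read off from the kernel.\<close>

lemma sum_real_coeff_rectangle:
  assumes reg: "regular_system D" and E: "E \<in> sets borel"
  shows "(\<Sum>A\<in>D. \<Sum>B\<in>D. real_coeff a A B * measure lborel (A \<inter> E) * measure lborel (B \<inter> F))
     = Re (rectangle_sum D a (uminus ` E) F) - Im (rectangle_sum D a E F)"
proof -
  have D: "A \<in> sets borel" if "A \<in> D" for A
    using reg that by (auto simp: regular_system_def finite_measure_sets_def)
  have m: "measure lborel (uminus ` A \<inter> E) = measure lborel (A \<inter> uminus ` E)" if "A \<in> D" for A
  proof -
    have "uminus ` (uminus ` A \<inter> E) = A \<inter> uminus ` E"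
      by (subst image_Int) (auto simp: image_image)
    moreover have "uminus ` A \<inter> E \<in> sets borel"
      using D E reg that by (auto simp: regular_system_def)
    ultimately show ?thesis using measure_lborel_uminus_image by metis
  qed
  have "(\<Sum>A\<in>D. \<Sum>B\<in>D. Re (a (uminus ` A) B) * measure lborel (A \<inter> E) * measure lborel (B \<inter> F))
     = (\<Sum>A\<in>D. \<Sum>B\<in>D. Re (a A B) * measure lborel (uminus ` A \<inter> E) * measure lborel (B \<inter> F))"
    by (subst sum_uminus_reindex[OF reg, symmetric]) (simp add: uminus_image_involution)
  also have "\<dots> = Re (rectangle_sum D a (uminus ` E) F)"
    unfolding rectangle_sum_def Re_sum by (intro sum.cong refl) (simp add: m)
  finally show ?thesis
    by (simp add: real_coeff_def rectangle_sum_def left_diff_distrib sum_subtractf mult.assoc)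
qed

lemma isCont_close_on_small_balls:
  fixes f :: "'a::metric_space \<times> 'b::metric_space \<Rightarrow> complex"
  assumes "isCont f (x, y)" "\<epsilon> > 0"
  shows "\<forall>\<^sub>F r in at_right 0. \<forall>p\<in>ball x r \<times> ball y r. cmod (f p - f (x, y)) \<le> \<epsilon>"
proof -
  obtain d where d: "d > 0" "\<And>p. dist p (x, y) < d \<Longrightarrow> dist (f p) (f (x, y)) < \<epsilon>"
    using assms by (auto simp: continuous_at_eps_delta)
  have "\<forall>p\<in>ball x r \<times> ball y r. cmod (f p - f (x, y)) \<le> \<epsilon>" if r: "0 < r" "r < d / 2" for r
  proof
    fix p assume p: "p \<in> ball x r \<times> ball y r"
    have "dist p (x, y) \<le> dist (fst p) x + dist (snd p) y"
      using sqrt_sum_squares_le_sum[of "dist (fst p) x" "dist (snd p) y"] by (simp add: dist_prod_def)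
    also have "\<dots> < d" using p r by (auto simp: dist_commute)
    finally show "cmod (f p - f (x, y)) \<le> \<epsilon>" using d(2)[of p] by (simp add: dist_norm)
  qed
  then show ?thesis using d(1) unfolding eventually_at_right_field by (intro exI[of _ "d / 2"]) auto
qed

section \<open>The characteristic function of the double integral\<close>

text \<open>Let \<open>e\<close> be the common volume of four small disjoint balls around the points \<open>P m\<close>. For large \<open>n\<close> the
  matrix of \<open>real_coeff (a n)\<close> on their normalised indicators differs from \<open>e\<close> times the matrix of
  \<open>real_kernel\<close> by at most \<open>4 * \<epsilon> * e\<close> in each entry. With \<open>\<epsilon> = c / 32\<close> this perturbs the quadratic form, on
  \<open>4\<close>-vectors, by at most half of its lower bound \<open>e * c\<close>.\<close>

proposition simple_double_integral_char_bound:
  fixes W :: "(real ^ 'd) set \<Rightarrow> 'w \<Rightarrow> complex" and \<Delta> :: "(real ^ 'd) set"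
  assumes bdd: "bounded \<Delta>" and pos: "measure lebesgue \<Delta> > 0" and int0: "0 \<in> interior \<Delta>"
    and wn: "complex_white_noise M W" and sc: "\<And>n. simple_coeffs (D n) (a n)"
    and f[measurable]: "rosenblatt_kernel \<Delta> \<alpha> \<in> borel_measurable (lborel \<Otimes>\<^sub>M lborel)"
    and l2: "(\<lambda>n. \<integral>\<^sup>+ p. ennreal ((cmod (simple_fun (D n) (a n) p - rosenblatt_kernel \<Delta> \<alpha> p))\<^sup>2)
                \<partial>(lborel \<Otimes>\<^sub>M lborel)) \<longlonglongrightarrow> 0"
  shows "\<exists>c>0. \<forall>\<^sub>F n in sequentially. \<forall>t.
    cmod (\<integral>\<omega>. iexp (t * Re (simple_double_integral W (D n) (a n) \<omega>)) \<partial>M) \<le> 1 / (1 + (c * t)\<^sup>2)"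
proof -
  interpret prob_space M using wn by (simp add: complex_white_noise_def)
  let ?f = "rosenblatt_kernel \<Delta> \<alpha>" and ?k = "real_kernel \<Delta> \<alpha>"
  obtain P :: "4 \<Rightarrow> real ^ 'd" and c where injP: "inj P" and P0: "\<And>m. P m \<noteq> 0" and c: "c > 0"
    and form: "\<And>N. c * (\<Sum>m\<in>UNIV. (N m)\<^sup>2) \<le> (\<Sum>m\<in>UNIV. \<Sum>m'\<in>UNIV. N m * N m' * ?k (P m) (P m'))"
    using real_kernel_positive_definite[OF bdd pos int0] by blast
  define \<epsilon> where "\<epsilon> = c / 32"
  have \<epsilon>: "\<epsilon> > 0" using c by (simp add: \<epsilon>_def)
  have cont: "isCont ?f (x, y)" if "x \<noteq> 0" "y \<noteq> 0" for x y
    by (rule rosenblatt_kernel_isCont[OF bdd pos that])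
  have "\<forall>\<^sub>F r in at_right 0. \<forall>m m'. \<forall>p\<in>ball (P m) r \<times> ball (P m') r. cmod (?f p - ?f (P m, P m')) \<le> \<epsilon>"
    by (intro eventually_all_finite isCont_close_on_small_balls cont P0 \<epsilon>)
  moreover have "\<forall>\<^sub>F r in at_right 0. \<forall>m m'. \<forall>p\<in>ball (- P m) r \<times> ball (P m') r. cmod (?f p - ?f (- P m, P m')) \<le> \<epsilon>"
    by (intro eventually_all_finite isCont_close_on_small_balls cont \<epsilon>) (simp_all add: P0)
  moreover have "\<forall>\<^sub>F r in at_right 0. \<forall>m m'. m \<noteq> m' \<longrightarrow> ball (P m) r \<inter> ball (P m') r = {}"
  proof (intro eventually_all_finite)
    fix m m'
    show "\<forall>\<^sub>F r in at_right 0. m \<noteq> m' \<longrightarrow> ball (P m) r \<inter> ball (P m') r = {}"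
    proof (cases "m = m'")
      case False
      then have "dist (P m) (P m') > 0" using injP by (auto simp: inj_def)
      then show ?thesis unfolding eventually_at_right_field
        by (intro exI[of _ "dist (P m) (P m') / 2"]) (auto intro!: disjoint_ballI)
    qed simp
  qed
  moreover have "\<forall>\<^sub>F r in at_right 0. (0::real) < r" by (rule eventually_at_right_less)
  ultimately have "\<forall>\<^sub>F r in at_right 0. 0 < r
      \<and> (\<forall>m m'. \<forall>p\<in>ball (P m) r \<times> ball (P m') r. cmod (?f p - ?f (P m, P m')) \<le> \<epsilon>)
      \<and> (\<forall>m m'. \<forall>p\<in>ball (- P m) r \<times> ball (P m') r. cmod (?f p - ?f (- P m, P m')) \<le> \<epsilon>)
      \<and> (\<forall>m m'. m \<noteq> m' \<longrightarrow> ball (P m) r \<inter> ball (P m') r = {})"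
    by eventually_elim blast
  from eventually_happens'[OF trivial_limit_at_right_real this] obtain r where r: "0 < r"
    and cl1: "\<forall>m m'. \<forall>p\<in>ball (P m) r \<times> ball (P m') r. cmod (?f p - ?f (P m, P m')) \<le> \<epsilon>"
    and cl2: "\<forall>m m'. \<forall>p\<in>ball (- P m) r \<times> ball (P m') r. cmod (?f p - ?f (- P m, P m')) \<le> \<epsilon>"
    and disj: "\<forall>m m'. m \<noteq> m' \<longrightarrow> ball (P m) r \<inter> ball (P m') r = {}"
    by (elim exE conjE) (rule that; assumption)
  note cl1 = cl1[rule_format] and cl2 = cl2[rule_format] and disjE = disj[rule_format]
  define e where "e = r ^ DIM(real ^ 'd) * measure lborel (ball (0 :: real ^ 'd) 1)"
  have me: "measure lborel (ball x r) = e" for x :: "real ^ 'd"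
    unfolding e_def using r by (intro content_ball_conv_unit_ball) simp
  have e: "e > 0" using content_ball_pos[OF r, of "0 :: real ^ 'd"] me by simp
  have fmb: "ball x r \<in> finite_measure_sets" for x :: "real ^ 'd"
    using emeasure_lborel_ball_finite[of x r] by (simp add: finite_measure_sets_def)
  have um: "uminus ` ball x r = ball (- x) r" for x :: "real ^ 'd"
    unfolding uminus_image_eq_vimage set_eq_iff vimage_eq mem_ball
    by (metis dist_minus add.inverse_inverse)
  define \<delta> where "\<delta> = \<epsilon> * e"
  have \<delta>: "\<delta> > 0" using \<epsilon> e by (simp add: \<delta>_def)
  have "\<forall>\<^sub>F n in sequentially. (\<integral>\<^sup>+ p. ennreal ((cmod (simple_fun (D n) (a n) p - ?f p))\<^sup>2) \<partial>(lborel \<Otimes>\<^sub>M lborel)) < ennreal (\<delta>\<^sup>2)"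
    using \<delta> by (intro order_tendstoD(2)[OF l2]) simp
  then have ev: "\<forall>\<^sub>F n in sequentially. \<forall>t.
    cmod (\<integral>\<omega>. iexp (t * Re (simple_double_integral W (D n) (a n) \<omega>)) \<partial>M) \<le> 1 / (1 + (e * c * t)\<^sup>2)"
  proof (eventually_elim, intro allI)
    fix n t
    assume close: "(\<integral>\<^sup>+ p. ennreal ((cmod (simple_fun (D n) (a n) p - ?f p))\<^sup>2) \<partial>(lborel \<Otimes>\<^sub>M lborel)) < ennreal (\<delta>\<^sup>2)"
    let ?D = "D n" and ?a = "a n"
    have reg: "regular_system ?D" using sc[of n] by (simp add: simple_coeffs_def)
    have fin: "finite ?D" and Dfm: "?D \<subseteq> finite_measure_sets"
      and disjD: "\<And>A B. A \<in> ?D \<Longrightarrow> B \<in> ?D \<Longrightarrow> A \<noteq> B \<Longrightarrow> A \<inter> B = {}"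
      using reg unfolding regular_system_def by blast+
    have Db: "A \<in> sets borel \<and> emeasure lborel A < \<infinity>" if "A \<in> ?D" for A
      using Dfm that by (auto simp: finite_measure_sets_def)
    have sm: "simple_fun ?D ?a \<in> borel_measurable (lborel \<Otimes>\<^sub>M lborel)"
    proof -
      have [measurable]: "A \<in> sets borel" if "A \<in> ?D" for A using Db[OF that] by simp
      show ?thesis unfolding simple_fun_def split_beta' by measurable
    qed
    have I: "cmod (rectangle_sum ?D ?a (ball x r) (ball y r) - complex_of_real (e\<^sup>2) * z) \<le> 2 * \<epsilon> * e\<^sup>2"
      if "\<And>p. p \<in> ball x r \<times> ball y r \<Longrightarrow> cmod (?f p - z) \<le> \<epsilon>" for x y z
    proof -
      have "cmod ((\<integral>p. indicator (ball x r \<times> ball y r) p *\<^sub>R simple_fun ?D ?a p \<partial>(lborel \<Otimes>\<^sub>M lborel)) - complex_of_real (e\<^sup>2) * z)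
          \<le> e * \<delta> + \<epsilon> * e\<^sup>2"
        using that close \<epsilon> \<delta>
        by (intro rectangle_integral_close[OF f sm simple_fun_rectangle_integral(1)[OF fin Dfm fmb fmb] fmb me fmb me]) auto
      then show ?thesis unfolding simple_fun_rectangle_integral(2)[OF fin Dfm fmb fmb]
        by (simp add: \<delta>_def power2_eq_square)
    qed
    define J where "J = (\<lambda>m m'. \<Sum>A\<in>?D. \<Sum>B\<in>?D. real_coeff ?a A B * measure lborel (A \<inter> ball (P m) r) * measure lborel (B \<inter> ball (P m') r))"
    have J: "\<bar>J m m' - e\<^sup>2 * ?k (P m) (P m')\<bar> \<le> 4 * \<epsilon> * e\<^sup>2" for m m'
    proof -
      let ?z1 = "rectangle_sum ?D ?a (ball (- P m) r) (ball (P m') r) - complex_of_real (e\<^sup>2) * ?f (- P m, P m')"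
      let ?z2 = "rectangle_sum ?D ?a (ball (P m) r) (ball (P m') r) - complex_of_real (e\<^sup>2) * ?f (P m, P m')"
      have "J m m' = Re (rectangle_sum ?D ?a (ball (- P m) r) (ball (P m') r)) - Im (rectangle_sum ?D ?a (ball (P m) r) (ball (P m') r))"
        unfolding J_def um[symmetric] by (rule sum_real_coeff_rectangle[OF reg]) simp
      then have "J m m' - e\<^sup>2 * ?k (P m) (P m') = Re ?z1 - Im ?z2"
        unfolding real_kernel_def[OF bdd pos] by (simp add: algebra_simps del: of_real_power)
      moreover have "cmod ?z1 \<le> 2 * \<epsilon> * e\<^sup>2" by (rule I) (rule cl2)
      moreover have "cmod ?z2 \<le> 2 * \<epsilon> * e\<^sup>2" by (rule I) (rule cl1)
      ultimately show ?thesis using abs_Re_le_cmod[of ?z1] abs_Im_le_cmod[of ?z2] by linarith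
    qed
    let ?p = "\<lambda>m A. measure lborel (A \<inter> ball (P m) r) / sqrt e"
    let ?Q = "\<lambda>\<omega>. \<Sum>A\<in>?D. \<Sum>B\<in>?D. real_coeff ?a A B * real_noise W A \<omega> * real_noise W B \<omega>"
    have pJ: "(\<Sum>A\<in>?D. \<Sum>B\<in>?D. real_coeff ?a A B * ?p m A * ?p m' B) = J m m' / e" for m m'
    proof -
      have "real_coeff ?a A B * ?p m A * ?p m' B
          = real_coeff ?a A B * measure lborel (A \<inter> ball (P m) r) * measure lborel (B \<inter> ball (P m') r) / e" for A B
        using e by (simp add: field_simps)
      then show ?thesis by (simp only: J_def sum_divide_distrib)
    qed
    have pos': "e * c / 2 * (\<Sum>m\<in>UNIV. (N m)\<^sup>2)
        \<le> (\<Sum>m\<in>UNIV. \<Sum>m'\<in>UNIV. N m * N m' * (\<Sum>A\<in>?D. \<Sum>B\<in>?D. real_coeff ?a A B * ?p m A * ?p m' B))" for N :: "4 \<Rightarrow> real"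
    proof -
      define S where "S = (\<Sum>m\<in>UNIV. (N m)\<^sup>2)"
      have "(\<Sum>m\<in>UNIV. \<bar>N m\<bar>)\<^sup>2 = (\<Sum>m\<in>UNIV. \<bar>N m\<bar> * 1)\<^sup>2" by simp
      also have "\<dots> \<le> (\<Sum>m\<in>UNIV. \<bar>N m\<bar>\<^sup>2) * (\<Sum>m\<in>(UNIV :: 4 set). 1\<^sup>2)" by (rule Cauchy_Schwarz_ineq_sum)
      finally have cs: "(\<Sum>m\<in>UNIV. \<bar>N m\<bar>)\<^sup>2 \<le> 4 * S" by (simp add: S_def)
      have "(\<Sum>m\<in>UNIV. \<Sum>m'\<in>UNIV. N m * N m' * (e * ?k (P m) (P m'))) - (\<Sum>m\<in>UNIV. \<Sum>m'\<in>UNIV. \<bar>N m\<bar> * \<bar>N m'\<bar> * (4 * \<epsilon> * e))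
         \<le> (\<Sum>m\<in>UNIV. \<Sum>m'\<in>UNIV. N m * N m' * (J m m' / e))"
        unfolding sum_subtractf[symmetric]
      proof (intro sum_mono)
        fix m m'
        have "J m m' / e - e * ?k (P m) (P m') = (J m m' - e\<^sup>2 * ?k (P m) (P m')) / e"
          using e by (simp add: diff_divide_distrib power2_eq_square)
        then have "\<bar>J m m' / e - e * ?k (P m) (P m')\<bar> = \<bar>J m m' - e\<^sup>2 * ?k (P m) (P m')\<bar> / e"
          using e by (simp only: abs_divide abs_of_pos)
        also have "\<dots> \<le> (4 * \<epsilon> * e\<^sup>2) / e" using e by (intro divide_right_mono J) simp
        also have "\<dots> = 4 * \<epsilon> * e" using e by (simp add: power2_eq_square)
        finally have "\<bar>J m m' / e - e * ?k (P m) (P m')\<bar> \<le> 4 * \<epsilon> * e" .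
        then have "\<bar>N m * N m'\<bar> * \<bar>J m m' / e - e * ?k (P m) (P m')\<bar> \<le> \<bar>N m * N m'\<bar> * (4 * \<epsilon> * e)"
          by (rule mult_left_mono) simp
        then have "\<bar>N m * N m' * (J m m' / e - e * ?k (P m) (P m'))\<bar> \<le> \<bar>N m\<bar> * \<bar>N m'\<bar> * (4 * \<epsilon> * e)"
          by (simp add: abs_mult)
        then show "N m * N m' * (e * ?k (P m) (P m')) - \<bar>N m\<bar> * \<bar>N m'\<bar> * (4 * \<epsilon> * e) \<le> N m * N m' * (J m m' / e)"
          unfolding right_diff_distrib by linarith
      qed
      moreover have "(\<Sum>m\<in>UNIV. \<Sum>m'\<in>UNIV. \<bar>N m\<bar> * \<bar>N m'\<bar> * (4 * \<epsilon> * e)) = (\<Sum>m\<in>UNIV. \<bar>N m\<bar>)\<^sup>2 * (4 * \<epsilon> * e)"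
        unfolding power2_eq_square sum_product by (simp only: sum_distrib_right)
      moreover have "(\<Sum>m\<in>UNIV. \<bar>N m\<bar>)\<^sup>2 * (4 * \<epsilon> * e) \<le> (4 * S) * (4 * \<epsilon> * e)"
        using cs \<epsilon> e by (intro mult_right_mono) auto
      moreover have "(4 * S) * (4 * \<epsilon> * e) = e * c / 2 * S" by (simp add: \<epsilon>_def)
      moreover have "(\<Sum>m\<in>UNIV. \<Sum>m'\<in>UNIV. N m * N m' * (e * ?k (P m) (P m'))) = e * (\<Sum>m\<in>UNIV. \<Sum>m'\<in>UNIV. N m * N m' * ?k (P m) (P m'))"
        by (simp add: sum_distrib_left mult_ac)
      moreover have "e * (c * S) \<le> e * (\<Sum>m\<in>UNIV. \<Sum>m'\<in>UNIV. N m * N m' * ?k (P m) (P m'))"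
        using form[of N] e unfolding S_def by (intro mult_left_mono) auto
      moreover have "e * (c * S) = 2 * (e * c / 2 * S)" by simp
      ultimately show ?thesis unfolding pJ S_def[symmetric] by linarith
    qed
    have bessel: "(\<Sum>m\<in>UNIV. (\<Sum>A\<in>?D. ?p m A * y A)\<^sup>2) \<le> (\<Sum>A\<in>?D. measure lborel A * (y A)\<^sup>2)" for y
      by (rule overlap_bessel[OF fin Db disjD _ emeasure_lborel_ball_finite me disjE e]) simp_all
    have bound: "(cmod (\<integral>\<omega>. iexp (t * ?Q \<omega>) \<partial>M))\<^sup>2 \<le> (1 / sqrt (1 + (2 * (e * c / 2) * t)\<^sup>2)) ^ CARD(4)"
      by (rule cmod_char_quadratic_form_le[OF fin real_noise_char(1)[OF wn reg] real_noise_char(2)[OF wn reg] _ bessel pos'])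
         (use e c in auto)
    have "(\<integral>\<omega>. iexp (t * Re (simple_double_integral W ?D ?a \<omega>)) \<partial>M) = (\<integral>\<omega>. iexp (t * ?Q \<omega>) \<partial>M)"
    proof (rule integral_cong_AE)
      have Wm: "W A \<in> borel_measurable M" if "A \<in> ?D" for A
        using wn[unfolded complex_white_noise_def, THEN conjunct2, THEN conjunct1] Dfm that by blast
      show "(\<lambda>\<omega>. iexp (t * Re (simple_double_integral W ?D ?a \<omega>))) \<in> borel_measurable M"
        unfolding simple_double_integral_def using Wm by measurable
      show "(\<lambda>\<omega>. iexp (t * ?Q \<omega>)) \<in> borel_measurable M"
        using real_noise_char(1)[OF wn reg] by measurable
      show "AE \<omega> in M. iexp (t * Re (simple_double_integral W ?D ?a \<omega>)) = iexp (t * ?Q \<omega>)"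
        using simple_double_integral_real_noise[OF wn sc[of n]]
        by eventually_elim (simp only: Re_complex_of_real)
    qed
    then have "(cmod (\<integral>\<omega>. iexp (t * Re (simple_double_integral W ?D ?a \<omega>)) \<partial>M))\<^sup>2 \<le> (1 / sqrt (1 + (e * c * t)\<^sup>2)) ^ 4"
      using bound by simp
    also have "\<dots> = (1 / (1 + (e * c * t)\<^sup>2))\<^sup>2"
    proof -
      have "0 \<le> 1 + (e * c * t)\<^sup>2" by simp
      then have "(sqrt (1 + (e * c * t)\<^sup>2)) ^ 4 = (1 + (e * c * t)\<^sup>2)\<^sup>2"
        by (metis (no_types) power_mult real_sqrt_pow2 mult_2 numeral_Bit0)
      then show ?thesis by (simp add: power_divide)
    qed
    finally show "cmod (\<integral>\<omega>. iexp (t * Re (simple_double_integral W ?D ?a \<omega>)) \<partial>M) \<le> 1 / (1 + (e * c * t)\<^sup>2)"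
      by (rule power2_le_imp_le) simp
  qed
  then show ?thesis using e c by (intro exI[of _ "e * c"]) auto
qed

section \<open>The bounded density\<close>

lemma integrable_inverse_1_plus_scaled_square:
  assumes "c \<noteq> (0::real)"
  shows "integrable lborel (\<lambda>t. 1 / (1 + (c * t)\<^sup>2))"
proof -
  have "integrable lborel (\<lambda>t :: real. inverse (1 + t\<^sup>2))"
    using integrable_inverse_1_plus_square by (simp add: set_integrable_def)
  from lborel_integrable_real_affine[OF this assms, of 0] show ?thesis
    by (simp add: inverse_eq_divide)
qed

text \<open>\<open>iexp\<close> is Lipschitz with constant one, and \<open>L\<^sup>2\<close> convergence on a probability space implies \<open>L\<^sup>1\<close>
  convergence.\<close>

lemma (in prob_space) char_tendsto_if_mean_square_tendsto:
  fixes S :: "nat \<Rightarrow> 'a \<Rightarrow> complex" and I :: "'a \<Rightarrow> complex"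
  assumes S[measurable]: "\<And>n. S n \<in> borel_measurable M" and I[measurable]: "I \<in> borel_measurable M"
    and l2: "(\<lambda>n. \<integral>\<^sup>+ \<omega>. ennreal ((cmod (S n \<omega> - I \<omega>))\<^sup>2) \<partial>M) \<longlonglongrightarrow> 0"
  shows "(\<lambda>n. \<integral>\<omega>. iexp (t * Re (S n \<omega>)) \<partial>M) \<longlonglongrightarrow> (\<integral>\<omega>. iexp (t * Re (I \<omega>)) \<partial>M)"
proof -
  define d where "d = (\<lambda>n. (\<integral>\<omega>. iexp (t * Re (S n \<omega>)) \<partial>M) - (\<integral>\<omega>. iexp (t * Re (I \<omega>)) \<partial>M))"
  have i1: "integrable M (\<lambda>\<omega>. iexp (t * Re (S n \<omega>)))" for n
    by (rule integrable_iexp_bounded) (auto intro: finite_measure_axioms)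
  have i2: "integrable M (\<lambda>\<omega>. iexp (t * Re (I \<omega>)))"
    by (rule integrable_iexp_bounded) (auto intro: finite_measure_axioms)
  have lip: "cmod (iexp a - iexp b) \<le> \<bar>a - b\<bar>" for a b :: real
  proof -
    have "iexp a - iexp b = iexp b * (iexp (a - b) - 1)"
      by (simp add: algebra_simps exp_diff)
    moreover have "cmod (iexp (a - b) - 1) \<le> \<bar>a - b\<bar>"
      using iexp_approx1[of "a - b" 0] by simp
    ultimately show ?thesis by (simp add: norm_mult)
  qed
  have bound: "ennreal ((cmod (d n))\<^sup>2) \<le> ennreal (t\<^sup>2) * (\<integral>\<^sup>+ \<omega>. ennreal ((cmod (S n \<omega> - I \<omega>))\<^sup>2) \<partial>M)" for n
  proof -
    have "d n = (\<integral>\<omega>. iexp (t * Re (S n \<omega>)) - iexp (t * Re (I \<omega>)) \<partial>M)"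
      unfolding d_def by (rule Bochner_Integration.integral_diff[OF i1 i2, symmetric])
    then have "ennreal (cmod (d n)) \<le> (\<integral>\<^sup>+\<omega>. ennreal (cmod (iexp (t * Re (S n \<omega>)) - iexp (t * Re (I \<omega>)))) \<partial>M)"
      using integral_norm_bound_ennreal[OF Bochner_Integration.integrable_diff[OF i1 i2]] by (simp only:)
    also have "\<dots> \<le> (\<integral>\<^sup>+\<omega>. ennreal (\<bar>t\<bar> * cmod (S n \<omega> - I \<omega>)) * 1 \<partial>M)"
    proof (rule nn_integral_mono)
      fix \<omega>
      have "cmod (iexp (t * Re (S n \<omega>)) - iexp (t * Re (I \<omega>))) \<le> \<bar>t * Re (S n \<omega>) - t * Re (I \<omega>)\<bar>" by (rule lip)
      also have "\<dots> = \<bar>t\<bar> * \<bar>Re (S n \<omega> - I \<omega>)\<bar>" by (simp add: abs_mult[symmetric] right_diff_distrib)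
      also have "\<dots> \<le> \<bar>t\<bar> * cmod (S n \<omega> - I \<omega>)" by (intro mult_left_mono abs_Re_le_cmod) simp
      finally show "ennreal (cmod (iexp (t * Re (S n \<omega>)) - iexp (t * Re (I \<omega>)))) \<le> ennreal (\<bar>t\<bar> * cmod (S n \<omega> - I \<omega>)) * 1"
        by (simp only: mult_1_right ennreal_leI)
    qed
    finally have "(ennreal (cmod (d n)))\<^sup>2 \<le> (\<integral>\<^sup>+\<omega>. ennreal (\<bar>t\<bar> * cmod (S n \<omega> - I \<omega>)) * 1 \<partial>M)\<^sup>2"
      by (rule power_mono) simp
    also have "\<dots> \<le> (\<integral>\<^sup>+\<omega>. (ennreal (\<bar>t\<bar> * cmod (S n \<omega> - I \<omega>)))\<^sup>2 \<partial>M) * (\<integral>\<^sup>+\<omega>. 1\<^sup>2 \<partial>M)"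
      by (rule Cauchy_Schwarz_nn_integral) auto
    also have "\<dots> = (\<integral>\<^sup>+\<omega>. ennreal (t\<^sup>2) * ennreal ((cmod (S n \<omega> - I \<omega>))\<^sup>2) \<partial>M)"
      by (simp add: ennreal_power power_mult_distrib ennreal_mult emeasure_space_1)
    also have "\<dots> = ennreal (t\<^sup>2) * (\<integral>\<^sup>+ \<omega>. ennreal ((cmod (S n \<omega> - I \<omega>))\<^sup>2) \<partial>M)"
      by (rule nn_integral_cmult) measurable
    finally show ?thesis by (simp add: ennreal_power)
  qed
  have "(\<lambda>n. ennreal (t\<^sup>2) * (\<integral>\<^sup>+ \<omega>. ennreal ((cmod (S n \<omega> - I \<omega>))\<^sup>2) \<partial>M)) \<longlonglongrightarrow> ennreal (t\<^sup>2) * 0"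
    by (intro ennreal_tendsto_cmult l2) simp
  then have lim: "(\<lambda>n. ennreal (t\<^sup>2) * (\<integral>\<^sup>+ \<omega>. ennreal ((cmod (S n \<omega> - I \<omega>))\<^sup>2) \<partial>M)) \<longlonglongrightarrow> 0"
    by (simp only: mult_zero_right)
  have "(\<lambda>n. ennreal ((cmod (d n))\<^sup>2)) \<longlonglongrightarrow> 0"
    by (rule tendsto_sandwich[OF _ _ tendsto_const lim]) (intro always_eventually allI bound zero_le)+
  then have "(\<lambda>n. (cmod (d n))\<^sup>2) \<longlonglongrightarrow> 0" by (subst (asm) ennreal_tendsto_0_iff) auto
  then have "(\<lambda>n. sqrt ((cmod (d n))\<^sup>2)) \<longlonglongrightarrow> sqrt 0" by (rule tendsto_real_sqrt)
  then have "d \<longlonglongrightarrow> 0" by (simp add: tendsto_norm_zero_iff)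
  then show ?thesis unfolding d_def by (simp add: LIM_zero_iff)
qed

lemma c2_pos:
  assumes "0 < \<alpha>" "\<alpha> < real d"
  shows "c2 d \<alpha> > 0"
  using assms unfolding c2_def by (intro divide_pos_pos mult_pos_pos Gamma_real_pos) auto

theorem lemma3:
  fixes M :: "'w measure"
    and W :: "(real ^ 'd) set \<Rightarrow> 'w \<Rightarrow> complex"
    and \<Delta> :: "(real ^ 'd) set"
    and \<alpha> :: real
    and X :: "'w \<Rightarrow> real"
  assumes "0 < \<alpha>" and "\<alpha> < real CARD('d) / 2"
    and "bounded \<Delta>" and "convex \<Delta>" and "jordan_measurable \<Delta>"
    and "measure lebesgue \<Delta> > 0" and "0 \<in> interior \<Delta>"
    and "complex_white_noise M W"
    and "rosenblatt_type_rv M W \<Delta> \<alpha> X"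
  shows "\<exists>p :: real \<Rightarrow> real.
           (\<forall>z. p z \<ge> 0) \<and>
           distributed M lborel X (\<lambda>z. ennreal (p z)) \<and>
           (\<forall>z. ((\<lambda>z. measure M {\<omega> \<in> space M. X \<omega> \<le> z}) has_real_derivative p z) (at z)) \<and>
           bdd_above (range p)"
proof -
  interpret prob_space M using assms(8) by (simp add: complex_white_noise_def)
  obtain I where X[measurable]: "X \<in> borel_measurable M"
    and wi: "has_double_wiener_ito_integral M W (rosenblatt_kernel \<Delta> \<alpha>) I"
    and XI: "AE \<omega> in M. complex_of_real (X \<omega>) = complex_of_real (c2 CARD('d) \<alpha>) * I \<omega>"
    using assms(9) unfolding rosenblatt_type_rv_def by blast
  obtain D a where f: "rosenblatt_kernel \<Delta> \<alpha> \<in> borel_measurable (lborel \<Otimes>\<^sub>M lborel)"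
    and I[measurable]: "I \<in> borel_measurable M" and sc: "\<And>n::nat. simple_coeffs (D n) (a n)"
    and l2f: "(\<lambda>n. \<integral>\<^sup>+ p. ennreal ((cmod (simple_fun (D n) (a n) p - rosenblatt_kernel \<Delta> \<alpha> p))\<^sup>2)
                \<partial>(lborel \<Otimes>\<^sub>M lborel)) \<longlonglongrightarrow> 0"
    and l2I: "(\<lambda>n. \<integral>\<^sup>+ \<omega>. ennreal ((cmod (simple_double_integral W (D n) (a n) \<omega> - I \<omega>))\<^sup>2) \<partial>M) \<longlonglongrightarrow> 0"
    using wi unfolding has_double_wiener_ito_integral_def by blast
  define k where "k = c2 CARD('d) \<alpha>"
  have k: "k > 0" unfolding k_def using assms(1,2) by (intro c2_pos) auto
  obtain c where c: "c > 0" and bound: "\<forall>\<^sub>F n in sequentially. \<forall>t.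
      cmod (\<integral>\<omega>. iexp (t * Re (simple_double_integral W (D n) (a n) \<omega>)) \<partial>M) \<le> 1 / (1 + (c * t)\<^sup>2)"
    using simple_double_integral_char_bound[OF assms(3,6,7,8) sc f l2f] by blast
  have Sm: "simple_double_integral W (D n) (a n) \<in> borel_measurable M" for n
  proof -
    have "D n \<subseteq> finite_measure_sets"
      using sc[of n] by (simp add: simple_coeffs_def regular_system_def)
    then have "W A \<in> borel_measurable M" if "A \<in> D n" for A
      using assms(8)[unfolded complex_white_noise_def, THEN conjunct2, THEN conjunct1] that by blast
    then show ?thesis unfolding simple_double_integral_def by measurable
  qed
  interpret X: real_distribution "distr M borel X" by (rule real_distribution_distr) simp
  have char_bound: "cmod (char (distr M borel X) t) \<le> 1 / (1 + (c * k * t)\<^sup>2)" for t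
  proof -
    have "AE \<omega> in M. X \<omega> = k * Re (I \<omega>)"
      using XI by eventually_elim (simp add: complex_eq_iff k_def)
    then have "AE \<omega> in M. iexp (t * X \<omega>) = iexp ((t * k) * Re (I \<omega>))"
      by eventually_elim (simp only: mult.assoc)
    then have "char (distr M borel X) t = (\<integral>\<omega>. iexp ((t * k) * Re (I \<omega>)) \<partial>M)"
      unfolding char_def by (subst integral_distr) (auto intro!: integral_cong_AE)
    moreover have "(\<lambda>n. cmod (\<integral>\<omega>. iexp ((t * k) * Re (simple_double_integral W (D n) (a n) \<omega>)) \<partial>M))
        \<longlonglongrightarrow> cmod (\<integral>\<omega>. iexp ((t * k) * Re (I \<omega>)) \<partial>M)"
      by (intro tendsto_norm char_tendsto_if_mean_square_tendsto Sm I l2I)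
    moreover have "\<forall>\<^sub>F n in sequentially.
        cmod (\<integral>\<omega>. iexp ((t * k) * Re (simple_double_integral W (D n) (a n) \<omega>)) \<partial>M) \<le> 1 / (1 + (c * (t * k))\<^sup>2)"
      using bound by eventually_elim blast
    ultimately have "cmod (char (distr M borel X) t) \<le> 1 / (1 + (c * (t * k))\<^sup>2)"
      by (simp only:) (rule tendsto_upperbound[OF _ _ sequentially_bot])
    then show ?thesis by (simp only: mult_ac)
  qed
  have "integrable lborel (char (distr M borel X))"
  proof (rule Bochner_Integration.integrable_bound)
    show "integrable lborel (\<lambda>t. 1 / (1 + (c * k * t)\<^sup>2))"
      using c k by (intro integrable_inverse_1_plus_scaled_square) simp
    show "AE t in lborel. norm (char (distr M borel X) t) \<le> norm (1 / (1 + (c * k * t)\<^sup>2))"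
    proof (rule AE_I2)
      fix t
      have "0 \<le> 1 / (1 + (c * k * t)\<^sup>2)" by (intro divide_nonneg_nonneg add_nonneg_nonneg) auto
      with char_bound[of t] show "norm (char (distr M borel X) t) \<le> norm (1 / (1 + (c * k * t)\<^sup>2))"
        by (simp only: real_norm_def abs_of_nonneg)
    qed
  qed simp
  from X.density_if_char_integrable[OF this] obtain p where p: "\<forall>z. 0 \<le> p z" "p \<in> borel_measurable borel"
    "distr M borel X = density lborel (\<lambda>z. ennreal (p z))"
    "\<forall>z. (cdf (distr M borel X) has_real_derivative p z) (at z)" "bdd_above (range p)"
    by blast
  have "cdf (distr M borel X) = (\<lambda>z. measure M {\<omega> \<in> space M. X \<omega> \<le> z})"
  proof
    fix z
    have "cdf (distr M borel X) z = measure M (X -` {..z} \<inter> space M)"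
      unfolding cdf_def by (rule measure_distr) auto
    also have "X -` {..z} \<inter> space M = {\<omega> \<in> space M. X \<omega> \<le> z}" by auto
    finally show "cdf (distr M borel X) z = measure M {\<omega> \<in> space M. X \<omega> \<le> z}" .
  qed
  moreover have "distributed M lborel X (\<lambda>z. ennreal (p z))"
  proof -
    have "distr M lborel X = distr M borel X" by (rule distr_cong) auto
    then show ?thesis using p(2,3) unfolding distributed_def by simp
  qed
  ultimately show ?thesis using p by (intro exI[of _ p]) auto
qed

end
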